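(* Let $\mathsf{G}$ be a finite, directed, strongly connected multigraph with vertex set $\{1,\dots,m\}$, adjacency matrix $D=(d_{ij})$ and $d_i=\sum_j d_{ij}$, and fix a generation function $\chi=(\chi_i)_{i\in\mathsf{G}}$. For $i\in\mathsf{G}$ let $\mathcal{T}_i$ be the directed cover of $\mathsf{G}$ with root $r$ of type $i$, planar-embedded according to $\chi$. Let $\mathcal{D}=(\mathcal{D}_1,\dots,\mathcal{D}_m)$, where each $\mathcal{D}_j$ is a probability distribution on $\{0,\dots,d_j\}$, and let $\rho$ be a random initial rotor configuration on $\mathcal{T}_i$ in which the $\rho(x)$, $x\in\mathcal{T}_i$, are independent and $\rho(x)$ has distribution $\mathcal{D}_j$ whenever $\tau(x)=j$. Let $M(\mathcal{D})$ be the first moment matrix of the multitype branching process of good children defined below, and $\mathrm{r}(M(\mathcal{D}))$ its spectral radius. Run transfinite rotor-router walks from the root. Then almost surely: (a) (Recurrence) if $\mathrm{r}(M(\mathcal{D}))\le 1$, then $E_n(\mathcal{T}_i,\rho)=0$ for all $n\ge 0$ and all $i\in\mathsf{G}$; (b) (Transience) if $\mathrm{r}(M(\mathcal{D}))>1$, then $\lim_{n\to\infty} E_n(\mathcal{T}_i,\rho)/n=\mathcal{E}_i$ for all $i\in\mathsf{G}$, where $\mathcal{E}_i$ is the probability that simple random walk on $\mathcal{T}_i$ started at the root $r$ never returns to $r$.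
   Context: Directed cover: $\mathcal{T}_i$ is the rooted tree whose root $r$ has label (type) $i$, and recursively a vertex of type $j$ has $d_{jk}$ children of type $k$; $\tau(x)$ denotes the type of $x$. A generation function $\chi=(\chi_j)$, $\chi_j:\{1,\dots,d_j\}\to\mathsf{G}$ with $\#\chi_j^{-1}(k)=d_{jk}$, orders the children: a vertex $x$ of type $j$ has children $x^{(1)},\dots,x^{(d_j)}$ with $\tau(x^{(k)})=\chi_j(k)$; $x^{(0)}$ is the parent of $x$, and an extra sink vertex $r^{(0)}$ is attached to the root as its parent. The rotor at $x$ takes values $\rho(x)\in\{0,\dots,d_{\tau(x)}\}$ meaning it points to $x^{(\rho(x))}$; the cyclic order of neighbours is $x^{(0)},x^{(1)},\dots,x^{(d_{\tau(x)})}$. Rotor-router walk step: at current position $x$ with $\rho(x)=k$, set $\rho(x)=k+1 \pmod{d_{\tau(x)}+1}$ and move to $x^{(k+1)}$. Transfinite rotor-router walk: particles are started one after another at $r$; each performs a rotor-router walk until it returns to $r$ (hits $r^{(0)}$) or escapes to infinity (visiting each vertex finitely often); rotors are not reset between particles. $E_n(\mathcal{T}_i,\rho)$ is the number of the first $n$ particles that escape to infinity. Good children: for $k\in\{0,\dots,d_i\}$ and $j\in\mathsf{G}$, $\mathfrak{C}_i^j(k)=\#\{l\in\{k+1,\dots,d_i\}:\chi_i(l)=j\}$. The multitype branching process on types $\{1,\dots,m\}$ has offspring law: a particle of type $i$ has, for each $k\in\{0,\dots,d_i\}$ with probability $\mathcal{D}_i(k)$, exactly $\mathfrak{C}_i^j(k)$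 children of type $j$ for every $j$. Its first moment matrix is $M(\mathcal{D})=(m_{ij})$ with $m_{ij}=\sum_{k=0}^{d_i}\mathcal{D}_i(k)\,\mathfrak{C}_i^j(k)$, the expected number of type-$j$ offspring of a type-$i$ particle.
   Formalization: Part (a) is proved under the added condition that no nonempty set C of types exists in which every type almost surely has exactly one good child with type in C; without it (a) is false (one vertex, one loop, all rotors 0). In (b), "returns to r" means hitting r^(0). *)

theory Defs
  imports
    "HOL-Probability.Probability"
    "Graph_Theory.Digraph_Component"
    "Jordan_Normal_Form.Spectral_Radius"
begin

section \<open>The multigraph and its directed covers\<close>

definition adj :: "(nat, 'e) pre_digraph \<Rightarrow> nat \<Rightarrow> nat \<Rightarrow> nat" where
  "adj G j k = card {e \<in> arcs G. tail G e = j \<and> head G e = k}"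

definition deg :: "(nat, 'e) pre_digraph \<Rightarrow> nat \<Rightarrow> nat" where
  "deg G j = (\<Sum>k\<in>verts G. adj G j k)"

definition generation_function :: "(nat, 'e) pre_digraph \<Rightarrow> (nat \<Rightarrow> nat \<Rightarrow> nat) \<Rightarrow> bool" where
  "generation_function G chi \<longleftrightarrow>
     (\<forall>j\<in>verts G. chi j ` {1..deg G j} \<subseteq> verts G \<and>
        (\<forall>k\<in>verts G. card {l \<in> {1..deg G j}. chi j l = k} = adj G j k))"

text \<open>A vertex of a planar rooted tree is the list of child indices on the path from it
  up to the root: the root is \<open>[]\<close> and the \<open>k\<close>-th child of \<open>x\<close> is \<open>k # x\<close>.\<close>

type_synonym vertex = "nat list"

primrec vtype :: "(nat \<Rightarrow> nat \<Rightarrow> nat) \<Rightarrow> nat \<Rightarrow> vertex \<Rightarrow> nat" where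
  "vtype chi i [] = i"
| "vtype chi i (k # x) = chi (vtype chi i x) k"

inductive_set directed_cover :: "(nat, 'e) pre_digraph \<Rightarrow> (nat \<Rightarrow> nat \<Rightarrow> nat) \<Rightarrow> nat \<Rightarrow> vertex set"
  for G chi i where
  root: "[] \<in> directed_cover G chi i"
| child: "x \<in> directed_cover G chi i \<Longrightarrow> k \<in> {1..deg G (vtype chi i x)}
    \<Longrightarrow> k # x \<in> directed_cover G chi i"

text \<open>Number of children of \<open>x\<close> in the directed cover with root type \<open>i\<close>.\<close>

definition nchildren :: "(nat, 'e) pre_digraph \<Rightarrow> (nat \<Rightarrow> nat \<Rightarrow> nat) \<Rightarrow> nat \<Rightarrow> vertex \<Rightarrow> nat" where
  "nchildren G chi i x = deg G (vtype chi i x)"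

text \<open>Positions are vertices of the tree with the extra sink \<open>r\<^sup>(\<^sup>0\<^sup>)\<close>
  attached to the root; the sink is \<open>None\<close>.  \<open>neighbour x k\<close> is the vertex \<open>x\<^sup>(\<^sup>k\<^sup>)\<close>.\<close>

type_synonym position = "vertex option"

definition neighbour :: "vertex \<Rightarrow> nat \<Rightarrow> position" where
  "neighbour x k =
     (if k = 0 then (case x of [] \<Rightarrow> None | _ # parent \<Rightarrow> Some parent) else Some (k # x))"


section \<open>Transfinite rotor-router walks\<close>

type_synonym rotors = "vertex \<Rightarrow> nat"

text \<open>The particle is absorbed in the sink.\<close>

fun rotor_step :: "(nat, 'e) pre_digraph \<Rightarrow> (nat \<Rightarrow> nat \<Rightarrow> nat) \<Rightarrow> nat
    \<Rightarrow> rotors \<times> position \<Rightarrow> rotors \<times> position" where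
  "rotor_step G chi i (\<rho>, None) = (\<rho>, None)"
| "rotor_step G chi i (\<rho>, Some x) =
     (let k = (\<rho> x + 1) mod (nchildren G chi i x + 1) in (\<rho>(x := k), neighbour x k))"

definition rotor_walk :: "(nat, 'e) pre_digraph \<Rightarrow> (nat \<Rightarrow> nat \<Rightarrow> nat) \<Rightarrow> nat
    \<Rightarrow> rotors \<Rightarrow> nat \<Rightarrow> rotors \<times> position" where
  "rotor_walk G chi i \<rho> t = (rotor_step G chi i ^^ t) (\<rho>, Some [])"

definition escapes :: "(nat, 'e) pre_digraph \<Rightarrow> (nat \<Rightarrow> nat \<Rightarrow> nat) \<Rightarrow> nat \<Rightarrow> rotors \<Rightarrow> bool" where
  "escapes G chi i \<rho> \<longleftrightarrow>
     (\<forall>t. snd (rotor_walk G chi i \<rho> t) \<noteq> None) \<and>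
     (\<forall>x. finite {t. snd (rotor_walk G chi i \<rho> t) = Some x})"

text \<open>The configuration left behind by one particle.  Whether the particle is absorbed or
  escapes, it visits each vertex finitely often, so each rotor is eventually constant.\<close>

definition rotors_after :: "(nat, 'e) pre_digraph \<Rightarrow> (nat \<Rightarrow> nat \<Rightarrow> nat) \<Rightarrow> nat \<Rightarrow> rotors \<Rightarrow> rotors" where
  "rotors_after G chi i \<rho> x =
     (THE k. eventually (\<lambda>t. fst (rotor_walk G chi i \<rho> t) x = k) sequentially)"

definition escape_count :: "(nat, 'e) pre_digraph \<Rightarrow> (nat \<Rightarrow> nat \<Rightarrow> nat) \<Rightarrow> nat
    \<Rightarrow> rotors \<Rightarrow> nat \<Rightarrow> nat" where
  "escape_count G chi i \<rho> n = card {k. k < n \<and> escapes G chi i ((rotors_after G chi i ^^ k) \<rho>)}"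


section \<open>Simple random walk\<close>

definition srw_step :: "(nat, 'e) pre_digraph \<Rightarrow> (nat \<Rightarrow> nat \<Rightarrow> nat) \<Rightarrow> nat
    \<Rightarrow> position \<Rightarrow> position pmf" where
  "srw_step G chi i p =
     (case p of None \<Rightarrow> return_pmf (Some [])
      | Some x \<Rightarrow> map_pmf (neighbour x) (pmf_of_set {0..nchildren G chi i x}))"

definition srw_kernel :: "(nat, 'e) pre_digraph \<Rightarrow> (nat \<Rightarrow> nat \<Rightarrow> nat) \<Rightarrow> nat
    \<Rightarrow> nat \<Rightarrow> (nat \<Rightarrow> position) \<Rightarrow> position measure" where
  "srw_kernel G chi i n \<omega> =
     measure_pmf (case n of 0 \<Rightarrow> return_pmf (Some []) | Suc k \<Rightarrow> srw_step G chi i (\<omega> k))"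

lemma Ionescu_Tulcea_srw: "Ionescu_Tulcea (srw_kernel G chi i) (\<lambda>_. count_space UNIV)"
proof (rule Ionescu_Tulcea.intro)
  fix n
  show "srw_kernel G chi i n
      \<in> measurable (PiM {0..<n} (\<lambda>_. count_space UNIV)) (subprob_algebra (count_space UNIV))"
  proof (cases n)
    case 0
    then show ?thesis
      by (auto simp: srw_kernel_def[abs_def] space_subprob_algebra
          intro!: measurable_const prob_space_imp_subprob_space measure_pmf.prob_space_axioms)
  next
    case (Suc k)
    have "(\<lambda>p. measure_pmf (srw_step G chi i p))
        \<in> measurable (count_space UNIV) (subprob_algebra (count_space UNIV))"
      by (rule measurable_measure_pmf)
    moreover have "(\<lambda>\<omega>. \<omega> k) \<in> measurable (PiM {0..<n} (\<lambda>_. count_space UNIV)) (count_space UNIV)"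
      using Suc by (intro measurable_component_singleton) auto
    ultimately show ?thesis
      using measurable_compose[of "\<lambda>\<omega>. \<omega> k" _ "count_space UNIV"]
      by (simp add: srw_kernel_def[abs_def] Suc)
  qed
qed (simp add: srw_kernel_def measure_pmf.prob_space_axioms)

text \<open>The law, on trajectories, of simple random walk started at the root.\<close>

definition srw :: "(nat, 'e) pre_digraph \<Rightarrow> (nat \<Rightarrow> nat \<Rightarrow> nat) \<Rightarrow> nat \<Rightarrow> (nat \<Rightarrow> position) measure" where
  "srw G chi i = projective_family.lim UNIV
     (Ionescu_Tulcea.CI (srw_kernel G chi i) (\<lambda>_. count_space UNIV)) (\<lambda>_. count_space UNIV)"

lemma srw_cylinder:
  "emeasure (srw G chi i) {\<omega> \<in> space (srw G chi i). \<forall>t\<le>n. \<omega> t = xs t} =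
     ennreal ((if xs 0 = Some [] then 1 else 0) *
       (\<Prod>t<n. pmf (srw_step G chi i (xs t)) (xs (Suc t))))"
proof -
  let ?M = "\<lambda>_::nat. count_space (UNIV :: position set)"
  interpret IT: Ionescu_Tulcea "srw_kernel G chi i" ?M
    by (rule Ionescu_Tulcea_srw)
  let ?A = "\<lambda>n. PiE {0..<Suc n} (\<lambda>t. {xs t})"
  let ?p = "\<lambda>n. ennreal ((if xs 0 = Some [] then 1 else 0) *
       (\<Prod>t<n. pmf (srw_step G chi i (xs t)) (xs (Suc t))))"
  let ?q = "\<lambda>n. emeasure (srw_kernel G chi i n xs) {xs n}"
  have A[measurable]: "?A n \<in> sets (PiM {0..<Suc n} ?M)" for n
    by (intro sets_PiM_I_finite) auto
  have step: "emeasure (IT.eP n \<omega>) (?A n) =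
      (if \<forall>t<n. \<omega> t = xs t then emeasure (srw_kernel G chi i n \<omega>) {xs n} else 0)"
    if "\<omega> \<in> space (PiM {0..<n} ?M)" for n \<omega>
  proof -
    have ext: "\<omega> \<in> extensional {0..<n}"
      using that by (auto simp: space_PiM PiE_def)
    have "emeasure (IT.eP n \<omega>) (?A n) =
        emeasure (srw_kernel G chi i n \<omega>) ((\<lambda>x. fun_upd \<omega> n x) -` ?A n \<inter> space (?M n))"
      by (rule IT.emeasure_eP[OF that A])
    also have "(\<lambda>x. fun_upd \<omega> n x) -` ?A n \<inter> space (?M n) =
        (if \<forall>t<n. \<omega> t = xs t then {xs n} else {})"
      using ext
      by (auto simp: PiE_iff extensional_def atLeastLessThanSuc split: if_splits dest!: bspec)
    finally show ?thesis by auto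
  qed
  have C: "emeasure (IT.C 0 (Suc n) (\<lambda>_. undefined)) (?A n) = ?p n" for n
  proof (induction n)
    case 0
    have u: "(\<lambda>_. undefined) \<in> space (PiM {0..<0} ?M)"
      by (simp add: space_PiM)
    have "emeasure (IT.C 0 (Suc 0) (\<lambda>_. undefined)) (?A 0) =
        emeasure (IT.eP 0 (\<lambda>_. undefined)) (?A 0)"
      using u IT.measurable_eP[of 0] by (simp del: atLeastLessThan0 add: bind_return)
    also have "\<dots> = ?p 0"
      by (subst step[OF u]) (auto simp: srw_kernel_def emeasure_pmf_single indicator_def)
    finally show ?case .
  next
    case (Suc n)
    have u: "(\<lambda>_. undefined) \<in> space (PiM {0..<0} ?M)"
      by (simp add: space_PiM)
    let ?C = "IT.C 0 (Suc n) (\<lambda>_. undefined)"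
    have sp: "space ?C = space (PiM {0..<Suc n} ?M)" and se: "sets ?C = sets (PiM {0..<Suc n} ?M)"
      using IT.space_C[OF u, of "Suc n"] IT.sets_C[OF u, of "Suc n"] by simp_all
    have "emeasure (IT.C 0 (Suc (Suc n)) (\<lambda>_. undefined)) (?A (Suc n)) =
        emeasure (?C \<bind> IT.eP (Suc n)) (?A (Suc n))"
      by simp
    also have "\<dots> = (\<integral>\<^sup>+\<omega>. emeasure (IT.eP (Suc n) \<omega>) (?A (Suc n)) \<partial>?C)"
    proof (rule emeasure_bind)
      show "space ?C \<noteq> {}" using IT.prob_space_C[OF u] prob_space.not_empty by blast
      show "IT.eP (Suc n) \<in> measurable ?C (subprob_algebra (PiM {0..<Suc (Suc n)} ?M))"
        using IT.measurable_eP[of "Suc n"] unfolding measurable_cong_sets[OF se refl] .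
    qed (rule A)
    also have "\<dots> = (\<integral>\<^sup>+\<omega>. ennreal (pmf (srw_step G chi i (xs n)) (xs (Suc n))) *
        indicator (?A n) \<omega> \<partial>?C)"
    proof (rule nn_integral_cong)
      fix \<omega> assume "\<omega> \<in> space ?C"
      then have w: "\<omega> \<in> space (PiM {0..<Suc n} ?M)" using sp by simp
      then have ext: "\<omega> \<in> extensional {0..<Suc n}"
        by (auto simp: space_PiM PiE_def)
      have "(\<forall>t<Suc n. \<omega> t = xs t) \<longleftrightarrow> \<omega> \<in> ?A n"
        using ext by (auto simp: PiE_iff)
      then show "emeasure (IT.eP (Suc n) \<omega>) (?A (Suc n)) =
          ennreal (pmf (srw_step G chi i (xs n)) (xs (Suc n))) * indicator (?A n) \<omega>"
        by (subst step[OF w]) (auto simp: srw_kernel_def emeasure_pmf_single indicator_def)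
    qed
    also have "\<dots> = ennreal (pmf (srw_step G chi i (xs n)) (xs (Suc n))) * emeasure ?C (?A n)"
      by (rule nn_integral_cmult_indicator) (simp only: se A)
    also have "\<dots> = ?p (Suc n)"
      unfolding Suc.IH by (simp add: ennreal_mult[symmetric] prod_nonneg mult_ac)
    finally show ?case .
  qed
  have "emeasure IT.PF.lim (IT.PF.emb UNIV {0..<Suc n} (?A n)) = emeasure (IT.CI {0..<Suc n}) (?A n)"
    by (rule IT.lim) (auto intro: A)
  also have "\<dots> = emeasure (IT.C 0 (Suc n) (\<lambda>_. undefined)) (IT.PF.emb {0..<Suc n} {0..<Suc n} (?A n))"
    by (rule IT.emeasure_CI) (auto intro: A)
  also have "IT.PF.emb {0..<Suc n} {0..<Suc n} (?A n) = ?A n"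
    by (rule prod_emb_id) (auto simp: PiE_def)
  also have "IT.PF.emb UNIV {0..<Suc n} (?A n) =
      {\<omega> \<in> space (srw G chi i). \<forall>t\<le>n. \<omega> t = xs t}"
    by (auto simp: srw_def prod_emb_def space_PiM PiE_iff less_Suc_eq_le restrict_def)
  finally show ?thesis
    unfolding C by (simp add: srw_def)
qed

text \<open>As for the rotor-router walk, returning means reaching the sink above the root; visits
  to the root itself do not count.\<close>

definition srw_escape_prob :: "(nat, 'e) pre_digraph \<Rightarrow> (nat \<Rightarrow> nat \<Rightarrow> nat) \<Rightarrow> nat \<Rightarrow> real" where
  "srw_escape_prob G chi i = measure (srw G chi i) {\<omega> \<in> space (srw G chi i). \<forall>t. \<omega> t \<noteq> None}"


section \<open>The branching process of good children\<close>

definition good_children :: "(nat, 'e) pre_digraph \<Rightarrow> (nat \<Rightarrow> nat \<Rightarrow> nat) \<Rightarrow> nat \<Rightarrow> nat \<Rightarrow> nat \<Rightarrow> nat" where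
  "good_children G chi i k j = card {l \<in> {k+1..deg G i}. chi i l = j}"

definition offspring :: "(nat, 'e) pre_digraph \<Rightarrow> (nat \<Rightarrow> nat \<Rightarrow> nat) \<Rightarrow> (nat \<Rightarrow> nat pmf)
    \<Rightarrow> nat \<Rightarrow> (nat \<Rightarrow> nat) pmf" where
  "offspring G chi \<D> i = map_pmf (good_children G chi i) (\<D> i)"

definition mean_offspring :: "(nat, 'e) pre_digraph \<Rightarrow> (nat \<Rightarrow> nat \<Rightarrow> nat) \<Rightarrow> (nat \<Rightarrow> nat pmf)
    \<Rightarrow> nat \<Rightarrow> nat \<Rightarrow> real" where
  "mean_offspring G chi \<D> i j = (\<Sum>k=0..deg G i. pmf (\<D> i) k * real (good_children G chi i k j))"

text \<open>Types are \<open>1, \<dots>, m\<close>, whereas matrix indices start at \<open>0\<close>.\<close>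

definition first_moment_matrix :: "(nat, 'e) pre_digraph \<Rightarrow> (nat \<Rightarrow> nat \<Rightarrow> nat) \<Rightarrow> (nat \<Rightarrow> nat pmf)
    \<Rightarrow> nat \<Rightarrow> complex mat" where
  "first_moment_matrix G chi \<D> m =
     mat m m (\<lambda>(a, b). complex_of_real (mean_offspring G chi \<D> (Suc a) (Suc b)))"

text \<open>The degenerate case of branching process theory: a set of types within which every
  particle almost surely has exactly one child, so that such a particle's line never dies out.
  Recurrence at spectral radius at most 1 fails precisely here; for instance, one type with one
  loop and all rotors initially 0 gives a ray along which the first particle escapes.\<close>

definition singular :: "(nat, 'e) pre_digraph \<Rightarrow> (nat \<Rightarrow> nat \<Rightarrow> nat) \<Rightarrow> (nat \<Rightarrow> nat pmf) \<Rightarrow> bool" where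
  "singular G chi \<D> \<longleftrightarrow>
     (\<exists>C. C \<noteq> {} \<and> C \<subseteq> verts G \<and> (\<forall>j\<in>C. AE z in offspring G chi \<D> j. (\<Sum>k\<in>C. z k) = 1))"

end

theory Submission
  imports Defs "HOL-Library.Sublist"
begin

text \<open>
  For \<open>n\<close> particles let \<open>U x\<close> and \<open>D x\<close> count the moves from the parent of a vertex \<open>x\<close> to \<open>x\<close>
  and back, and put \<open>E x = U x - D x\<close>.  Then \<open>E\<close> is additive over children, each child \<open>c\<close> of \<open>x\<close>
  satisfies \<open>\<bar>U c - D x\<bar> \<le> 1\<close>, with \<open>U c \<ge> D x\<close> for good children and \<open>U c \<le> D x\<close> for the others, and
  everything below uses only these relations.  Hence bounds \<open>E c \<le> a c * U c + O(1)\<close> at the children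
  give the bound with \<open>a x = S / (1 + S)\<close>, \<open>S = \<Sum> a c\<close>, at \<open>x\<close>, and likewise for lower bounds; this
  is the recursion for the escape probabilities of simple random walk.  Its fixed point attracts every
  positive starting value, so it remains to find a positive linear lower bound.

  A vertex is live if it starts an infinite line of good children.  A live vertex that is visited has
  \<open>E > 0\<close>, and conversely \<open>E > 0\<close> forces a live vertex, because \<open>U\<close> decreases at every bad step of a line
  with \<open>E > 0\<close>.  So recurrence is extinction of the branching process.  In the supercritical case, a
  fixed proportion of the \<open>2^k\<close> leaves of an embedded binary tree of depth \<open>k\<close> is live for all large \<open>k\<close>,
  and with \<open>2^k\<close> close to \<open>n\<close> the relations above force linearly many of them to be visited or \<open>E\<close>
  to be linear at the root.
\<close>

section \<open>Rotor walks as flows on the tree\<close>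

text \<open>What shapes the transient case is the additive constants. A fixed number of uses of the
  recursion is harmless after division by \<open>n\<close>, but it preserves a positive lower bound
  without creating one, and the errors are not controlled when the number of uses grows with
  \<open>n\<close>. The initial bound therefore comes from a separate argument at depth about log2
  \<open>n\<close> that tracks only the loss of \<open>U\<close> on the way to the leaves. A step
  from a vertex below \<open>x\<close> to a child costs at most \<open>E x + 1\<close> entries, and
  as \<open>E\<close> is additive, disjoint branches share one total: either most leaves are reached
  or \<open>E\<close> is already linear. The random rotors enter this only through admissibility and
  the proportions of live leaves, almost surely at all of the countably many vertices of one type.
  Strong connectivity carries the bound to the other types. Survival uses the moduli of an
  eigenvector, extinction the polynomial growth of matrix powers.\<close>

text \<open>How often a rotor with positions \<open>0, \<dots>, d\<close>, started at \<open>c\<close>, points to \<open>k\<close> in its next \<open>n\<close> moves.\<close>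

definition rotor_outs :: "nat \<Rightarrow> nat \<Rightarrow> nat \<Rightarrow> nat \<Rightarrow> nat" where
  "rotor_outs d c n k = (\<Sum>v<n. of_bool ((c + Suc v) mod Suc d = k))"

lemma rotor_outs_0 [simp]: "rotor_outs d c 0 k = 0"
  by (simp add: rotor_outs_def)

lemma rotor_outs_Suc:
  "rotor_outs d c (Suc n) k = rotor_outs d c n k + of_bool ((c + Suc n) mod Suc d = k)"
  by (simp add: rotor_outs_def)

text \<open>After \<open>n\<close> moves the rotor stands at \<open>(c + n) mod Suc d\<close>, where
  the next particle resumes; this lets the counts of successive particles be added.\<close>

lemma rotor_outs_add:
  "rotor_outs d c (n + n') k = rotor_outs d c n k + rotor_outs d ((c + n) mod Suc d) n' k"
proof (induction n')
  case (Suc n')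
  have "((c + n) mod Suc d + Suc n') mod Suc d = (c + Suc (n + n')) mod Suc d"
    unfolding mod_add_left_eq by (simp add: add_ac)
  then show ?case
    using Suc by (simp add: rotor_outs_Suc)
qed simp

lemma rotor_outs_le: "rotor_outs d c n k \<le> n"
  by (induction n) (auto simp: rotor_outs_Suc)

text \<open>The right side counts the numbers in \<open>{0..c + n}\<close> congruent to
  \<open>k\<close> modulo \<open>Suc d\<close>. Those in \<open>{0..c}\<close> precede the first
  move and contribute only \<open>k\<close> itself, if \<open>k \<le> c\<close>. Adding
  \<open>Suc d\<close> before subtracting \<open>k\<close> keeps the natural subtraction
  exact.\<close>

lemma rotor_outs_closed_form:
  assumes "c \<le> d" "k \<le> d"
  shows "rotor_outs d c n k + of_bool (k \<le> c) = (c + n + Suc d - k) div Suc d"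
proof (induction n)
  case 0
  show ?case
    using assms by (cases "k \<le> c") (auto simp: div_if)
next
  case (Suc n)
  have eq: "c + Suc n + Suc d - k = Suc (c + n + Suc d - k)"
    using assms by simp
  define r where "r = (c + Suc n) mod Suc d"
  have r: "r \<le> d"
    unfolding r_def by (metis less_Suc_eq_le mod_less_divisor zero_less_Suc)
  have "Suc (c + n + Suc d - k) mod Suc d = (r + (Suc d - k)) mod Suc d"
    using assms unfolding r_def mod_add_left_eq by (simp add: Suc_diff_le)
  also have "\<dots> = (if r < k then r + (Suc d - k) else r - k)"
    using assms r by (auto simp: not_less mod_if)
  finally have "Suc (c + n + Suc d - k) mod Suc d = 0 \<longleftrightarrow> (c + Suc n) mod Suc d = k"
    using assms r unfolding r_def[symmetric] by auto
  then show ?case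
    using Suc unfolding eq div_Suc by (auto simp: rotor_outs_Suc)
qed

lemma rotor_outs_zero:
  assumes "c \<le> d"
  shows "rotor_outs d c n 0 = (c + n) div Suc d"
  using rotor_outs_closed_form[OF assms, of 0 n] div_add_self2[of "Suc d" "c + n"] by simp

text \<open>Moving cyclically from \<open>c\<close>, the rotor meets \<open>k\<close> before
  \<open>0\<close> if \<open>c < k\<close> and after \<open>0\<close> otherwise. So the initial
  position decides which count leads, and the lead is at most one. This is the source of the notion
  of a good child.\<close>

lemma rotor_outs_balanced:
  assumes "c \<le> d" "1 \<le> k" "k \<le> d"
  shows "c < k \<Longrightarrow> rotor_outs d c n 0 \<le> rotor_outs d c n k"
    and "c < k \<Longrightarrow> rotor_outs d c n k \<le> rotor_outs d c n 0 + 1"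
    and "k \<le> c \<Longrightarrow> rotor_outs d c n k \<le> rotor_outs d c n 0"
    and "k \<le> c \<Longrightarrow> rotor_outs d c n 0 \<le> rotor_outs d c n k + 1"
proof -
  have "(c + n) div Suc d \<le> (c + n + Suc d - k) div Suc d"
    using assms by (intro div_le_mono) simp
  moreover have "(c + n + Suc d - k) div Suc d \<le> (c + n + Suc d) div Suc d"
    by (intro div_le_mono) simp
  ultimately have *: "(c + n) div Suc d \<le> rotor_outs d c n k + of_bool (k \<le> c)"
      "rotor_outs d c n k + of_bool (k \<le> c) \<le> (c + n) div Suc d + 1"
    using rotor_outs_closed_form[OF assms(1,3), of n] div_add_self2[of "Suc d" "c + n"] by simp_all
  note z = rotor_outs_zero[OF assms(1), of n]
  show "c < k \<Longrightarrow> rotor_outs d c n 0 \<le> rotor_outs d c n k"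
    "c < k \<Longrightarrow> rotor_outs d c n k \<le> rotor_outs d c n 0 + 1"
    "k \<le> c \<Longrightarrow> rotor_outs d c n k \<le> rotor_outs d c n 0"
    "k \<le> c \<Longrightarrow> rotor_outs d c n 0 \<le> rotor_outs d c n k + 1"
    using * unfolding z by (auto split: if_splits)
qed

lemma suffix_siblings: "suffix (k # x) y \<Longrightarrow> suffix (l # x) y \<Longrightarrow> k = l"
  using suffix_length_suffix[of "k # x" y "l # x"] suffix_order.antisym
    suffix_length_suffix[of "l # x" y "k # x"]
  by auto

section \<open>One particle: edge counts, visits and escape below a vertex\<close>

locale rotor_tree =
  fixes G :: "(nat, 'e) pre_digraph" and chi :: "nat \<Rightarrow> nat \<Rightarrow> nat" and i :: nat
begin

abbreviation T :: "vertex set" where "T \<equiv> directed_cover G chi i"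
abbreviation tau :: "vertex \<Rightarrow> nat" where "tau \<equiv> vtype chi i"
abbreviation nch :: "vertex \<Rightarrow> nat" where "nch \<equiv> nchildren G chi i"

definition admissible :: "rotors \<Rightarrow> bool" where
  "admissible \<rho> \<longleftrightarrow> (\<forall>x\<in>T. \<rho> x \<le> nch x)"

lemma child_in_T: "x \<in> T \<Longrightarrow> 1 \<le> l \<Longrightarrow> l \<le> nch x \<Longrightarrow> l # x \<in> T"
  by (rule directed_cover.child) (auto simp: nchildren_def)

lemma append_in_T: "zs @ x \<in> T \<Longrightarrow> x \<in> T"
  by (induction zs) (auto elim: directed_cover.cases)

lemma Cons_in_T: "l # x \<in> T \<longleftrightarrow> x \<in> T \<and> 1 \<le> l \<and> l \<le> nch x"
  by (auto simp: child_in_T nchildren_def elim: directed_cover.cases)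

definition pos :: "rotors \<Rightarrow> nat \<Rightarrow> position" where
  "pos \<rho> t = snd (rotor_walk G chi i \<rho> t)"

definition visits :: "rotors \<Rightarrow> nat \<Rightarrow> vertex \<Rightarrow> nat" where
  "visits \<rho> t x = (\<Sum>s<t. of_bool (pos \<rho> s = Some x))"

text \<open>\<open>V x\<close> is read as the number of moves made at \<open>x\<close>. As rotors
  move deterministically, \<open>V\<close> alone fixes how often each edge is used, whatever the
  order of the moves.\<close>

definition exits :: "rotors \<Rightarrow> (vertex \<Rightarrow> nat) \<Rightarrow> vertex \<Rightarrow> nat" where
  "exits \<rho> V x = rotor_outs (nch x) (\<rho> x) (V x) 0"

text \<open>The number \<open>n\<close> of particles started at the root counts as its number of entries.\<close>

definition entries :: "rotors \<Rightarrow> nat \<Rightarrow> (vertex \<Rightarrow> nat) \<Rightarrow> vertex \<Rightarrow> nat" where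
  "entries \<rho> n V x = (case x of [] \<Rightarrow> n | l # y \<Rightarrow> rotor_outs (nch y) (\<rho> y) (V y) l)"

lemma pos_0 [simp]: "pos \<rho> 0 = Some []"
  by (simp add: pos_def rotor_walk_def)

lemma rotor_walk_Suc:
  "rotor_walk G chi i \<rho> (Suc t) = rotor_step G chi i (rotor_walk G chi i \<rho> t)"
  by (simp add: rotor_walk_def)

lemma pos_Suc:
  "pos \<rho> (Suc t) = (case pos \<rho> t of None \<Rightarrow> None
     | Some x \<Rightarrow> neighbour x ((fst (rotor_walk G chi i \<rho> t) x + 1) mod (nch x + 1)))"
  unfolding pos_def rotor_walk_Suc
  by (cases "rotor_walk G chi i \<rho> t"; cases "snd (rotor_walk G chi i \<rho> t)") (auto simp: Let_def)

lemma visits_0 [simp]: "visits \<rho> 0 x = 0"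
  and visits_Suc: "visits \<rho> (Suc t) x = visits \<rho> t x + of_bool (pos \<rho> t = Some x)"
  by (simp_all add: visits_def)

lemma rotor_after_visits:
  assumes "\<rho> x \<le> nch x"
  shows "fst (rotor_walk G chi i \<rho> t) x = (\<rho> x + visits \<rho> t x) mod Suc (nch x)"
proof (induction t)
  case 0
  show ?case using assms by (simp add: rotor_walk_def)
next
  case (Suc t)
  show ?case
  proof (cases "pos \<rho> t")
    case None
    then have "rotor_walk G chi i \<rho> (Suc t) = rotor_walk G chi i \<rho> t"
      unfolding rotor_walk_Suc by (cases "rotor_walk G chi i \<rho> t") (auto simp: pos_def)
    then show ?thesis using Suc None by (simp add: visits_Suc)
  next
    case (Some y)
    obtain r where r: "rotor_walk G chi i \<rho> t = (r, Some y)"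
      using Some by (cases "rotor_walk G chi i \<rho> t") (auto simp: pos_def)
    show ?thesis
      using Suc Some unfolding rotor_walk_Suc r
      by (cases "x = y") (auto simp: visits_Suc Let_def mod_Suc_eq)
  qed
qed

lemma pos_in_T:
  assumes "pos \<rho> t = Some x"
  shows "x \<in> T"
  using assms
proof (induction t arbitrary: x)
  case 0
  then show ?case by (simp add: directed_cover.root)
next
  case (Suc t)
  then obtain y where y: "pos \<rho> t = Some y"
    by (auto simp: pos_Suc split: option.splits)
  define k where "k = (fst (rotor_walk G chi i \<rho> t) y + 1) mod (nch y + 1)"
  have "k \<le> nch y"
    unfolding k_def by (simp add: less_Suc_eq_le flip: less_Suc_eq_le)
  moreover have "neighbour y k = Some x"
    using Suc.prems y by (simp add: pos_Suc k_def)
  ultimately show ?case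
    using Suc.IH[OF y] by (auto simp: neighbour_def Cons_in_T split: if_splits list.splits)
qed

text \<open>The edge to the parent is the only way into and out of the subtree of \<open>x\<close>,
  so its two directions are used alternately. At the root the start of the particle counts as an
  entry, hence the argument \<open>1\<close>.\<close>

lemma entries_exits_walk:
  assumes \<rho>: "admissible \<rho>" and x: "x \<in> T"
  shows "entries \<rho> 1 (visits \<rho> t) x =
    exits \<rho> (visits \<rho> t) x + of_bool (\<exists>y. pos \<rho> t = Some y \<and> suffix x y)"
proof (induction t)
  case 0
  then show ?case by (auto simp: entries_def exits_def split: list.splits)
next
  case (Suc t)
  show ?case
  proof (cases "pos \<rho> t")
    case None
    then show ?thesis using Suc
      by (auto simp: entries_def exits_def pos_Suc visits_Suc split: list.splits)
  next
    case (Some y)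
    define k where "k = (\<rho> y + Suc (visits \<rho> t y)) mod Suc (nch y)"
    have "y \<in> T" using Some by (rule pos_in_T)
    then have "\<rho> y \<le> nch y" using \<rho> by (simp add: admissible_def)
    then have pos': "pos \<rho> (Suc t) = neighbour y k"
      using Some by (simp add: pos_Suc k_def rotor_after_visits mod_Suc_eq)
    have en: "entries \<rho> 1 (visits \<rho> (Suc t)) x =
        entries \<rho> 1 (visits \<rho> t) x + of_bool (x = k # y)"
      using Some by (auto simp: entries_def visits_Suc rotor_outs_Suc k_def split: list.splits)
    have ex: "exits \<rho> (visits \<rho> (Suc t)) x =
        exits \<rho> (visits \<rho> t) x + of_bool (x = y \<and> k = 0)"
      using Some by (auto simp: exits_def visits_Suc rotor_outs_Suc k_def)
    have nk: "k = 0 \<Longrightarrow> x \<noteq> k # y" using x by (auto simp: Cons_in_T)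
    have ns: "\<not> suffix (l # z) z" for l z
      using suffix_length_le[of "l # z" z] by auto
    show ?thesis
    proof (cases "k = 0")
      case True
      then show ?thesis
        unfolding en ex Suc.IH pos' using nk[OF True] Some ns[of _ "tl y"]
        by (cases y) (auto simp: neighbour_def suffix_Cons)
    next
      case False
      then show ?thesis
        unfolding en ex Suc.IH pos' using Some ns[of k y]
        by (auto simp: neighbour_def suffix_Cons)
    qed
  qed
qed

text \<open>Exits never exceed entries, and every \<open>Suc (nch x)\<close> consecutive moves at
  \<open>x\<close> contain one exit, so few entries force few visits. A child is entered at most
  once per move at its parent, which passes the bound down from the root.\<close>

lemma visits_bounded:
  assumes \<rho>: "admissible \<rho>" and x: "x \<in> T"
  shows "\<exists>B. \<forall>t. visits \<rho> t x \<le> B"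
  using x
proof (induction rule: directed_cover.induct)
  have bound: "visits \<rho> t x \<le> Suc (nch x) * Suc B"
    if "x \<in> T" "entries \<rho> 1 (visits \<rho> t) x \<le> B" for x t B
  proof -
    have "\<rho> x \<le> nch x" using \<rho> that by (simp add: admissible_def)
    then have "(\<rho> x + visits \<rho> t x) div Suc (nch x) = exits \<rho> (visits \<rho> t) x"
      by (simp add: exits_def rotor_outs_zero)
    also have "\<dots> \<le> entries \<rho> 1 (visits \<rho> t) x"
      using entries_exits_walk[OF \<rho> that(1)] by simp
    also have "\<dots> < Suc B" using that by simp
    finally have "\<rho> x + visits \<rho> t x < Suc B * Suc (nch x)"
      by (subst (asm) div_less_iff_less_mult) auto
    then show ?thesis by (simp add: mult.commute)
  qed
  {
    case root
    show ?case
      using bound[OF directed_cover.root, of _ 1] by (auto simp: entries_def)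
  next
    case (child x k)
    then obtain B where "\<forall>t. visits \<rho> t x \<le> B" by blast
    then have "entries \<rho> 1 (visits \<rho> t) (k # x) \<le> B" for t
      using rotor_outs_le[of "nch x" "\<rho> x" "visits \<rho> t x" k]
      by (auto simp: entries_def intro: order_trans)
    then show ?case
      using bound[OF directed_cover.child[OF child.hyps(1,2)], of _ B] by blast
  }
qed

definition total_visits :: "rotors \<Rightarrow> vertex \<Rightarrow> nat" where
  "total_visits \<rho> x = card {t. pos \<rho> t = Some x}"

lemma visits_card: "visits \<rho> t x = card {s. s < t \<and> pos \<rho> s = Some x}"
proof -
  have "visits \<rho> t x = card ({..<t} \<inter> {s. pos \<rho> s = Some x})"
    by (simp add: visits_def)
  also have "{..<t} \<inter> {s. pos \<rho> s = Some x} = {s. s < t \<and> pos \<rho> s = Some x}"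
    by auto
  finally show ?thesis .
qed

lemma finite_visits:
  assumes "admissible \<rho>"
  shows "finite {t. pos \<rho> t = Some x}"
proof (cases "x \<in> T")
  case True
  then obtain B where B: "visits \<rho> t x \<le> B" for t
    using visits_bounded[OF assms] by blast
  show ?thesis
  proof (rule ccontr)
    assume "infinite {t. pos \<rho> t = Some x}"
    then obtain F where F: "F \<subseteq> {t. pos \<rho> t = Some x}" "finite F" "card F = Suc B"
      using infinite_arbitrarily_large by blast
    then obtain t where "F \<subseteq> {..<t}" by (meson finite_nat_iff_bounded)
    with F have "card F \<le> card {s. s < t \<and> pos \<rho> s = Some x}"
      by (intro card_mono) auto
    then show False using B[of t] F by (simp add: visits_card)
  qed
next
  case False
  then have "{t. pos \<rho> t = Some x} = {}" using pos_in_T by blast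
  then show ?thesis by simp
qed

lemma eventually_not_at:
  assumes "admissible \<rho>"
  shows "eventually (\<lambda>t. pos \<rho> t \<noteq> Some x) sequentially"
  using finite_visits[OF assms, of x] unfolding cofinite_eq_sequentially[symmetric] eventually_cofinite
  by simp

lemma eventually_total_visits:
  assumes "admissible \<rho>"
  shows "eventually (\<lambda>t. visits \<rho> t x = total_visits \<rho> x) sequentially"
proof -
  obtain t0 where "{t. pos \<rho> t = Some x} \<subseteq> {..<t0}"
    using finite_visits[OF assms, of x] by (meson finite_nat_iff_bounded)
  then have "{s. s < t \<and> pos \<rho> s = Some x} = {t. pos \<rho> t = Some x}" if "t \<ge> t0" for t
    using that by auto
  then show ?thesis
    unfolding eventually_sequentially visits_card total_visits_def by (intro exI[of _ t0]) simp
qed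

lemma rotors_after_total_visits:
  assumes "admissible \<rho>" "x \<in> T"
  shows "rotors_after G chi i \<rho> x = (\<rho> x + total_visits \<rho> x) mod Suc (nch x)"
  unfolding rotors_after_def
proof (rule the_equality)
  show ev: "eventually (\<lambda>t. fst (rotor_walk G chi i \<rho> t) x =
      (\<rho> x + total_visits \<rho> x) mod Suc (nch x)) sequentially"
    using eventually_total_visits[OF assms(1), of x]
    by eventually_elim (use assms in \<open>simp add: rotor_after_visits admissible_def\<close>)
  fix k assume "eventually (\<lambda>t. fst (rotor_walk G chi i \<rho> t) x = k) sequentially"
  with ev have "eventually (\<lambda>t::nat. k = (\<rho> x + total_visits \<rho> x) mod Suc (nch x)) sequentially"
    by eventually_elim simp
  then show "k = (\<rho> x + total_visits \<rho> x) mod Suc (nch x)" by simp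
qed

lemma admissible_rotors_after:
  assumes "admissible \<rho>"
  shows "admissible (rotors_after G chi i \<rho>)"
  using assms rotors_after_total_visits[OF assms]
  by (auto simp: admissible_def less_Suc_eq_le[symmetric])

definition escapes_in :: "rotors \<Rightarrow> vertex \<Rightarrow> bool" where
  "escapes_in \<rho> x \<longleftrightarrow> eventually (\<lambda>t. \<exists>y. pos \<rho> t = Some y \<and> suffix x y) sequentially"

text \<open>All visit counts are finite, so both edge counts are eventually constant. Hence so is
  the indicator of being below \<open>x\<close>: the particle ends up inside the subtree for good or
  outside it for good.\<close>

lemma entries_exits_total:
  assumes \<rho>: "admissible \<rho>" and x: "x \<in> T"
  shows "entries \<rho> 1 (total_visits \<rho>) x =
      exits \<rho> (total_visits \<rho>) x + of_bool (escapes_in \<rho> x)"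
    and "\<not> escapes_in \<rho> x \<Longrightarrow>
      eventually (\<lambda>t. \<not> (\<exists>y. pos \<rho> t = Some y \<and> suffix x y)) sequentially"
proof -
  let ?P = "\<lambda>t. \<exists>y. pos \<rho> t = Some y \<and> suffix x y"
  let ?E = "entries \<rho> 1 (total_visits \<rho>) x" and ?D = "exits \<rho> (total_visits \<rho>) x"
  have "eventually (\<lambda>t. entries \<rho> 1 (visits \<rho> t) x = ?E) sequentially"
  proof (cases x)
    case (Cons l y)
    show ?thesis
      using eventually_total_visits[OF \<rho>, of y] by eventually_elim (simp add: entries_def Cons)
  qed (simp add: entries_def)
  moreover have "eventually (\<lambda>t. exits \<rho> (visits \<rho> t) x = ?D) sequentially"
    using eventually_total_visits[OF \<rho>, of x] by eventually_elim (simp add: exits_def)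
  ultimately have ev: "eventually (\<lambda>t. ?E = ?D + of_bool (?P t)) sequentially"
    by eventually_elim (use entries_exits_walk[OF \<rho> x] in metis)
  show *: "eventually (\<lambda>t. \<not> ?P t) sequentially" if "\<not> escapes_in \<rho> x"
  proof (cases "?E = ?D")
    case True
    with ev show ?thesis by (auto elim: eventually_mono)
  next
    case False
    have "eventually ?P sequentially"
      using ev by eventually_elim (use False in \<open>auto split: if_splits\<close>)
    with that show ?thesis by (simp add: escapes_in_def)
  qed
  show "?E = ?D + of_bool (escapes_in \<rho> x)"
  proof (cases "escapes_in \<rho> x")
    case True
    then have "eventually (\<lambda>t::nat. ?E = ?D + 1) sequentially"
      unfolding escapes_in_def using ev by eventually_elim auto
    with True show ?thesis by simp
  next
    case False
    have "eventually (\<lambda>t::nat. ?E = ?D) sequentially"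
      using ev *[OF False] by eventually_elim auto
    with False show ?thesis by simp
  qed
qed

text \<open>From some time on the particle is no longer at \<open>x\<close> itself, so being below
  \<open>x\<close> means being below exactly one child.\<close>

lemma escapes_in_children:
  assumes \<rho>: "admissible \<rho>" and x: "x \<in> T"
  shows "(of_bool (escapes_in \<rho> x) :: nat) = (\<Sum>l=1..nch x. of_bool (escapes_in \<rho> (l # x)))"
proof -
  let ?P = "\<lambda>z t. \<exists>y. pos \<rho> t = Some y \<and> suffix z y"
  have ev: "eventually (\<lambda>t. of_bool (?P z t) = (of_bool (escapes_in \<rho> z) :: nat)) sequentially"
    if "z \<in> T" for z
  proof (cases "escapes_in \<rho> z")
    case True
    then show ?thesis by (auto simp: escapes_in_def elim: eventually_mono)
  next
    case False
    then show ?thesis using entries_exits_total(2)[OF \<rho> that] by (auto elim: eventually_mono)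
  qed
  have "eventually (\<lambda>t. \<forall>l\<in>{1..nch x}.
      of_bool (?P (l # x) t) = (of_bool (escapes_in \<rho> (l # x)) :: nat)) sequentially"
    using x by (intro eventually_ball_finite ballI ev child_in_T) auto
  then have "eventually (\<lambda>t::nat. (of_bool (escapes_in \<rho> x) :: nat) =
      (\<Sum>l=1..nch x. of_bool (escapes_in \<rho> (l # x)))) sequentially"
    using ev[OF x] eventually_not_at[OF \<rho>, of x]
  proof eventually_elim
    case (elim t)
    have "(of_bool (?P x t) :: nat) = (\<Sum>l=1..nch x. of_bool (?P (l # x) t))"
    proof (cases "?P x t")
      case True
      then obtain y where y: "pos \<rho> t = Some y" "suffix x y" by blast
      have "y \<in> T" using y(1) by (rule pos_in_T)
      from y elim(3) obtain zs where zs: "y = zs @ x" "zs \<noteq> []"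
        by (auto simp: suffix_def)
      \<comment> \<open>Vertices list the path upwards, so the last entry of \<open>zs\<close> is
        the first step down from \<open>x\<close> towards \<open>y\<close>.\<close>
      define l where "l = last zs"
      have yl: "y = butlast zs @ l # x" using zs by (simp add: l_def)
      have "l # x \<in> T"
        using \<open>y \<in> T\<close> unfolding yl by (rule append_in_T)
      then have "l \<in> {1..nch x}" by (simp add: Cons_in_T)
      moreover have "suffix (k # x) y \<longleftrightarrow> k = l" for k
        unfolding yl by (auto simp: suffix_def)
      ultimately show ?thesis using y True
        by (simp add: of_bool_def sum.delta)
    next
      case False
      then have "\<not> ?P (l # x) t" for l
        using suffix_ConsD by (metis suffix_Cons suffix_def append.assoc append_Cons append_Nil)
      with False show ?thesis by (simp only: of_bool_eq sum.neutral_const simp_thms)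
    qed
    with elim show ?case by simp
  qed
  then show ?thesis by simp
qed

text \<open>The sink is absorbing, so a particle that is eventually outside it has never been in
  it.\<close>

lemma escapes_in_root:
  assumes "admissible \<rho>"
  shows "escapes_in \<rho> [] \<longleftrightarrow> escapes G chi i \<rho>"
proof -
  have absorbed: "pos \<rho> (t + s) = None" if "pos \<rho> t = None" for t s
    by (induction s) (use that in \<open>auto simp: pos_Suc\<close>)
  have "escapes_in \<rho> [] \<longleftrightarrow> eventually (\<lambda>t. pos \<rho> t \<noteq> None) sequentially"
    by (simp add: escapes_in_def)
  also have "\<dots> \<longleftrightarrow> (\<forall>t. pos \<rho> t \<noteq> None)"
  proof
    assume ev: "eventually (\<lambda>t. pos \<rho> t \<noteq> None) sequentially"
    then obtain t0 where t0: "\<And>t. t \<ge> t0 \<Longrightarrow> pos \<rho> t \<noteq> None"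
      unfolding eventually_sequentially by blast
    show "\<forall>t. pos \<rho> t \<noteq> None"
      using t0[of "t + t0" for t] absorbed by (metis le_add2)
  qed simp
  also have "\<dots> \<longleftrightarrow> escapes G chi i \<rho>"
    using finite_visits[OF assms] by (simp add: escapes_def pos_def)
  finally show ?thesis .
qed

text \<open>Supplies the finiteness clause of \<open>flow\<close>. The other clauses also admit the
  spurious solution with \<open>E = 0\<close> and \<open>U = D\<close> constant on the whole
  tree.\<close>

lemma finite_visited_below:
  assumes \<rho>: "admissible \<rho>" and x: "x \<in> T" and e: "\<not> escapes_in \<rho> x"
  shows "finite {y. suffix x y \<and> total_visits \<rho> y > 0}"
proof -
  obtain t0 where t0: "\<And>t y. t \<ge> t0 \<Longrightarrow> pos \<rho> t = Some y \<Longrightarrow> \<not> suffix x y"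
    using entries_exits_total(2)[OF \<rho> x e] unfolding eventually_sequentially by blast
  have "{y. suffix x y \<and> total_visits \<rho> y > 0} \<subseteq> (\<lambda>t. the (pos \<rho> t)) ` {..<t0}"
  proof
    fix y assume y: "y \<in> {y. suffix x y \<and> total_visits \<rho> y > 0}"
    then obtain t where t: "pos \<rho> t = Some y"
      by (auto simp: total_visits_def card_gt_0_iff)
    with y t0 have "t < t0" by (metis mem_Collect_eq not_le)
    with t show "y \<in> (\<lambda>t. the (pos \<rho> t)) ` {..<t0}" by (intro image_eqI[of _ _ t]) auto
  qed
  then show ?thesis by (rule finite_subset) simp
qed

text \<open>\<open>U x\<close> and \<open>D x\<close> count the moves of all particles from the parent of \<open>x\<close> to \<open>x\<close> and back;
  \<open>E x\<close> counts the particles that escape to infinity below \<open>x\<close>.\<close>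

definition flow :: "rotors \<Rightarrow> (vertex \<Rightarrow> nat) \<Rightarrow> (vertex \<Rightarrow> nat) \<Rightarrow> (vertex \<Rightarrow> nat) \<Rightarrow> bool" where
  "flow \<rho> U D E \<longleftrightarrow> (\<forall>x\<in>T. U x = D x + E x \<and> E x = (\<Sum>l=1..nch x. E (l # x)) \<and>
     (E x = 0 \<longrightarrow> finite {y. suffix x y \<and> D y > 0}) \<and>
     (\<forall>l\<in>{1..nch x}. U (l # x) \<le> D x + 1 \<and> D x \<le> U (l # x) + 1 \<and>
        (\<rho> x < l \<longrightarrow> D x \<le> U (l # x)) \<and> (l \<le> \<rho> x \<longrightarrow> U (l # x) \<le> D x)))"

text \<open>Induction over the particles, with \<open>V\<close> accumulating their visits: the rotor
  at \<open>x\<close> left by \<open>n\<close> particles is the initial one advanced by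
  \<open>V x\<close> moves, so the edge counts of the next particle continue the earlier
  ones.\<close>

lemma entries_exits_particles:
  assumes \<rho>: "admissible \<rho>"
  shows "\<exists>V E. admissible ((rotors_after G chi i ^^ n) \<rho>) \<and> E [] = escape_count G chi i \<rho> n \<and>
    (\<forall>x\<in>T. (rotors_after G chi i ^^ n) \<rho> x = (\<rho> x + V x) mod Suc (nch x) \<and>
      entries \<rho> n V x = exits \<rho> V x + E x \<and> E x = (\<Sum>l=1..nch x. E (l # x)) \<and>
      (E x = 0 \<longrightarrow> finite {y. suffix x y \<and> V y > 0}))"
proof (induction n)
  case 0
  show ?case
    using \<rho> by (intro exI[of _ "\<lambda>_. 0"])
      (auto simp: escape_count_def entries_def exits_def admissible_def split: list.splits)
next
  case (Suc n)
  let ?r = "(rotors_after G chi i ^^ n) \<rho>"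
  from Suc obtain V E where r: "admissible ?r" and E: "E [] = escape_count G chi i \<rho> n"
    and IH: "\<And>x. x \<in> T \<Longrightarrow> ?r x = (\<rho> x + V x) mod Suc (nch x)"
      "\<And>x. x \<in> T \<Longrightarrow> entries \<rho> n V x = exits \<rho> V x + E x"
      "\<And>x. x \<in> T \<Longrightarrow> E x = (\<Sum>l=1..nch x. E (l # x))"
      "\<And>x. x \<in> T \<Longrightarrow> E x = 0 \<Longrightarrow> finite {y. suffix x y \<and> V y > 0}"
    by blast
  define V' where "V' x = V x + total_visits ?r x" for x
  define E' where "E' x = E x + of_bool (escapes_in ?r x)" for x
  have "{k. k < Suc n \<and> P k} = {k. k < n \<and> P k} \<union> (if P n then {n} else {})" for P
    by (auto simp: less_Suc_eq)
  then have "E' [] = escape_count G chi i \<rho> (Suc n)"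
    by (simp add: E'_def E escapes_in_root[OF r] escape_count_def card_Un_disjoint)
  moreover have "admissible ((rotors_after G chi i ^^ Suc n) \<rho>)"
    using admissible_rotors_after[OF r] by simp
  moreover have "(rotors_after G chi i ^^ Suc n) \<rho> x = (\<rho> x + V' x) mod Suc (nch x)"
    if "x \<in> T" for x
    using rotors_after_total_visits[OF r that] IH(1)[OF that]
    by (simp add: V'_def mod_simps add_ac)
  moreover have "entries \<rho> (Suc n) V' x = exits \<rho> V' x + E' x" if x: "x \<in> T" for x
  proof -
    have "exits \<rho> V' x = exits \<rho> V x + exits ?r (total_visits ?r) x"
      by (simp add: exits_def V'_def rotor_outs_add IH(1)[OF x])
    moreover have "entries \<rho> (Suc n) V' x = entries \<rho> n V x + entries ?r 1 (total_visits ?r) x"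
      using x by (cases x) (auto simp: entries_def V'_def rotor_outs_add IH(1) Cons_in_T)
    ultimately show ?thesis
      using IH(2)[OF x] entries_exits_total(1)[OF r x] by (simp add: E'_def)
  qed
  moreover have "E' x = (\<Sum>l=1..nch x. E' (l # x))" if "x \<in> T" for x
    using IH(3)[OF that] escapes_in_children[OF r that] by (simp add: E'_def sum.distrib)
  moreover have "finite {y. suffix x y \<and> V' y > 0}" if "x \<in> T" "E' x = 0" for x
  proof -
    have "finite ({y. suffix x y \<and> V y > 0} \<union> {y. suffix x y \<and> total_visits ?r y > 0})"
      using that IH(4) finite_visited_below[OF r] by (auto simp: E'_def split: if_splits)
    then show ?thesis by (rule rev_finite_subset) (auto simp: V'_def)
  qed
  ultimately show ?case by blast
qed

lemma flow_exists:
  assumes \<rho>: "admissible \<rho>"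
  obtains U D E where "flow \<rho> U D E" "U [] = n" "E [] = escape_count G chi i \<rho> n"
proof -
  obtain V E where E: "E [] = escape_count G chi i \<rho> n"
    and bal: "\<And>x. x \<in> T \<Longrightarrow> entries \<rho> n V x = exits \<rho> V x + E x"
      "\<And>x. x \<in> T \<Longrightarrow> E x = (\<Sum>l=1..nch x. E (l # x))"
      "\<And>x. x \<in> T \<Longrightarrow> E x = 0 \<Longrightarrow> finite {y. suffix x y \<and> V y > 0}"
    using entries_exits_particles[OF \<rho>, of n] by blast
  have "flow \<rho> (entries \<rho> n V) (exits \<rho> V) E"
    unfolding flow_def
  proof (intro ballI conjI impI)
    fix x assume x: "x \<in> T"
    then have c: "\<rho> x \<le> nch x" using \<rho> by (simp add: admissible_def)
    show "entries \<rho> n V x = exits \<rho> V x + E x" "E x = (\<Sum>l=1..nch x. E (l # x))"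
      using bal x by auto
    show "finite {y. suffix x y \<and> exits \<rho> V y > 0}" if "E x = 0"
      using bal(3)[OF x that] by (rule rev_finite_subset) (auto simp: exits_def intro: gr0I)
    fix l assume l: "l \<in> {1..nch x}"
    note b = rotor_outs_balanced[OF c, of l "V x"]
    show "entries \<rho> n V (l # x) \<le> exits \<rho> V x + 1" "exits \<rho> V x \<le> entries \<rho> n V (l # x) + 1"
      using b l by (cases "\<rho> x < l"; simp add: entries_def exits_def)+
    show "exits \<rho> V x \<le> entries \<rho> n V (l # x)" if "\<rho> x < l"
      using b(1) l that by (simp add: entries_def exits_def)
    show "entries \<rho> n V (l # x) \<le> exits \<rho> V x" if "l \<le> \<rho> x"
      using b(3) l that by (simp add: entries_def exits_def)
  qed
  from that[OF this _ E] show thesis by (simp add: entries_def)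
qed

end

section \<open>Escape counts of flows\<close>

text \<open>A finite height makes the event accessible to a recursion, both for measurability and
  for its probability.\<close>

primrec good_path :: "(vertex \<Rightarrow> nat) \<Rightarrow> nat \<Rightarrow> rotors \<Rightarrow> vertex \<Rightarrow> bool" where
  "good_path d 0 \<rho> x \<longleftrightarrow> True"
| "good_path d (Suc h) \<rho> x \<longleftrightarrow> (\<exists>l\<in>{1..d x}. \<rho> x < l \<and> good_path d h \<rho> (l # x))"

context rotor_tree
begin

abbreviation "gpath \<equiv> good_path nch"

text \<open>The tree is locally finite, so by Koenig's lemma lines of good children of every finite
  length amount to an infinite one.\<close>

definition live :: "rotors \<Rightarrow> vertex \<Rightarrow> bool" where
  "live \<rho> x \<longleftrightarrow> (\<forall>h. gpath h \<rho> x)"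

lemma flowD:
  assumes "flow \<rho> U D E" "x \<in> T"
  shows "U x = D x + E x" "E x = (\<Sum>l=1..nch x. E (l # x))"
    "E x = 0 \<Longrightarrow> finite {y. suffix x y \<and> D y > 0}"
    "1 \<le> l \<Longrightarrow> l \<le> nch x \<Longrightarrow> U (l # x) \<le> D x + 1"
    "1 \<le> l \<Longrightarrow> l \<le> nch x \<Longrightarrow> D x \<le> U (l # x) + 1"
    "1 \<le> l \<Longrightarrow> l \<le> nch x \<Longrightarrow> \<rho> x < l \<Longrightarrow> D x \<le> U (l # x)"
    "1 \<le> l \<Longrightarrow> l \<le> nch x \<Longrightarrow> l \<le> \<rho> x \<Longrightarrow> U (l # x) \<le> D x"
  using assms unfolding flow_def by auto

text \<open>If \<open>E x = 0\<close>, then \<open>E\<close> vanishes below \<open>x\<close>, so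
  \<open>U = D\<close> there, and \<open>D\<close> does not decrease on passing to a good child. A
  positive \<open>D x\<close> is then carried to every depth, against the finiteness clause of
  \<open>flow\<close>.\<close>

lemma live_visited_escapes:
  assumes f: "flow \<rho> U D E" and x: "x \<in> T" and live: "live \<rho> x" and U: "U x > 0"
  shows "E x > 0"
proof (rule ccontr)
  assume "\<not> E x > 0"
  then have E: "E x = 0" by simp
  have reach: "\<exists>y. suffix x y \<and> length y = length x + h \<and> D y > 0"
    if "gpath h \<rho> x" "x \<in> T" "E x = 0" "D x > 0" for h x
    using that
  proof (induction h arbitrary: x)
    case 0
    then show ?case by auto
  next
    case (Suc h)
    then obtain l where l: "1 \<le> l" "l \<le> nch x" "\<rho> x < l" "gpath h \<rho> (l # x)" by auto
    have l': "l # x \<in> T" using l Suc.prems by (simp add: Cons_in_T)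
    have "E (l # x) = 0"
      using flowD(2)[OF f Suc.prems(2)] Suc.prems(3) l by auto
    moreover have "D (l # x) > 0"
      using flowD(1)[OF f l'] flowD(6)[OF f Suc.prems(2) l(1-3)] Suc.prems(4) calculation by simp
    ultimately obtain y where "suffix (l # x) y" "length y = length (l # x) + h" "D y > 0"
      using Suc.IH[OF l(4) l'] by blast
    then show ?case
      by (intro exI[of _ y]) (auto dest: suffix_ConsD)
  qed
  have D: "D x > 0" using flowD(1)[OF f x] U E by simp
  have "finite (length ` {y. suffix x y \<and> D y > 0})"
    using flowD(3)[OF f x E] by blast
  then obtain B where B: "\<And>y. suffix x y \<Longrightarrow> D y > 0 \<Longrightarrow> length y \<le> B"
    by (auto simp: finite_nat_set_iff_bounded_le)
  obtain y where "suffix x y" "length y = length x + Suc B" "D y > 0"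
    using reach[OF _ x E D] live unfolding live_def by blast
  with B[of y] show False by simp
qed

text \<open>Along a line of descent with \<open>E > 0\<close> the entry count \<open>U\<close> never increases, and it
  decreases at each step that does not go to a good child.\<close>

lemma no_live_no_escape:
  assumes f: "flow \<rho> U D E" and nl: "\<And>x. x \<in> T \<Longrightarrow> \<not> live \<rho> x" and x: "x \<in> T"
  shows "E x = 0"
  using x
proof (induction "U x" arbitrary: x rule: less_induct)
  case less
  \<comment> \<open>Inner induction on a height \<open>h\<close> that good lines from
    \<open>y\<close> do not reach. If \<open>E y\<close> were positive, a good child would keep
    \<open>U\<close> at most \<open>U x\<close> and lower \<open>h\<close>, while any other child
    would have \<open>U\<close> below \<open>U x\<close> and fall under the outer induction.\<close>
  have "E y = 0" if "\<not> gpath h \<rho> y" "y \<in> T" "U y \<le> U x" for h y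
    using that
  proof (induction h arbitrary: y)
    case (Suc h)
    show ?case
    proof (rule ccontr)
      assume E: "E y \<noteq> 0"
      note U = flowD(1)[OF f Suc.prems(2)]
      have "E (l # y) = 0" if l: "1 \<le> l" "l \<le> nch y" for l
      proof (cases "\<rho> y < l")
        case True
        have "U (l # y) \<le> U x"
          using flowD(4)[OF f Suc.prems(2) l] U E Suc.prems(3) by simp
        moreover have "\<not> gpath h \<rho> (l # y)"
          using Suc.prems(1) l True by auto
        ultimately show ?thesis
          using Suc.IH l Suc.prems(2) by (simp add: Cons_in_T)
      next
        case False
        then have "U (l # y) < U x"
          using flowD(7)[OF f Suc.prems(2) l] U E Suc.prems(3) by simp
        then show ?thesis
          using less.hyps l Suc.prems(2) by (simp add: Cons_in_T)
      qed
      then have "E y = 0"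
        by (subst flowD(2)[OF f Suc.prems(2)]) simp
      with E show False by simp
    qed
  qed simp
  then show ?case using nl[OF less.prems] less.prems by (auto simp: live_def)
qed

section \<open>Linear bounds on escape counts and their recursion\<close>

definition child_sum :: "(nat \<Rightarrow> real) \<Rightarrow> nat \<Rightarrow> real" where
  "child_sum e j = (\<Sum>l=1..deg G j. e (chi j l))"

text \<open>Escape probability of the walk at a vertex of type \<open>j\<close> whose children have escape
  probabilities \<open>e\<close>.\<close>

definition escape_op :: "(nat \<Rightarrow> real) \<Rightarrow> nat \<Rightarrow> real" where
  "escape_op e j = child_sum e j / (1 + child_sum e j)"

text \<open>The constant \<open>K\<close> may depend on the vertex but not on the flow, hence not on
  the number of particles.\<close>

definition lower_rate :: "rotors \<Rightarrow> (nat \<Rightarrow> real) \<Rightarrow> bool" where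
  "lower_rate \<rho> e \<longleftrightarrow>
     (\<forall>x\<in>T. \<exists>K. \<forall>U D E. flow \<rho> U D E \<longrightarrow> e (tau x) * real (U x) - K \<le> real (E x))"

definition upper_rate :: "rotors \<Rightarrow> (nat \<Rightarrow> real) \<Rightarrow> bool" where
  "upper_rate \<rho> e \<longleftrightarrow>
     (\<forall>x\<in>T. \<exists>K. \<forall>U D E. flow \<rho> U D E \<longrightarrow> real (E x) \<le> e (tau x) * real (U x) + K)"

lemma child_sum_nonneg: "(\<And>j. e j \<ge> 0) \<Longrightarrow> child_sum e j \<ge> 0"
  by (simp add: child_sum_def sum_nonneg)

lemma child_sum_mono: "(\<And>j. e j \<le> e' j) \<Longrightarrow> child_sum e j \<le> child_sum e' j"
  by (simp add: child_sum_def sum_mono)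

lemma escape_op_nonneg: "(\<And>j. e j \<ge> 0) \<Longrightarrow> escape_op e j \<ge> 0"
  by (simp add: escape_op_def child_sum_nonneg)

lemma escape_op_le_1: "(\<And>j. e j \<ge> 0) \<Longrightarrow> escape_op e j \<le> 1"
  using child_sum_nonneg[of e j] by (simp add: escape_op_def)

lemma ratio_mono: "0 \<le> a \<Longrightarrow> a \<le> b \<Longrightarrow> a / (1 + a) \<le> b / (1 + (b::real))"
  by (simp add: field_simps)

lemma escape_op_mono:
  "(\<And>j. e j \<ge> 0) \<Longrightarrow> (\<And>j. e j \<le> e' j) \<Longrightarrow> escape_op e j \<le> escape_op e' j"
  unfolding escape_op_def by (intro ratio_mono child_sum_nonneg child_sum_mono)

lemma child_sum_tau: "child_sum e (tau x) = (\<Sum>l=1..nch x. e (tau (l # x)))"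
  by (simp add: child_sum_def nchildren_def)

text \<open>Each child is entered at most \<open>D x + 1\<close> times, so the bounds at the
  children sum to \<open>S * (D x + 1)\<close> plus a constant. Inserting
  \<open>D x = U x - E x\<close> and solving for \<open>E x\<close> produces the factor
  \<open>S / (1 + S)\<close>.\<close>

lemma upper_rate_escape_op:
  assumes "upper_rate \<rho> e" and e: "\<And>j. e j \<ge> 0"
  shows "upper_rate \<rho> (escape_op e)"
  unfolding upper_rate_def
proof
  fix x assume x: "x \<in> T"
  have "\<forall>l\<in>{1..nch x}. \<exists>K. \<forall>U D E. flow \<rho> U D E \<longrightarrow>
      real (E (l # x)) \<le> e (tau (l # x)) * real (U (l # x)) + K"
    using assms(1) child_in_T[OF x] unfolding upper_rate_def by (metis atLeastAtMost_iff)
  then obtain K where K: "\<And>l U D E. l \<in> {1..nch x} \<Longrightarrow> flow \<rho> U D E \<Longrightarrow>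
      real (E (l # x)) \<le> e (tau (l # x)) * real (U (l # x)) + K l"
    by metis
  define S where "S = child_sum e (tau x)"
  have S: "S \<ge> 0" unfolding S_def using e by (rule child_sum_nonneg)
  define C where "C = (S + (\<Sum>l=1..nch x. K l)) / (1 + S)"
  have "real (E x) \<le> escape_op e (tau x) * real (U x) + C" if f: "flow \<rho> U D E" for U D E
  proof -
    have U: "real (U x) = real (D x) + real (E x)"
      using flowD(1)[OF f x] by simp
    have "real (E x) = (\<Sum>l=1..nch x. real (E (l # x)))"
      by (subst flowD(2)[OF f x]) simp
    also have "\<dots> \<le> (\<Sum>l=1..nch x. e (tau (l # x)) * (real (D x) + 1) + K l)"
    proof (rule sum_mono)
      fix l assume l: "l \<in> {1..nch x}"
      then have "real (U (l # x)) \<le> real (D x) + 1"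
        using flowD(4)[OF f x, of l] by simp
      then show "real (E (l # x)) \<le> e (tau (l # x)) * (real (D x) + 1) + K l"
        using K[OF l f] mult_left_mono[OF _ e[of "tau (l # x)"]] by fastforce
    qed
    also have "\<dots> = S * (real (D x) + 1) + (\<Sum>l=1..nch x. K l)"
      by (simp add: sum.distrib S_def child_sum_tau sum_distrib_right)
    finally have "real (E x) * (1 + S) \<le> S * real (U x) + (S + (\<Sum>l=1..nch x. K l))"
      unfolding U by (simp add: algebra_simps)
    then have "real (E x) \<le> (S * real (U x) + (S + (\<Sum>l=1..nch x. K l))) / (1 + S)"
      using S by (simp add: field_simps)
    then show ?thesis by (simp add: escape_op_def C_def S_def add_divide_distrib)
  qed
  then show "\<exists>C. \<forall>U D E. flow \<rho> U D E \<longrightarrow>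
      real (E x) \<le> escape_op e (tau x) * real (U x) + C" by blast
qed

lemma lower_rate_escape_op:
  assumes "lower_rate \<rho> e" and e: "\<And>j. e j \<ge> 0"
  shows "lower_rate \<rho> (escape_op e)"
  unfolding lower_rate_def
proof
  fix x assume x: "x \<in> T"
  have "\<forall>l\<in>{1..nch x}. \<exists>K. \<forall>U D E. flow \<rho> U D E \<longrightarrow>
      e (tau (l # x)) * real (U (l # x)) - K \<le> real (E (l # x))"
    using assms(1) child_in_T[OF x] unfolding lower_rate_def by (metis atLeastAtMost_iff)
  then obtain K where K: "\<And>l U D E. l \<in> {1..nch x} \<Longrightarrow> flow \<rho> U D E \<Longrightarrow>
      e (tau (l # x)) * real (U (l # x)) - K l \<le> real (E (l # x))"
    by metis
  define S where "S = child_sum e (tau x)"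
  have S: "S \<ge> 0" unfolding S_def using e by (rule child_sum_nonneg)
  define C where "C = (S + (\<Sum>l=1..nch x. K l)) / (1 + S)"
  have "escape_op e (tau x) * real (U x) - C \<le> real (E x)" if f: "flow \<rho> U D E" for U D E
  proof -
    have U: "real (U x) = real (D x) + real (E x)"
      using flowD(1)[OF f x] by simp
    have "S * (real (D x) - 1) - (\<Sum>l=1..nch x. K l) =
        (\<Sum>l=1..nch x. e (tau (l # x)) * (real (D x) - 1) - K l)"
      by (simp add: sum_subtractf S_def child_sum_tau sum_distrib_right)
    also have "\<dots> \<le> (\<Sum>l=1..nch x. real (E (l # x)))"
    proof (rule sum_mono)
      fix l assume l: "l \<in> {1..nch x}"
      then have "real (D x) - 1 \<le> real (U (l # x))"
        using flowD(5)[OF f x, of l] by simp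
      then show "e (tau (l # x)) * (real (D x) - 1) - K l \<le> real (E (l # x))"
        using K[OF l f] mult_left_mono[OF _ e[of "tau (l # x)"]] by fastforce
    qed
    also have "\<dots> = real (E x)"
      by (subst flowD(2)[OF f x]) simp
    finally have "S * real (U x) - (S + (\<Sum>l=1..nch x. K l)) \<le> real (E x) * (1 + S)"
      unfolding U by (simp add: algebra_simps)
    then have "(S * real (U x) - (S + (\<Sum>l=1..nch x. K l))) / (1 + S) \<le> real (E x)"
      using S by (simp add: field_simps)
    then show ?thesis by (simp add: escape_op_def C_def S_def diff_divide_distrib)
  qed
  then show "\<exists>C. \<forall>U D E. flow \<rho> U D E \<longrightarrow>
      escape_op e (tau x) * real (U x) - C \<le> real (E x)" by blast
qed

lemma lower_rate_mono:
  assumes "lower_rate \<rho> e" "\<And>x. x \<in> T \<Longrightarrow> e' (tau x) \<le> e (tau x)"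
  shows "lower_rate \<rho> e'"
  unfolding lower_rate_def
proof
  fix x assume x: "x \<in> T"
  then obtain K where "\<And>U D E. flow \<rho> U D E \<Longrightarrow> e (tau x) * real (U x) - K \<le> real (E x)"
    using assms(1) unfolding lower_rate_def by blast
  then show "\<exists>K. \<forall>U D E. flow \<rho> U D E \<longrightarrow> e' (tau x) * real (U x) - K \<le> real (E x)"
    using mult_right_mono[OF assms(2)[OF x]]
    by (intro exI[of _ K]) (smt (verit, best) of_nat_0_le_iff)
qed

text \<open>Escape probability of the walk truncated at height \<open>k\<close>.\<close>

definition trunc_escape :: "nat \<Rightarrow> nat \<Rightarrow> real" where
  "trunc_escape k = (escape_op ^^ k) (\<lambda>_. 1)"

definition tree_escape :: "nat \<Rightarrow> real" where
  "tree_escape j = lim (\<lambda>k. trunc_escape k j)"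

lemma trunc_escape_0 [simp]: "trunc_escape 0 j = 1"
  and trunc_escape_Suc: "trunc_escape (Suc k) = escape_op (trunc_escape k)"
  by (simp_all add: trunc_escape_def)

lemma trunc_escape_nonneg: "trunc_escape k j \<ge> 0"
  by (induction k arbitrary: j) (auto simp: trunc_escape_Suc intro: escape_op_nonneg)

lemma trunc_escape_decseq: "decseq (\<lambda>k. trunc_escape k j)"
proof (rule decseq_SucI)
  show "trunc_escape (Suc k) j \<le> trunc_escape k j" for k
  proof (induction k arbitrary: j)
    case 0
    then show ?case by (simp add: trunc_escape_Suc escape_op_le_1)
  next
    case (Suc k)
    then show ?case
      unfolding trunc_escape_Suc[of "Suc k"] trunc_escape_Suc[of k]
      by (intro escape_op_mono) (auto simp: trunc_escape_nonneg trunc_escape_Suc[symmetric])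
  qed
qed

lemma tendsto_tree_escape: "(\<lambda>k. trunc_escape k j) \<longlonglongrightarrow> tree_escape j"
  using decseq_convergent[OF trunc_escape_decseq[of j], of 0] trunc_escape_nonneg
  unfolding tree_escape_def by (metis limI)

lemma tree_escape_le: "tree_escape j \<le> trunc_escape k j"
  using decseq_ge[OF trunc_escape_decseq tendsto_tree_escape] .

lemma tree_escape_nonneg: "tree_escape j \<ge> 0"
  by (rule LIMSEQ_le_const[OF tendsto_tree_escape]) (auto simp: trunc_escape_nonneg)

lemma tree_escape_fixpoint: "escape_op tree_escape j = tree_escape j"
proof (rule LIMSEQ_unique)
  show "(\<lambda>k. trunc_escape (Suc k) j) \<longlonglongrightarrow> tree_escape j"
    using tendsto_tree_escape by (rule LIMSEQ_Suc)
  have "child_sum tree_escape j \<ge> 0"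
    by (intro child_sum_nonneg tree_escape_nonneg)
  moreover have "(\<lambda>k. child_sum (trunc_escape k) j) \<longlonglongrightarrow> child_sum tree_escape j"
    unfolding child_sum_def by (intro tendsto_sum tendsto_tree_escape)
  ultimately show "(\<lambda>k. trunc_escape (Suc k) j) \<longlonglongrightarrow> escape_op tree_escape j"
    unfolding trunc_escape_Suc escape_op_def by (intro tendsto_intros) auto
qed

lemma upper_rate_trunc_escape: "upper_rate \<rho> (trunc_escape k)"
proof (induction k)
  case 0
  have "real (E x) \<le> 1 * real (U x) + 0" if "flow \<rho> U D E" "x \<in> T" for U D E x
    using flowD(1)[OF that] by simp
  then show ?case unfolding upper_rate_def trunc_escape_0 by blast
next
  case (Suc k)
  then show ?case
    unfolding trunc_escape_Suc by (rule upper_rate_escape_op) (rule trunc_escape_nonneg)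
qed

text \<open>\<open>escape_op\<close> is strictly superhomogeneous for factors \<open>s < 1\<close>, so each application
  shrinks the defect \<open>c = 1 / s - 1\<close> by the factor \<open>1 + S\<close>.\<close>

lemma lower_rate_improve:
  assumes low: "lower_rate \<rho> (\<lambda>j. 1 / (1 + c) * tree_escape j)" and c: "0 \<le> c"
    and S: "S > 0" "\<And>x. x \<in> T \<Longrightarrow> S \<le> child_sum tree_escape (tau x)"
  shows "lower_rate \<rho> (\<lambda>j. 1 / (1 + c / (1 + S)) * tree_escape j)"
proof (rule lower_rate_mono)
  show "lower_rate \<rho> (escape_op (\<lambda>j. 1 / (1 + c) * tree_escape j))"
    using low by (rule lower_rate_escape_op) (use c tree_escape_nonneg in auto)
  fix x assume x: "x \<in> T"
  define A where "A = child_sum tree_escape (tau x)"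
  have A: "S \<le> A" "A > 0" using S x by (auto simp: A_def intro: less_le_trans)
  have "child_sum (\<lambda>j. 1 / (1 + c) * tree_escape j) (tau x) = A / (1 + c)"
    by (simp add: child_sum_def A_def sum_divide_distrib)
  moreover have "A / (1 + c) / (1 + A / (1 + c)) = A / (1 + c + A)"
    using c A by (simp add: divide_simps)
  ultimately have op: "escape_op (\<lambda>j. 1 / (1 + c) * tree_escape j) (tau x) = A / (1 + c + A)"
    by (simp only: escape_op_def)
  have te: "tree_escape (tau x) = A / (1 + A)"
    using tree_escape_fixpoint[of "tau x"] by (simp add: escape_op_def A_def)
  \<comment> \<open>At this vertex the new defect is exactly \<open>c / (1 + A)\<close>, which is at
    most \<open>c / (1 + S)\<close> because \<open>S \<le> A\<close>.\<close>
  have "c \<le> c / (1 + S) * (1 + A)"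
    using c S mult_right_mono[OF A(1) c] by (simp add: field_simps)
  then have "1 + c + A \<le> (1 + c / (1 + S)) * (1 + A)"
    by (simp add: algebra_simps)
  then have "A / ((1 + c / (1 + S)) * (1 + A)) \<le> A / (1 + c + A)"
    using A c by (intro divide_left_mono mult_pos_pos add_pos_nonneg) (auto simp: S(1) less_imp_le)
  then show "1 / (1 + c / (1 + S)) * tree_escape (tau x)
      \<le> escape_op (\<lambda>j. 1 / (1 + c) * tree_escape j) (tau x)"
    unfolding op te by simp
qed

text \<open>Iterating the improvement makes the defect decay geometrically. The additive constants
  are not controlled along the iteration, so every factor below 1 is reached, but not 1
  itself.\<close>

lemma lower_rate_tree_escape:
  assumes low: "lower_rate \<rho> (\<lambda>j. s * tree_escape j)" and s: "0 < s" "s \<le> 1"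
    and S: "S > 0" "\<And>x. x \<in> T \<Longrightarrow> S \<le> child_sum tree_escape (tau x)"
    and s1: "s1 < 1"
  shows "lower_rate \<rho> (\<lambda>j. s1 * tree_escape j)"
proof -
  \<comment> \<open>\<open>c 0\<close> is the defect of the given factor, that is
    \<open>s = 1 / (1 + c 0)\<close>.\<close>
  define c where "c n = (1 / s - 1) / (1 + S) ^ n" for n :: nat
  have c: "c n \<ge> 0" for n
    using s S by (simp add: c_def)
  have low_n: "lower_rate \<rho> (\<lambda>j. 1 / (1 + c n) * tree_escape j)" for n
  proof (induction n)
    case 0
    then show ?case using low by (simp add: c_def)
  next
    case (Suc n)
    have "c (Suc n) = c n / (1 + S)" by (simp add: c_def)
    then show ?case using lower_rate_improve[OF Suc c S] by simp
  qed
  have "(\<lambda>n. 1 / (1 + c n)) \<longlonglongrightarrow> 1 / (1 + 0)"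
  proof (intro tendsto_intros)
    have "(\<lambda>n. (1 / s - 1) * (1 / (1 + S)) ^ n) \<longlonglongrightarrow> (1 / s - 1) * 0"
      using S by (intro tendsto_intros LIMSEQ_realpow_zero) auto
    then show "c \<longlonglongrightarrow> 0"
      by (simp add: power_divide c_def[abs_def])
  qed auto
  then have "eventually (\<lambda>n. 1 / (1 + c n) > s1) sequentially"
    using s1 by (intro order_tendstoD) auto
  then obtain n where "s1 \<le> 1 / (1 + c n)"
    by (auto simp: eventually_sequentially intro: less_imp_le)
  then show ?thesis
    using lower_rate_mono[OF low_n[of n]] tree_escape_nonneg by (meson mult_right_mono)
qed


section \<open>Entries lost on the way down an embedded binary tree\<close>

text \<open>For a child of a vertex \<open>y\<close> below \<open>x\<close>,
  \<open>U y = D y + E y\<close> exceeds the entries of the child by at most \<open>1 + E y\<close>,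
  and \<open>E y \<le> E x\<close>. So each step costs at most \<open>E x + 1\<close>
  entries.\<close>

lemma flow_descend:
  assumes f: "flow \<rho> U D E" and "w @ x \<in> T"
  shows "E (w @ x) \<le> E x \<and> U x \<le> U (w @ x) + length w * (E x + 1)"
  using assms(2)
proof (induction w)
  case (Cons l w)
  then have T: "w @ x \<in> T" and l: "1 \<le> l" "l \<le> nch (w @ x)" by (auto simp: Cons_in_T)
  have "E (l # w @ x) \<le> E (w @ x)"
    unfolding flowD(2)[OF f T] using l by (intro member_le_sum) auto
  then show ?case
    using Cons.IH[OF T] flowD(1)[OF f T] flowD(5)[OF f T l] by (simp add: algebra_simps)
qed simp

lemma flow_siblings:
  assumes f: "flow \<rho> U D E" and "v1 @ l1 # w @ x \<in> T" "v2 @ l2 # w @ x \<in> T" and l: "l1 \<noteq> l2"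
  shows "E (v1 @ l1 # w @ x) + E (v2 @ l2 # w @ x) \<le> E x"
proof -
  have T: "l1 # w @ x \<in> T" "l2 # w @ x \<in> T"
    using assms(2,3) append_in_T by blast+
  then have T': "w @ x \<in> T" and l': "l1 \<in> {1..nch (w @ x)}" "l2 \<in> {1..nch (w @ x)}"
    by (auto simp: Cons_in_T)
  have "E (v1 @ l1 # w @ x) + E (v2 @ l2 # w @ x) \<le> E (l1 # w @ x) + E (l2 # w @ x)"
    using assms(2,3) by (intro add_mono flow_descend[OF f, THEN conjunct1])
  also have "\<dots> = (\<Sum>l\<in>{l1, l2}. E (l # w @ x))"
    using l by simp
  also have "\<dots> \<le> (\<Sum>l=1..nch (w @ x). E (l # w @ x))"
    using l' by (intro sum_mono2) auto
  also have "\<dots> = E (w @ x)"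
    using flowD(2)[OF f T'] by simp
  also have "\<dots> \<le> E x"
    using flow_descend[OF f T'] by simp
  finally show ?thesis .
qed

end

text \<open>A binary tree of vertices of type \<open>b\<close> embedded below every vertex of type \<open>b\<close>.\<close>

locale binary_embedding = rotor_tree +
  fixes b :: nat and v1 v2 w :: vertex and l1 l2 :: nat
  assumes branch: "\<And>x. x \<in> T \<Longrightarrow> tau x = b \<Longrightarrow>
      v1 @ l1 # w @ x \<in> T \<and> tau (v1 @ l1 # w @ x) = b \<and>
      v2 @ l2 # w @ x \<in> T \<and> tau (v2 @ l2 # w @ x) = b"
    and distinct_branches: "l1 \<noteq> l2"
begin

abbreviation "left x \<equiv> v1 @ l1 # w @ x"
abbreviation "right x \<equiv> v2 @ l2 # w @ x"

primrec leaves :: "nat \<Rightarrow> vertex \<Rightarrow> vertex set" where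
  "leaves 0 x = {x}"
| "leaves (Suc k) x = leaves k (left x) \<union> leaves k (right x)"

lemma finite_leaves [simp]: "finite (leaves k x)"
  by (induction k arbitrary: x) auto

lemma leaves_suffix: "z \<in> leaves k x \<Longrightarrow> suffix x z"
proof (induction k arbitrary: x)
  case (Suc k)
  then have "suffix ((v1 @ l1 # w) @ x) z \<or> suffix ((v2 @ l2 # w) @ x) z" by auto
  then show ?case by (blast dest: suffix_appendD)
qed simp

lemma leaves_type: "z \<in> leaves k x \<Longrightarrow> x \<in> T \<Longrightarrow> tau x = b \<Longrightarrow> z \<in> T \<and> tau z = b"
proof (induction k arbitrary: x)
  case (Suc k)
  then show ?case using branch[OF Suc.prems(2,3)] by auto
qed simp

lemma left_right_disjoint: "suffix (left x) z \<Longrightarrow> suffix (right x) z \<Longrightarrow> False"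
  using suffix_siblings[of l1 "w @ x" z l2] distinct_branches by (auto dest: suffix_appendD)

text \<open>Distinct leaves have disjoint subtrees, which later makes their being live
  independent.\<close>

lemma leaves_incomparable:
  "z \<in> leaves k x \<Longrightarrow> z' \<in> leaves k x \<Longrightarrow> suffix z y \<Longrightarrow> suffix z' y \<Longrightarrow> z = z'"
proof (induction k arbitrary: x)
  case (Suc k)
  have "suffix u y" if "z \<in> leaves k u" "suffix z y" for z u
    using leaves_suffix[OF that(1)] that(2) by (rule suffix_order.trans)
  with Suc show ?case
    using left_right_disjoint[of x y] unfolding leaves.simps by blast
qed simp

lemma card_leaves: "card (leaves k x) = 2 ^ k"
proof (induction k arbitrary: x)
  case (Suc k)
  have "leaves k (left x) \<inter> leaves k (right x) = {}"
    using leaves_suffix left_right_disjoint by blast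
  then show ?case by (simp add: card_Un_disjoint Suc)
qed simp

definition stride :: nat where
  "stride = max (length (left [])) (length (right []))"

text \<open>Passing to a branch \<open>y\<close> costs at most \<open>stride * (E x + 1)\<close>
  entries. At most \<open>2 ^ k\<close> unvisited leaves lie below \<open>y\<close>, so the part
  with \<open>E x\<close> contributes \<open>2 ^ k * stride * E x\<close> per branch. The induction
  hypotheses of the two branches combine because \<open>E\<close> is additive. Both contributions
  have the same bound, whence the constant doubles with each level.\<close>

lemma unvisited_leaves:
  assumes f: "flow \<rho> U D E" and "x \<in> T" "tau x = b"
  shows "real (card {z\<in>leaves k x. U z = 0}) * (real (U x) - real k * real stride)
    \<le> 2 ^ Suc k * real stride * real (E x)"
  using assms(2,3)
proof (induction k arbitrary: x)
  case 0
  \<comment> \<open>A single leaf is counted only if \<open>U x = 0\<close>, so the left side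
    vanishes.\<close>
  have "{z. z = x \<and> U z = 0} = (if U x = 0 then {x} else {})" by auto
  then show ?case by simp
next
  case (Suc k)
  let ?R = "\<lambda>x. card {z\<in>leaves k x. U z = 0}"
  let ?S = "real stride"
  note br = branch[OF Suc.prems]
  have bound: "real (?R y) * (real (U x) - real (Suc k) * ?S)
      \<le> 2 ^ Suc k * ?S * real (E y) + 2 ^ k * ?S * real (E x)"
    if "y = left x \<or> y = right x" for y
  proof -
    have y: "y \<in> T" "tau y = b" using br that by auto
    have "U x \<le> U y + stride * (E x + 1)"
    proof -
      obtain u where u: "y = u @ x" "length u \<le> stride"
      using that[of "left []"] that[of "right []"] \<open>y = left x \<or> y = right x\<close>
        by (auto simp: stride_def)
      have "U x \<le> U y + length u * (E x + 1)"
        using flow_descend[OF f, of u x] y(1) unfolding u(1) by simp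
      also have "\<dots> \<le> U y + stride * (E x + 1)"
        using u(2) by (intro add_left_mono mult_right_mono) auto
      finally show ?thesis .
    qed
    then have "real (U x) \<le> real (U y) + ?S * (real (E x) + 1)"
      by (metis of_nat_1 of_nat_add of_nat_le_iff of_nat_mult)
    then have "real (?R y) * (real (U x) - real (Suc k) * ?S)
        \<le> real (?R y) * ((real (U y) - real k * ?S) + ?S * real (E x))"
      by (intro mult_left_mono) (auto simp: algebra_simps)
    also have "\<dots> = real (?R y) * (real (U y) - real k * ?S) + real (?R y) * (?S * real (E x))"
      by (rule distrib_left)
    also have "\<dots> \<le> 2 ^ Suc k * ?S * real (E y) + 2 ^ k * (?S * real (E x))"
    proof (intro add_mono Suc.IH y mult_right_mono)
      have "?R y \<le> card (leaves k y)" by (intro card_mono) auto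
      then show "real (?R y) \<le> 2 ^ k" by (simp add: card_leaves)
    qed auto
    finally show ?thesis by simp
  qed
  show ?case
  proof (cases "real (U x) - real (Suc k) * ?S \<ge> 0")
    case True
    have "{z\<in>leaves (Suc k) x. U z = 0} =
        {z\<in>leaves k (left x). U z = 0} \<union> {z\<in>leaves k (right x). U z = 0}" by auto
    then have "card {z\<in>leaves (Suc k) x. U z = 0} \<le> ?R (left x) + ?R (right x)"
      by (simp add: card_Un_le)
    then have "real (card {z\<in>leaves (Suc k) x. U z = 0}) * (real (U x) - real (Suc k) * ?S)
        \<le> (real (?R (left x)) + real (?R (right x))) * (real (U x) - real (Suc k) * ?S)"
      using True by (intro mult_right_mono) (simp_all flip: of_nat_add)
    also have "\<dots> \<le> 2 ^ Suc k * ?S * (real (E (left x)) + real (E (right x)))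
        + 2 ^ Suc k * ?S * real (E x)"
      using bound[of "left x"] bound[of "right x"] by (simp add: algebra_simps)
    also have "\<dots> \<le> 2 ^ Suc k * ?S * real (E x) + 2 ^ Suc k * ?S * real (E x)"
    proof -
      have "real (E (left x)) + real (E (right x)) \<le> real (E x)"
        using flow_siblings[OF f _ _ distinct_branches, of v1 w x v2] br
        by (simp flip: of_nat_add)
      then show ?thesis by (intro add_right_mono mult_left_mono) auto
    qed
    finally show ?thesis by (simp add: mult_ac)
  next
    case False
    then have "real (card {z\<in>leaves (Suc k) x. U z = 0}) * (real (U x) - real (Suc k) * ?S) \<le> 0"
      by (intro mult_nonneg_nonpos) auto
    also have "0 \<le> 2 ^ Suc (Suc k) * ?S * real (E x)" by simp
    finally show ?thesis .
  qed
qed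

text \<open>Each visited live leaf has an escape below it, and disjoint subtrees do not share
  escapes.\<close>

lemma visited_live_leaves:
  assumes f: "flow \<rho> U D E" and "x \<in> T" "tau x = b"
  shows "card {z\<in>leaves k x. live \<rho> z \<and> U z > 0} \<le> E x"
  using assms(2,3)
proof (induction k arbitrary: x)
  case 0
  have "{z\<in>leaves 0 x. live \<rho> z \<and> U z > 0} = (if live \<rho> x \<and> U x > 0 then {x} else {})"
    by auto
  then show ?case
    using live_visited_escapes[OF f 0(1)] by (auto simp: Suc_le_eq)
next
  case (Suc k)
  note br = branch[OF Suc.prems]
  let ?R = "\<lambda>x. card {z\<in>leaves k x. live \<rho> z \<and> U z > 0}"
  have "{z\<in>leaves (Suc k) x. live \<rho> z \<and> U z > 0} =
      {z\<in>leaves k (left x). live \<rho> z \<and> U z > 0} \<union> {z\<in>leaves k (right x). live \<rho> z \<and> U z > 0}"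
    by auto
  then have "card {z\<in>leaves (Suc k) x. live \<rho> z \<and> U z > 0} \<le> ?R (left x) + ?R (right x)"
    by (simp add: card_Un_le)
  also have "\<dots> \<le> E (left x) + E (right x)"
    using br by (intro add_mono Suc.IH) auto
  also have "\<dots> \<le> E x"
    using flow_siblings[OF f _ _ distinct_branches, of v1 w x v2] br by simp
  finally show ?case .
qed

text \<open>As \<open>2 * k * stride \<le> U x\<close>, at least half of \<open>U x\<close> remains
  after deducting \<open>k * stride\<close>, so at most \<open>4 * stride * E x\<close> leaves are
  unvisited. At most \<open>E x\<close> live leaves are visited, hence
  \<open>p * 2 ^ k \<le> (1 + 4 * stride) * E x\<close>. The last factor 2 is lost between
  \<open>2 ^ k\<close> and \<open>U x\<close>.\<close>

lemma escapes_if_many_live_leaves: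
  assumes f: "flow \<rho> U D E" and x: "x \<in> T" "tau x = b"
    and many: "p * 2 ^ k \<le> real (card {z\<in>leaves k x. live \<rho> z})"
    and k: "2 * k * stride \<le> 2 ^ k" "2 ^ k \<le> U x" "U x < 2 ^ Suc k" and p: "p \<ge> 0"
  shows "p / (2 * (1 + 4 * real stride)) * real (U x) \<le> real (E x)"
proof -
  let ?S = "real stride"
  let ?R = "real (card {z\<in>leaves k x. U z = 0})"
  have Ux: "real (U x) > 0" using k(2) by (simp add: less_le_trans[of 0 "2 ^ k"])
  have "real (2 * k * stride) \<le> real (U x)"
    using k(1,2) by (intro of_nat_mono) linarith
  then have "real (U x) / 2 \<le> real (U x) - real k * ?S"
    by simp
  then have "?R * (real (U x) / 2) \<le> ?R * (real (U x) - real k * ?S)"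
    by (intro mult_left_mono) auto
  also have "\<dots> \<le> 2 ^ Suc k * ?S * real (E x)"
    by (rule unvisited_leaves[OF f x])
  also have "\<dots> \<le> (2 * real (U x)) * ?S * real (E x)"
  proof -
    have "(2::real) ^ k \<le> real (U x)"
      using k(2) by (metis of_nat_le_iff of_nat_numeral of_nat_power)
    then show ?thesis by (intro mult_right_mono) auto
  qed
  finally have "?R * real (U x) \<le> (4 * ?S * real (E x)) * real (U x)"
    by (simp add: mult_ac)
  then have R: "?R \<le> 4 * ?S * real (E x)"
    using Ux by (rule mult_right_le_imp_le)
  have "{z\<in>leaves k x. live \<rho> z} \<subseteq>
      {z\<in>leaves k x. live \<rho> z \<and> U z > 0} \<union> {z\<in>leaves k x. U z = 0}" by auto
  then have "card {z\<in>leaves k x. live \<rho> z} \<le>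
      card ({z\<in>leaves k x. live \<rho> z \<and> U z > 0} \<union> {z\<in>leaves k x. U z = 0})"
    by (intro card_mono) auto
  also have "\<dots> \<le> card {z\<in>leaves k x. live \<rho> z \<and> U z > 0} + card {z\<in>leaves k x. U z = 0}"
    by (rule card_Un_le)
  also have "\<dots> \<le> E x + card {z\<in>leaves k x. U z = 0}"
    by (intro add_right_mono visited_live_leaves[OF f x])
  finally have "p * 2 ^ k \<le> real (E x) + ?R"
    using many by linarith
  also have "\<dots> \<le> (1 + 4 * ?S) * real (E x)"
    using R by (simp add: algebra_simps)
  finally have *: "p * 2 ^ k \<le> (1 + 4 * ?S) * real (E x)" .
  have "real (U x) \<le> 2 ^ Suc k"
    using k(3) by (metis less_imp_le of_nat_le_iff of_nat_numeral of_nat_power)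
  then have "p * real (U x) \<le> p * 2 ^ Suc k"
    using p by (intro mult_left_mono)
  also have "\<dots> \<le> 2 * (1 + 4 * ?S) * real (E x)"
    using * by (simp add: algebra_simps)
  finally show ?thesis by (simp add: divide_simps mult.commute add_pos_nonneg)
qed

lemma linear_escape_if_eventually_many_live_leaves:
  assumes x: "x \<in> T" "tau x = b" and p: "p \<ge> 0"
    and many: "eventually (\<lambda>k. p * 2 ^ k \<le> real (card {z\<in>leaves k x. live \<rho> z})) sequentially"
  shows "\<exists>K. \<forall>U D E. flow \<rho> U D E \<longrightarrow>
    p / (2 * (1 + 4 * real stride)) * real (U x) - K \<le> real (E x)"
proof -
  have "(\<lambda>k. real (2 * k * stride) / 2 ^ k) \<longlonglongrightarrow> 0"
  proof -
    have "(\<lambda>k. 2 * real stride * (real k * (1 / 2) ^ k)) \<longlonglongrightarrow> 2 * real stride * 0"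
      by (intro tendsto_intros powser_times_n_limit_0) auto
    then show ?thesis by (simp add: power_one_over field_simps)
  qed
  then have "eventually (\<lambda>k. real (2 * k * stride) / 2 ^ k < 1) sequentially"
    by (rule order_tendstoD) simp
  then have "eventually (\<lambda>k. 2 * k * stride \<le> 2 ^ k) sequentially"
  proof eventually_elim
    case (elim k)
    then have "real (2 * k * stride) < 2 ^ k" by (simp add: divide_simps)
    then have "real (2 * k * stride) < real (2 ^ k)" by simp
    then show ?case by (simp only: of_nat_less_iff less_imp_le)
  qed
  then have "eventually (\<lambda>k. 2 * k * stride \<le> 2 ^ k \<and>
      p * 2 ^ k \<le> real (card {z\<in>leaves k x. live \<rho> z})) sequentially"
    using many by (rule eventually_conj)
  then obtain k0 where k0: "\<And>k. k \<ge> k0 \<Longrightarrow> 2 * k * stride \<le> 2 ^ k"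
      "\<And>k. k \<ge> k0 \<Longrightarrow> p * 2 ^ k \<le> real (card {z\<in>leaves k x. live \<rho> z})"
    unfolding eventually_sequentially by blast
  define c where "c = p / (2 * (1 + 4 * real stride))"
  have c: "c \<ge> 0" using p by (simp add: c_def)
  \<comment> \<open>\<open>K = c * 2 ^ k0\<close> absorbs the entry counts below
    \<open>2 ^ k0\<close>, which fit no depth \<open>k \<ge> k0\<close>.\<close>
  have "c * real (U x) - c * 2 ^ k0 \<le> real (E x)" if f: "flow \<rho> U D E" for U D E
  proof (cases "U x < 2 ^ k0")
    case True
    then have "real (U x) \<le> 2 ^ k0"
      by (metis less_imp_le of_nat_le_iff of_nat_numeral of_nat_power)
    then have "c * real (U x) \<le> c * 2 ^ k0" using c by (rule mult_left_mono)
    then show ?thesis by (simp add: order_trans[of _ 0])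
  next
    case False
    then have "U x \<ge> 1" using zero_less_power[of "2 :: nat" k0] by linarith
    then obtain k where k: "2 ^ k \<le> U x" "U x < 2 ^ Suc k"
      using ex_power_ivl1[of 2 "U x"] by auto
    have "k \<ge> k0"
    proof (rule ccontr)
      assume "\<not> k \<ge> k0"
      then have "(2::nat) ^ Suc k \<le> 2 ^ k0" by (intro power_increasing) auto
      with k False show False by linarith
    qed
    then have "c * real (U x) \<le> real (E x)"
      unfolding c_def using escapes_if_many_live_leaves[OF f x _ _ k p] k0 by blast
    moreover have "c * 2 ^ k0 \<ge> 0" using c by simp
    ultimately show ?thesis by linarith
  qed
  then show ?thesis unfolding c_def by blast
qed

end

section \<open>Passing between types and convergence of the escape rate\<close>

locale cover = rotor_tree +
  assumes fin_digraph: "fin_digraph G"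
    and strongly_connected: "strongly_connected G"
    and generation: "generation_function G chi"
    and root_type: "i \<in> verts G"
begin

lemma finite_verts: "finite (verts G)"
  using fin_digraph by (rule fin_digraph.finite_verts)

lemma chi_in_verts: "j \<in> verts G \<Longrightarrow> l \<in> {1..deg G j} \<Longrightarrow> chi j l \<in> verts G"
  using generation unfolding generation_function_def by blast

lemma tau_in_verts: "x \<in> T \<Longrightarrow> tau x \<in> verts G"
  by (induction rule: directed_cover.induct) (auto simp: root_type chi_in_verts)

lemma arc_child:
  assumes "e \<in> arcs G"
  obtains l where "l \<in> {1..deg G (tail G e)}" "chi (tail G e) l = head G e"
proof -
  interpret fin_digraph G by (rule fin_digraph)
  have "card {l \<in> {1..deg G (tail G e)}. chi (tail G e) l = head G e} = adj G (tail G e) (head G e)"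
    using generation assms unfolding generation_function_def by simp
  moreover have "adj G (tail G e) (head G e) > 0"
    using assms finite_arcs unfolding adj_def by (auto simp: card_gt_0_iff)
  ultimately have "{l \<in> {1..deg G (tail G e)}. chi (tail G e) l = head G e} \<noteq> {}"
    by (metis card.empty less_irrefl)
  with that show thesis by blast
qed

text \<open>The subtree below a vertex depends only on its type, so one word, read off a directed
  path in \<open>G\<close>, serves all vertices of type \<open>j\<close>.\<close>

lemma word_between_types:
  assumes "j \<in> verts G" "k \<in> verts G"
  shows "\<exists>w. \<forall>x\<in>T. tau x = j \<longrightarrow> w @ x \<in> T \<and> tau (w @ x) = k"
proof -
  interpret fin_digraph G by (rule fin_digraph)
  have "j \<rightarrow>\<^sup>*\<^bsub>G\<^esub> k"
    using strongly_connected assms by (auto simp: strongly_connected_def)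
  then show ?thesis
  proof (induction rule: reachable_induct)
    case base
    show ?case by (intro exI[of _ "[]"]) simp
  next
    case (step u v)
    then obtain e where e: "e \<in> arcs G" "tail G e = u" "head G e = v"
      by (auto simp: arcs_ends_def arc_to_ends_def)
    obtain l where l: "l \<in> {1..deg G u}" "chi u l = v"
      using arc_child[OF e(1)] e by blast
    obtain w where w: "\<forall>x\<in>T. tau x = j \<longrightarrow> w @ x \<in> T \<and> tau (w @ x) = u"
      using step.IH by blast
    have "(l # w) @ x \<in> T \<and> tau ((l # w) @ x) = v" if x: "x \<in> T" "tau x = j" for x
    proof -
      have "w @ x \<in> T" "tau (w @ x) = u" using w x by auto
      then show ?thesis using l by (auto simp: Cons_in_T nchildren_def)
    qed
    then show ?case by blast
  qed
qed

text \<open>From \<open>b\<close> go to a type of out-degree at least 2, branch into its first two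
  children, and return from each to \<open>b\<close>.\<close>

lemma binary_embedding_exists:
  assumes "b \<in> verts G" and "j \<in> verts G" "deg G j \<ge> 2"
  shows "\<exists>v1 v2 w. binary_embedding G chi i b v1 v2 w 1 2"
proof -
  obtain w where w: "\<And>x. x \<in> T \<Longrightarrow> tau x = b \<Longrightarrow> w @ x \<in> T \<and> tau (w @ x) = j"
    using word_between_types[OF assms(1,2)] by blast
  have c: "chi j 1 \<in> verts G" "chi j 2 \<in> verts G"
    using assms chi_in_verts by auto
  obtain v1 where v1: "\<And>x. x \<in> T \<Longrightarrow> tau x = chi j 1 \<Longrightarrow> v1 @ x \<in> T \<and> tau (v1 @ x) = b"
    using word_between_types[OF c(1) assms(1)] by blast
  obtain v2 where v2: "\<And>x. x \<in> T \<Longrightarrow> tau x = chi j 2 \<Longrightarrow> v2 @ x \<in> T \<and> tau (v2 @ x) = b"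
    using word_between_types[OF c(2) assms(1)] by blast
  have "v1 @ 1 # w @ x \<in> T \<and> tau (v1 @ 1 # w @ x) = b \<and>
      v2 @ 2 # w @ x \<in> T \<and> tau (v2 @ 2 # w @ x) = b" if x: "x \<in> T" "tau x = b" for x
  proof -
    have y: "w @ x \<in> T" "tau (w @ x) = j" using w[OF x] by auto
    then have "1 # w @ x \<in> T" "2 # w @ x \<in> T"
      using assms(3) by (auto simp: Cons_in_T nchildren_def)
    then show ?thesis using v1[of "1 # w @ x"] v2[of "2 # w @ x"] y by simp
  qed
  then have "binary_embedding G chi i b v1 v2 w 1 2"
    by unfold_locales auto
  then show ?thesis by blast
qed

text \<open>A descendant of type \<open>b\<close> at distance \<open>L\<close> below
  \<open>x\<close> is entered at least \<open>U x - L * (E x + 1)\<close> times. Inserting this into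
  its linear bound and solving for \<open>E x\<close> gives the rate
  \<open>c / (1 + c * L)\<close>.\<close>

lemma lower_rate_from_type:
  assumes b: "b \<in> verts G" and c: "c > 0"
    and low: "\<And>x. x \<in> T \<Longrightarrow> tau x = b \<Longrightarrow>
      \<exists>K. \<forall>U D E. flow \<rho> U D E \<longrightarrow> c * real (U x) - K \<le> real (E x)"
  obtains e where "\<And>j. e j > 0" "lower_rate \<rho> e"
proof -
  have "\<forall>j\<in>verts G. \<exists>w. \<forall>x\<in>T. tau x = j \<longrightarrow> w @ x \<in> T \<and> tau (w @ x) = b"
    using word_between_types b by blast
  then obtain w where w: "\<And>x. x \<in> T \<Longrightarrow> w (tau x) @ x \<in> T \<and> tau (w (tau x) @ x) = b"
    using tau_in_verts by metis
  define e where "e j = c / (1 + c * real (length (w j)))" for j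
  have e: "e j > 0" for j
    using c by (simp add: e_def add_pos_nonneg)
  moreover have "lower_rate \<rho> e"
    unfolding lower_rate_def
  proof
    fix x assume x: "x \<in> T"
    define y where "y = w (tau x) @ x"
    define L where "L = real (length (w (tau x)))"
    have y: "y \<in> T" "tau y = b" using w[OF x] by (auto simp: y_def)
    obtain K where K: "\<And>U D E. flow \<rho> U D E \<Longrightarrow> c * real (U y) - K \<le> real (E y)"
      using low[OF y] by blast
    have "e (tau x) * real (U x) - (c * L + K) / (1 + c * L) \<le> real (E x)" if f: "flow \<rho> U D E" for U D E
    proof -
      have d: "E y \<le> E x \<and> U x \<le> U y + length (w (tau x)) * (E x + 1)"
        using flow_descend[OF f, of "w (tau x)" x] y unfolding y_def by simp
      then have "real (U x) \<le> real (U y) + L * (real (E x) + 1)"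
        unfolding L_def by (metis of_nat_1 of_nat_add of_nat_le_iff of_nat_mult)
      then have "c * (real (U x) - L * (real (E x) + 1)) \<le> c * real (U y)"
        using c by (intro mult_left_mono) auto
      also have "\<dots> \<le> real (E x) + K"
        using K[OF f] d by linarith
      finally have "c * real (U x) - (c * L + K) \<le> real (E x) * (1 + c * L)"
        by (simp add: algebra_simps)
      moreover have "1 + c * L > 0" using c by (simp add: L_def add_pos_nonneg)
      ultimately have "(c * real (U x) - (c * L + K)) / (1 + c * L) \<le> real (E x)"
        by (simp add: divide_le_eq)
      then show ?thesis by (simp add: e_def L_def diff_divide_distrib)
    qed
    then show "\<exists>K. \<forall>U D E. flow \<rho> U D E \<longrightarrow> e (tau x) * real (U x) - K \<le> real (E x)"
      by blast
  qed
  ultimately show thesis by (rule that)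
qed

lemma linear_bound_compare:
  fixes a b :: real
  assumes "\<And>n::nat. a * real n - K \<le> b * real n + C"
  shows "a \<le> b"
proof (rule ccontr)
  assume "\<not> a \<le> b"
  then obtain n :: nat where "real n * (a - b) > C + K"
    using reals_Archimedean3[of "a - b"] by auto
  with assms[of n] show False by (simp add: algebra_simps)
qed

text \<open>Flows with \<open>U [] = n\<close> exist for every \<open>n\<close>, so the slope of the
  lower bound at the root is at most that of each upper bound \<open>trunc_escape k\<close>; in the
  limit \<open>e i \<le> tree_escape i\<close>. By the fixed point equation a zero of
  \<open>tree_escape\<close> is inherited by all descendants, and strong connectivity would bring it
  back to type \<open>i\<close>.\<close>

lemma tree_escape_pos:
  assumes \<rho>: "admissible \<rho>" and low: "lower_rate \<rho> e" and e: "\<And>j. e j > 0" and j: "j \<in> verts G"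
  shows "tree_escape j > 0"
proof (rule ccontr)
  assume "\<not> tree_escape j > 0"
  then have j0: "tree_escape j = 0" using tree_escape_nonneg[of j] by linarith
  have root: "[] \<in> T" by (rule directed_cover.root)
  obtain K where K: "\<And>U D E. flow \<rho> U D E \<Longrightarrow> e (tau []) * real (U []) - K \<le> real (E [])"
    using low root unfolding lower_rate_def by blast
  have "e i \<le> trunc_escape k i" for k
  proof -
    obtain C where C: "\<And>U D E. flow \<rho> U D E \<Longrightarrow>
        real (E []) \<le> trunc_escape k (tau []) * real (U []) + C"
      using upper_rate_trunc_escape[of \<rho> k] root unfolding upper_rate_def by blast
    have "e i * real n - K \<le> trunc_escape k i * real n + C" for n
    proof -
      obtain U D E where f: "flow \<rho> U D E" "U [] = n" using flow_exists[OF \<rho>] by metis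
      show ?thesis using K[OF f(1)] C[OF f(1)] f(2) by simp
    qed
    then show ?thesis by (rule linear_bound_compare)
  qed
  then have "e i \<le> tree_escape i"
    by (intro LIMSEQ_le_const[OF tendsto_tree_escape]) auto
  then have i0: "tree_escape i > 0" using e[of i] by linarith
  obtain v where v: "\<forall>x\<in>T. tau x = i \<longrightarrow> v @ x \<in> T \<and> tau (v @ x) = j"
    using word_between_types[OF root_type j] by blast
  then have y: "v @ [] \<in> T" "tau (v @ []) = j" using root by (metis vtype.simps(1))+
  obtain w where w: "w @ v @ [] \<in> T" "tau (w @ v @ []) = i"
    using word_between_types[OF j root_type] y by blast
  have "tree_escape (tau (w @ v @ [])) = 0" if "w @ v @ [] \<in> T" for w
    using that
  proof (induction w)
    case Nil
    then show ?case using y j0 by simp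
  next
    case (Cons l w)
    let ?j = "tau (w @ v @ [])"
    have "tree_escape ?j = 0" using Cons by (simp add: Cons_in_T)
    then have "escape_op tree_escape ?j = 0" by (simp add: tree_escape_fixpoint)
    moreover have "child_sum tree_escape ?j \<ge> 0"
      by (intro child_sum_nonneg tree_escape_nonneg)
    ultimately have "child_sum tree_escape ?j = 0"
      by (simp add: escape_op_def)
    then show ?case
      using Cons.prems unfolding child_sum_def
      by (subst (asm) sum_nonneg_eq_0_iff) (auto simp: tree_escape_nonneg Cons_in_T nchildren_def)
  qed
  with w i0 show False by fastforce
qed

text \<open>Slopes \<open>t * tree_escape i\<close> with \<open>t < 1\<close> from below and
  \<open>trunc_escape k i\<close> from above enclose the quotient, since additive constants vanish
  after division by \<open>n\<close>.\<close>

theorem escape_rate: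
  assumes \<rho>: "admissible \<rho>" and b: "b \<in> verts G" and c: "c > 0"
    and low: "\<And>x. x \<in> T \<Longrightarrow> tau x = b \<Longrightarrow>
      \<exists>K. \<forall>U D E. flow \<rho> U D E \<longrightarrow> c * real (U x) - K \<le> real (E x)"
  shows "(\<lambda>n. real (escape_count G chi i \<rho> n) / real n) \<longlonglongrightarrow> tree_escape i"
proof -
  obtain e where e: "\<And>j. e j > 0" "lower_rate \<rho> e"
    using lower_rate_from_type[OF b c low] by metis
  note pos = tree_escape_pos[OF \<rho> e(2,1)]
  have ne: "verts G \<noteq> {}" using root_type by blast
  \<comment> \<open>As \<open>tree_escape\<close> is at most 1, \<open>s * tree_escape\<close> lies
    below \<open>e\<close> and can start the improvement.\<close>
  define s where "s = min 1 (Min (e ` verts G))"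
  have s: "0 < s" "s \<le> 1" "\<And>j. j \<in> verts G \<Longrightarrow> s \<le> e j"
    using e(1) ne finite_verts by (auto simp: s_def min_le_iff_disj)
  have low_s: "lower_rate \<rho> (\<lambda>j. s * tree_escape j)"
  proof (rule lower_rate_mono[OF e(2)])
    fix x assume "x \<in> T"
    then have "s \<le> e (tau x)" using s(3) tau_in_verts by blast
    moreover have "s * tree_escape (tau x) \<le> s * 1"
      using tree_escape_le[of "tau x" 0] s(1) by (intro mult_left_mono) auto
    ultimately show "s * tree_escape (tau x) \<le> e (tau x)" by simp
  qed
  define S where "S = Min (child_sum tree_escape ` verts G)"
  have cs: "child_sum tree_escape j > 0" if "j \<in> verts G" for j
  proof -
    have "child_sum tree_escape j \<noteq> 0"
      using pos[OF that] tree_escape_fixpoint[of j] by (auto simp: escape_op_def)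
    then show ?thesis
      using child_sum_nonneg[of tree_escape j] tree_escape_nonneg by fastforce
  qed
  have S: "S > 0" "\<And>x. x \<in> T \<Longrightarrow> S \<le> child_sum tree_escape (tau x)"
    using cs ne finite_verts tau_in_verts by (auto simp: S_def)
  have low_all: "lower_rate \<rho> (\<lambda>j. t * tree_escape j)" if "t < 1" for t
    by (rule lower_rate_tree_escape[OF low_s s(1,2) S that])
  have root: "[] \<in> T" by (rule directed_cover.root)
  let ?a = "\<lambda>n. real (escape_count G chi i \<rho> n) / real n"
  have const0: "(\<lambda>n. K / real n) \<longlonglongrightarrow> 0" for K :: real
    by (rule lim_const_over_n)
  show ?thesis
  proof (rule order_tendstoI)
    fix a assume a: "a < tree_escape i"
    have "eventually (\<lambda>t. a < t * tree_escape i) (at_left 1)"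
      by (rule order_tendstoD(1)[OF _ a])
        (rule tendsto_eq_intros | simp)+
    moreover have "eventually (\<lambda>t. t < (1::real)) (at_left 1)"
      by (simp add: eventually_at_left_field) (meson lt_ex)
    ultimately obtain t where t: "a < t * tree_escape i" "t < 1"
      using eventually_happens[OF eventually_conj, of _ "at_left (1::real)"] by force
    obtain K where K: "\<And>U D E. flow \<rho> U D E \<Longrightarrow>
        t * tree_escape (tau []) * real (U []) - K \<le> real (E [])"
      using low_all[OF t(2)] root unfolding lower_rate_def by blast
    have "(\<lambda>n. t * tree_escape i - K / real n) \<longlonglongrightarrow> t * tree_escape i - 0"
      by (intro tendsto_intros const0)
    then have "eventually (\<lambda>n. a < t * tree_escape i - K / real n) sequentially"
      using t by (intro order_tendstoD) auto
    then show "eventually (\<lambda>n. a < ?a n) sequentially"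
      using eventually_gt_at_top[of 0]
    proof eventually_elim
      case (elim n)
      obtain U D E where f: "flow \<rho> U D E" "U [] = n" "E [] = escape_count G chi i \<rho> n"
        using flow_exists[OF \<rho>] by metis
      have "(t * tree_escape i * real n - K) / real n \<le> ?a n"
        using K[OF f(1)] f by (intro divide_right_mono) auto
      with elim show ?case by (simp add: diff_divide_distrib)
    qed
  next
    fix a assume "tree_escape i < a"
    then have "eventually (\<lambda>k. trunc_escape k i < a) sequentially"
      using tendsto_tree_escape by (intro order_tendstoD)
    then obtain k where k: "trunc_escape k i < a"
      by (auto simp: eventually_sequentially)
    obtain C where C: "\<And>U D E. flow \<rho> U D E \<Longrightarrow>
        real (E []) \<le> trunc_escape k (tau []) * real (U []) + C"
      using upper_rate_trunc_escape[of \<rho> k] root unfolding upper_rate_def by blast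
    have "(\<lambda>n. trunc_escape k i + C / real n) \<longlonglongrightarrow> trunc_escape k i + 0"
      by (intro tendsto_intros const0)
    then have "eventually (\<lambda>n. trunc_escape k i + C / real n < a) sequentially"
      using k by (intro order_tendstoD) auto
    then show "eventually (\<lambda>n. ?a n < a) sequentially"
      using eventually_gt_at_top[of 0]
    proof eventually_elim
      case (elim n)
      obtain U D E where f: "flow \<rho> U D E" "U [] = n" "E [] = escape_count G chi i \<rho> n"
        using flow_exists[OF \<rho>] by metis
      have "?a n \<le> (trunc_escape k i * real n + C) / real n"
        using C[OF f(1)] f by (intro divide_right_mono) auto
      with elim show ?case by (simp add: add_divide_distrib)
    qed
  qed
qed

lemma no_live_escape_count:
  assumes "admissible \<rho>" "\<And>x. x \<in> T \<Longrightarrow> \<not> live \<rho> x"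
  shows "escape_count G chi i \<rho> n = 0"
proof -
  obtain U D E where f: "flow \<rho> U D E" "E [] = escape_count G chi i \<rho> n"
    using flow_exists[OF assms(1)] by metis
  then show ?thesis
    using no_live_no_escape[OF f(1) assms(2) directed_cover.root] by simp
qed

end

section \<open>The escape probability of simple random walk\<close>

context rotor_tree
begin

text \<open>The time-reversed path of the walk up to time \<open>t\<close>.\<close>

primrec srw_path :: "nat \<Rightarrow> position list pmf" where
  "srw_path 0 = return_pmf [Some []]"
| "srw_path (Suc t) = srw_path t \<bind> (\<lambda>ps. map_pmf (\<lambda>p. p # ps) (srw_step G chi i (hd ps)))"

lemma pmf_srw_path_Cons:
  "pmf (srw_path (Suc t)) (p # ps) = pmf (srw_path t) ps * pmf (srw_step G chi i (hd ps)) p"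
proof -
  have "ennreal (pmf (srw_path (Suc t)) (p # ps)) =
      (\<integral>\<^sup>+qs. ennreal (pmf (map_pmf (\<lambda>p. p # qs) (srw_step G chi i (hd qs))) (p # ps)) \<partial>srw_path t)"
    by (simp add: ennreal_pmf_bind)
  also have "\<dots> = (\<integral>\<^sup>+qs. ennreal (pmf (srw_step G chi i (hd ps)) p) * indicator {ps} qs \<partial>srw_path t)"
  proof (rule nn_integral_cong)
    fix qs :: "position list"
    show "ennreal (pmf (map_pmf (\<lambda>p. p # qs) (srw_step G chi i (hd qs))) (p # ps)) =
        ennreal (pmf (srw_step G chi i (hd ps)) p) * indicator {ps} qs"
    proof (cases "qs = ps")
      case True
      then show ?thesis using pmf_map_inj'[of "\<lambda>p. p # ps"] by (simp add: inj_def)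
    next
      case False
      then have "p # ps \<notin> set_pmf (map_pmf (\<lambda>p. p # qs) (srw_step G chi i (hd qs)))" by auto
      then show ?thesis using False by (simp add: pmf_eq_0_set_pmf)
    qed
  qed
  also have "\<dots> = ennreal (pmf (srw_path t) ps * pmf (srw_step G chi i (hd ps)) p)"
    by (subst nn_integral_cmult_indicator)
      (auto simp: emeasure_pmf_single ennreal_mult mult.commute)
  finally show ?thesis by (simp add: ennreal_inj)
qed

lemma length_srw_path: "ps \<in> set_pmf (srw_path t) \<Longrightarrow> length ps = Suc t"
  by (induction t arbitrary: ps) auto

lemma pmf_srw_path:
  "pmf (srw_path t) (rev (map xs [0..<Suc t])) =
     (if xs 0 = Some [] then 1 else 0) * (\<Prod>s<t. pmf (srw_step G chi i (xs s)) (xs (Suc s)))"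
proof (induction t)
  case 0
  then show ?case by auto
next
  case (Suc t)
  have "rev (map xs [0..<Suc (Suc t)]) = xs (Suc t) # rev (map xs [0..<Suc t])" by simp
  moreover have "hd (rev (map xs [0..<Suc t])) = xs t" by simp
  ultimately show ?case
    using Suc by (simp only: pmf_srw_path_Cons) (simp add: mult_ac)
qed

lemma space_srw [simp]: "space (srw G chi i) = UNIV"
  and sets_srw: "sets (srw G chi i) = sets (PiM UNIV (\<lambda>_. count_space UNIV))"
proof -
  interpret IT: Ionescu_Tulcea "srw_kernel G chi i" "\<lambda>_. count_space UNIV"
    by (rule Ionescu_Tulcea_srw)
  show "space (srw G chi i) = UNIV" "sets (srw G chi i) = sets (PiM UNIV (\<lambda>_. count_space UNIV))"
    unfolding srw_def IT.PF.space_lim IT.PF.sets_lim by (simp_all add: space_PiM)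
qed

lemma measurable_srw_coordinate [measurable]:
  "(\<lambda>\<omega>. \<omega> t) \<in> measurable (srw G chi i) (count_space UNIV)"
  unfolding measurable_cong_sets[OF sets_srw refl] by (rule measurable_component_singleton) simp

lemma measurable_srw_path:
  "(\<lambda>\<omega>. rev (map \<omega> [0..<n])) \<in> measurable (srw G chi i) (count_space UNIV)"
proof (subst measurable_count_space_eq2_countable, intro conjI ballI)
  fix ps :: "position list"
  have coord: "{\<omega> \<in> space (srw G chi i). \<omega> s = p} \<in> sets (srw G chi i)" for s p
    using measurable_sets[OF measurable_srw_coordinate, of "{p}" s]
    by (simp add: vimage_def Int_def)
  have "rev (map \<omega> [0..<n]) = ps \<longleftrightarrow> length ps = n \<and> (\<forall>s\<in>{..<n}. \<omega> s = rev ps ! s)" for \<omega>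
    unfolding rev_swap list_eq_iff_nth_eq[of "map \<omega> [0..<n]"] by auto
  then have "(\<lambda>\<omega>. rev (map \<omega> [0..<n])) -` {ps} \<inter> space (srw G chi i) =
      (if length ps = n then {\<omega> \<in> space (srw G chi i). \<forall>s\<in>{..<n}. \<omega> s = rev ps ! s} else {})"
    by auto
  also have "\<dots> \<in> sets (srw G chi i)"
    using sets.sets_Collect_finite_All[of "{..<n}" "srw G chi i" "\<lambda>s \<omega>. \<omega> s = rev ps ! s"] coord by simp
  finally show "(\<lambda>\<omega>. rev (map \<omega> [0..<n])) -` {ps} \<inter> space (srw G chi i) \<in> sets (srw G chi i)" .
qed auto

text \<open>Lists of positions form a countable type, so comparing singletons suffices, and those
  are the cylinders of \<open>srw_cylinder\<close>. Questions about finite stretches of the walk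
  thereby move to a pmf.\<close>

lemma distr_srw_path:
  "distr (srw G chi i) (count_space UNIV) (\<lambda>\<omega>. rev (map \<omega> [0..<Suc t])) = measure_pmf (srw_path t)"
    (is "?L = ?R")
proof (rule measure_eqI_countable[where A = UNIV])
  fix ps :: "position list"
  note m = measurable_srw_path[of "Suc t"]
  show "emeasure ?L {ps} = emeasure ?R {ps}"
  proof (cases "length ps = Suc t")
    case True
    define xs where "xs s = rev ps ! s" for s
    have ps: "ps = rev (map xs [0..<Suc t])"
      using True unfolding xs_def by (metis length_rev map_nth rev_rev_ident)
    have "(\<lambda>\<omega>. rev (map \<omega> [0..<Suc t])) -` {ps} \<inter> space (srw G chi i) =
        {\<omega> \<in> space (srw G chi i). \<forall>s\<le>t. \<omega> s = xs s}"
      unfolding ps by (auto simp del: upt_Suc)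
    then show ?thesis
      by (simp only: emeasure_distr[OF m] sets_count_space Pow_UNIV UNIV_I srw_cylinder
          emeasure_pmf_single ps pmf_srw_path)
  next
    case False
    then have "(\<lambda>\<omega>. rev (map \<omega> [0..<Suc t])) -` {ps} \<inter> space (srw G chi i) = {}"
      by (auto simp del: upt_Suc)
    moreover have "ps \<notin> set_pmf (srw_path t)" using length_srw_path False by blast
    ultimately show ?thesis
      by (simp add: emeasure_distr[OF m] emeasure_pmf_single pmf_eq_0_set_pmf del: upt_Suc)
  qed
qed auto

lemma prob_space_srw: "prob_space (srw G chi i)"
proof (rule prob_spaceI)
  have "emeasure (srw G chi i) (space (srw G chi i)) =
      emeasure (distr (srw G chi i) (count_space UNIV) (\<lambda>\<omega>. rev (map \<omega> [0..<Suc 0]))) UNIV"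
    using measurable_srw_path[of "Suc 0"] by (simp add: emeasure_distr)
  also have "\<dots> = 1"
    unfolding distr_srw_path using measure_pmf.emeasure_space_1 by simp
  finally show "emeasure (srw G chi i) (space (srw G chi i)) = 1" .
qed

text \<open>Probability that the walk from \<open>p\<close> avoids the sink up to time
  \<open>t\<close>, by conditioning on the first step. The sink needs the explicit value 0, because
  \<open>srw_step\<close> leads from it back to the root.\<close>

primrec avoid_prob :: "nat \<Rightarrow> position \<Rightarrow> real" where
  "avoid_prob 0 p = of_bool (p \<noteq> None)"
| "avoid_prob (Suc t) p = (case p of None \<Rightarrow> 0
     | Some x \<Rightarrow> (\<Sum>k=0..nch x. avoid_prob t (neighbour x k)) / real (nch x + 1))"

lemma avoid_prob_None [simp]: "avoid_prob t None = 0"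
  by (cases t) auto

lemma avoid_prob_nonneg: "avoid_prob t p \<ge> 0"
  by (induction t arbitrary: p) (auto split: option.split intro!: sum_nonneg divide_nonneg_nonneg)

lemma avoid_prob_step:
  "ennreal (avoid_prob (Suc t) (Some x)) = (\<integral>\<^sup>+p. ennreal (avoid_prob t p) \<partial>srw_step G chi i (Some x))"
proof -
  have "(\<integral>\<^sup>+p. ennreal (avoid_prob t p) \<partial>srw_step G chi i (Some x)) =
      (\<Sum>k=0..nch x. ennreal (avoid_prob t (neighbour x k))) / ennreal (real (nch x + 1))"
    unfolding srw_step_def by (simp add: nn_integral_pmf_of_set flip: ennreal_of_nat_eq_real_of_nat)
  also have "\<dots> = ennreal ((\<Sum>k=0..nch x. avoid_prob t (neighbour x k)) / real (nch x + 1))"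
    unfolding sum_ennreal[OF avoid_prob_nonneg]
    by (rule divide_ennreal) (auto intro: sum_nonneg avoid_prob_nonneg)
  finally show ?thesis by simp
qed

text \<open>Markov property with \<open>t\<close> steps made and \<open>s\<close> still to come. The
  induction moves one step at a time from the path into \<open>avoid_prob\<close>, so
  \<open>s\<close> has to vary.\<close>

lemma avoid_prob_path:
  "(\<integral>\<^sup>+ps. indicator {ps. None \<notin> set ps} ps * ennreal (avoid_prob s (hd ps)) \<partial>srw_path t) =
     ennreal (avoid_prob (s + t) (Some []))"
proof (induction t arbitrary: s)
  case 0
  then show ?case by (simp add: nn_integral_return)
next
  case (Suc t)
  have "(\<integral>\<^sup>+ps. indicator {ps. None \<notin> set ps} ps * ennreal (avoid_prob s (hd ps)) \<partial>srw_path (Suc t)) =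
      (\<integral>\<^sup>+ps. \<integral>\<^sup>+p. indicator {ps. None \<notin> set ps} (p # ps) * ennreal (avoid_prob s p)
        \<partial>srw_step G chi i (hd ps) \<partial>srw_path t)"
    by simp
  also have "\<dots> = (\<integral>\<^sup>+ps. indicator {ps. None \<notin> set ps} ps * ennreal (avoid_prob (Suc s) (hd ps)) \<partial>srw_path t)"
  proof (rule nn_integral_cong_AE, rule AE_pmfI)
    fix ps assume ps: "ps \<in> set_pmf (srw_path t)"
    then have "ps \<noteq> []" using length_srw_path by fastforce
    have "indicator {ps. None \<notin> set ps} (p # ps) * ennreal (avoid_prob s p) =
        indicator {ps. None \<notin> set ps} ps * ennreal (avoid_prob s p)" for p
      by (cases p) (auto simp: indicator_def)
    then have *: "(\<integral>\<^sup>+p. indicator {ps. None \<notin> set ps} (p # ps) * ennreal (avoid_prob s p)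
        \<partial>srw_step G chi i (hd ps)) =
      indicator {ps. None \<notin> set ps} ps * (\<integral>\<^sup>+p. ennreal (avoid_prob s p) \<partial>srw_step G chi i (hd ps))"
      by (simp add: nn_integral_cmult)
    show "(\<integral>\<^sup>+p. indicator {ps. None \<notin> set ps} (p # ps) * ennreal (avoid_prob s p)
        \<partial>srw_step G chi i (hd ps)) =
      indicator {ps. None \<notin> set ps} ps * ennreal (avoid_prob (Suc s) (hd ps))"
    proof (cases "None \<in> set ps")
      case False
      then obtain x where "hd ps = Some x"
        using \<open>ps \<noteq> []\<close> by (metis hd_in_set not_None_eq)
      then show ?thesis unfolding * using avoid_prob_step by simp
    qed (simp add: *)
  qed
  also have "\<dots> = ennreal (avoid_prob (s + Suc t) (Some []))"
    unfolding Suc.IH by simp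
  finally show ?case .
qed

lemma avoid_until_vimage:
  "{\<omega>. \<forall>s\<le>t. \<omega> s \<noteq> None} =
    (\<lambda>\<omega>. rev (map \<omega> [0..<Suc t])) -` {ps. None \<notin> set ps} \<inter> space (srw G chi i)"
proof -
  have "set (rev (map \<omega> [0..<Suc t])) = \<omega> ` {..t}" for \<omega> :: "nat \<Rightarrow> position"
    by (simp add: atLeast0LessThan lessThan_Suc_atMost del: upt_Suc)
  moreover have "{\<omega> :: nat \<Rightarrow> position. \<forall>s\<le>t. \<omega> s \<noteq> None} = {\<omega>. None \<notin> \<omega> ` {..t}}"
    by (intro Collect_cong) (metis atMost_iff imageE image_eqI)
  ultimately show ?thesis by (simp add: vimage_def del: upt_Suc)
qed

lemma srw_avoid_until:
  "measure (srw G chi i) {\<omega>. \<forall>s\<le>t. \<omega> s \<noteq> None} = avoid_prob t (Some [])"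
proof -
  note m = measurable_srw_path[of "Suc t"]
  have "emeasure (srw G chi i) {\<omega>. \<forall>s\<le>t. \<omega> s \<noteq> None} =
      emeasure (distr (srw G chi i) (count_space UNIV) (\<lambda>\<omega>. rev (map \<omega> [0..<Suc t]))) {ps. None \<notin> set ps}"
  proof (subst emeasure_distr[OF m])
    show "emeasure (srw G chi i) {\<omega>. \<forall>s\<le>t. \<omega> s \<noteq> None} = emeasure (srw G chi i)
        ((\<lambda>\<omega>. rev (map \<omega> [0..<Suc t])) -` {ps. None \<notin> set ps} \<inter> space (srw G chi i))"
      by (simp only: avoid_until_vimage)
  qed simp
  also have "\<dots> = (\<integral>\<^sup>+ps. indicator {ps. None \<notin> set ps} ps \<partial>srw_path t)"
    unfolding distr_srw_path by simp
  also have "\<dots> = (\<integral>\<^sup>+ps. indicator {ps. None \<notin> set ps} ps * ennreal (avoid_prob 0 (hd ps)) \<partial>srw_path t)"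
  proof (rule nn_integral_cong_AE, rule AE_pmfI)
    fix ps assume "ps \<in> set_pmf (srw_path t)"
    then have "hd ps \<in> set ps" using length_srw_path by (metis hd_in_set list.size(3) nat.distinct(1))
    then have "None \<notin> set ps \<Longrightarrow> hd ps \<noteq> None" by metis
    then show "(indicator {ps. None \<notin> set ps} ps :: ennreal) =
        indicator {ps. None \<notin> set ps} ps * ennreal (avoid_prob 0 (hd ps))"
      by (auto simp: indicator_def)
  qed
  also have "\<dots> = ennreal (avoid_prob t (Some []))"
    using avoid_prob_path[where s = 0 and t = t] by (simp only: add_0)
  finally show ?thesis by (simp add: measure_def avoid_prob_nonneg)
qed

lemma avoid_prob_decseq: "decseq (\<lambda>t. avoid_prob t p)"
proof (rule decseq_SucI)
  show "avoid_prob (Suc t) p \<le> avoid_prob t p" for t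
  proof (induction t arbitrary: p)
    case 0
    have "(\<Sum>k=0..nch x. of_bool (neighbour x k \<noteq> None)) \<le> real (nch x + 1)" for x
      using sum_mono[of "{0..nch x}" "\<lambda>k. of_bool (neighbour x k \<noteq> None)" "\<lambda>_. 1 :: real"] by auto
    then show ?case by (auto split: option.split simp: divide_le_eq)
  next
    case (Suc t)
    show ?case
    proof (cases p)
      case (Some x)
      have "(\<Sum>k=0..nch x. avoid_prob (Suc t) (neighbour x k)) / real (nch x + 1) \<le>
          (\<Sum>k=0..nch x. avoid_prob t (neighbour x k)) / real (nch x + 1)"
        by (intro divide_right_mono sum_mono Suc) auto
      then show ?thesis using Some by (simp only: avoid_prob.simps(2) option.case)
    qed simp
  qed
qed

lemma srw_escape_prob_limit: "(\<lambda>t. avoid_prob t (Some [])) \<longlonglongrightarrow> srw_escape_prob G chi i"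
proof -
  interpret prob_space "srw G chi i" by (rule prob_space_srw)
  have "{\<omega>. \<forall>s\<le>t. \<omega> s \<noteq> None} \<in> sets (srw G chi i)" for t
  proof -
    have "{\<omega>. \<forall>s\<le>t. \<omega> s \<noteq> None} =
        (\<lambda>\<omega>. rev (map \<omega> [0..<Suc t])) -` {ps. None \<notin> set ps} \<inter> space (srw G chi i)"
      by (rule avoid_until_vimage)
    then show ?thesis using measurable_sets[OF measurable_srw_path, of "{ps. None \<notin> set ps}" "Suc t"] by simp
  qed
  then have "(\<lambda>t. prob {\<omega>. \<forall>s\<le>t. \<omega> s \<noteq> None}) \<longlonglongrightarrow> prob (\<Inter>t. {\<omega>. \<forall>s\<le>t. \<omega> s \<noteq> None})"
    by (intro finite_Lim_measure_decseq) (auto simp: decseq_def)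
  moreover have "(\<Inter>t. {\<omega>. \<forall>s\<le>t. \<omega> s \<noteq> None}) = {\<omega> \<in> space (srw G chi i). \<forall>t. \<omega> t \<noteq> None}"
    by auto
  ultimately show ?thesis
    unfolding srw_avoid_until srw_escape_prob_def by simp
qed

section \<open>The escape probability as the fixed point \<open>tree_escape\<close>\<close>

definition never_sink :: "position \<Rightarrow> real" where
  "never_sink p = lim (\<lambda>t. avoid_prob t p)"

lemma tendsto_never_sink: "(\<lambda>t. avoid_prob t p) \<longlonglongrightarrow> never_sink p"
  using decseq_convergent[OF avoid_prob_decseq[of p], of 0] avoid_prob_nonneg
  unfolding never_sink_def by (metis limI)

lemma never_sink_le_1: "never_sink p \<le> 1"
  using decseq_ge[OF avoid_prob_decseq tendsto_never_sink, of p 0] by (cases p) auto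

lemma never_sink_None [simp]: "never_sink None = 0"
  using LIMSEQ_unique[OF tendsto_never_sink[of None]] by (simp add: tendsto_const)

lemma sum_neighbour:
  "(\<Sum>k=0..nch x. f (neighbour x k)) = f (neighbour x 0) + (\<Sum>l=1..nch x. f (Some (l # x)))"
proof -
  have "(\<Sum>k=0..nch x. f (neighbour x k)) = f (neighbour x 0) + (\<Sum>l=1..nch x. f (neighbour x l))"
    by (simp add: sum.atLeast_Suc_atMost)
  also have "(\<Sum>l=1..nch x. f (neighbour x l)) = (\<Sum>l=1..nch x. f (Some (l # x)))"
    by (intro sum.cong) (auto simp: neighbour_def)
  finally show ?thesis .
qed

lemma never_sink_harmonic:
  "real (nch x + 1) * never_sink (Some x) = never_sink (neighbour x 0) + (\<Sum>l=1..nch x. never_sink (Some (l # x)))"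
proof -
  have "(\<lambda>t. avoid_prob (Suc t) (Some x)) \<longlonglongrightarrow>
      (\<Sum>k=0..nch x. never_sink (neighbour x k)) / real (nch x + 1)"
    unfolding avoid_prob.simps option.case by (intro tendsto_intros tendsto_never_sink) simp
  then have "never_sink (Some x) = (\<Sum>k=0..nch x. never_sink (neighbour x k)) / real (nch x + 1)"
    by (rule LIMSEQ_unique[OF LIMSEQ_Suc[OF tendsto_never_sink]])
  then have "real (nch x + 1) * never_sink (Some x) = (\<Sum>k=0..nch x. never_sink (neighbour x k))"
    by (simp add: field_simps)
  then show ?thesis by (simp only: sum_neighbour)
qed

text \<open>From \<open>x\<close> the walk either gets \<open>k\<close> levels down before visiting
  the parent, with probability \<open>trunc_escape k (tau x)\<close>, or returns to the parent and
  starts afresh. The proof inserts these bounds for the children into the harmonic equation and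
  solves for the value at \<open>x\<close>.\<close>

lemma never_sink_le_trunc_escape:
  "never_sink (Some x) \<le> trunc_escape k (tau x) + (1 - trunc_escape k (tau x)) * never_sink (neighbour x 0)"
proof (induction k arbitrary: x)
  case 0
  then show ?case by (simp add: never_sink_le_1)
next
  case (Suc k)
  let ?h = "never_sink (Some x)" and ?p = "never_sink (neighbour x 0)"
  define S where "S = child_sum (trunc_escape k) (tau x)"
  have S: "S \<ge> 0" unfolding S_def by (intro child_sum_nonneg trunc_escape_nonneg)
  have S_eq: "S = (\<Sum>l=1..nch x. trunc_escape k (tau (l # x)))"
    unfolding S_def by (rule child_sum_tau)
  have nb: "l \<noteq> 0 \<Longrightarrow> neighbour (l # x) 0 = Some x" for l by (simp add: neighbour_def)
  have "(\<Sum>l=1..nch x. never_sink (Some (l # x))) \<le>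
      (\<Sum>l=1..nch x. trunc_escape k (tau (l # x)) + (1 - trunc_escape k (tau (l # x))) * ?h)"
  proof (rule sum_mono)
    fix l assume "l \<in> {1..nch x}"
    then show "never_sink (Some (l # x)) \<le>
        trunc_escape k (tau (l # x)) + (1 - trunc_escape k (tau (l # x))) * ?h"
      using Suc.IH[of "l # x"] nb[of l] by simp
  qed
  also have "\<dots> = S + (real (nch x) - S) * ?h"
    unfolding S_eq sum.distrib sum_distrib_right[symmetric] sum_subtractf by simp
  finally have "?h * (1 + S) \<le> S + ?p"
    using never_sink_harmonic[of x] by (simp add: algebra_simps)
  then have "?h \<le> (S + ?p) / (1 + S)" using S by (simp add: pos_le_divide_eq)
  also have "(S + ?p) / (1 + S) = S / (1 + S) + (1 - S / (1 + S)) * ?p"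
  proof -
    have "1 - S / (1 + S) = 1 / (1 + S)"
      using S by (simp add: divide_simps)
    then show ?thesis by (simp only: add_divide_distrib) simp
  qed
  finally show ?case by (simp add: trunc_escape_Suc escape_op_def S_def)
qed

text \<open>Probability, according to \<open>tree_escape\<close>, that the walk from a vertex returns to the sink.\<close>

primrec return_prob :: "vertex \<Rightarrow> real" where
  "return_prob [] = 1 - tree_escape i"
| "return_prob (l # x) = (1 - tree_escape (tau (l # x))) * return_prob x"

lemma return_prob_bounds: "0 \<le> return_prob x \<and> return_prob x \<le> 1"
proof (induction x)
  case Nil
  then show ?case using tree_escape_le[of i 0] tree_escape_nonneg[of i] by simp
next
  case (Cons l x)
  then show ?case
    using tree_escape_le[of "tau (l # x)" 0] tree_escape_nonneg[of "tau (l # x)"]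
    by (simp add: mult_le_one)
qed

text \<open>By the fixed point equation the parent has the value
  \<open>(1 + S) * return_prob x\<close>, while the children sum to
  \<open>(nch x - S) * return_prob x\<close>; the terms with \<open>S\<close> cancel.\<close>

lemma return_prob_harmonic:
  "real (nch x + 1) * return_prob x =
     (case neighbour x 0 of None \<Rightarrow> 1 | Some y \<Rightarrow> return_prob y) + (\<Sum>l=1..nch x. return_prob (l # x))"
proof -
  define S where "S = child_sum tree_escape (tau x)"
  have S: "S \<ge> 0" unfolding S_def by (intro child_sum_nonneg tree_escape_nonneg)
  define g where "g = (case neighbour x 0 of None \<Rightarrow> 1 | Some y \<Rightarrow> return_prob y)"
  have "1 - tree_escape (tau x) = 1 / (1 + S)"
    using tree_escape_fixpoint[of "tau x"] S by (simp add: escape_op_def S_def[symmetric] field_simps)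
  moreover have "return_prob x = (1 - tree_escape (tau x)) * g"
    by (cases x) (auto simp: g_def neighbour_def)
  ultimately have g: "g = (1 + S) * return_prob x" using S by simp
  have "(\<Sum>l=1..nch x. return_prob (l # x)) = (real (nch x) - S) * return_prob x"
    by (simp add: S_def child_sum_tau sum_subtractf flip: sum_distrib_right)
  then show ?thesis using g unfolding g_def by (simp add: algebra_simps)
qed

text \<open>Comparison principle: \<open>1 - return_prob\<close> is harmonic, at most 1, and
  consistent with the value 0 at the sink, so averaging keeps it below \<open>avoid_prob\<close> at
  all times.\<close>

lemma return_prob_avoid_prob: "1 - return_prob x \<le> avoid_prob t (Some x)"
proof (induction t arbitrary: x)
  case 0
  then show ?case using return_prob_bounds[of x] by simp
next
  case (Suc t)
  have nb: "(case neighbour x 0 of None \<Rightarrow> 0 | Some y \<Rightarrow> 1 - return_prob y) \<le> avoid_prob t (neighbour x 0)"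
    using Suc by (auto split: option.split)
  have "real (nch x + 1) * (1 - return_prob x) =
      (case neighbour x 0 of None \<Rightarrow> 0 | Some y \<Rightarrow> 1 - return_prob y) + (\<Sum>l=1..nch x. 1 - return_prob (l # x))"
    using return_prob_harmonic[of x]
    by (auto simp: algebra_simps sum_subtractf split: option.splits)
  also have "\<dots> \<le> avoid_prob t (neighbour x 0) + (\<Sum>l=1..nch x. avoid_prob t (Some (l # x)))"
    by (intro add_mono nb sum_mono Suc)
  also have "\<dots> = real (nch x + 1) * avoid_prob (Suc t) (Some x)"
    by (simp add: sum_neighbour)
  finally show ?case by (rule mult_left_le_imp_le) simp
qed

theorem srw_escape_prob_eq: "srw_escape_prob G chi i = tree_escape i"
proof (rule antisym)
  have lim: "srw_escape_prob G chi i = never_sink (Some [])"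
    using LIMSEQ_unique[OF srw_escape_prob_limit tendsto_never_sink] .
  have "never_sink (Some []) \<le> trunc_escape k i" for k
    using never_sink_le_trunc_escape[of "[]" k] by (simp add: neighbour_def)
  then show "srw_escape_prob G chi i \<le> tree_escape i"
    unfolding lim by (intro LIMSEQ_le_const[OF tendsto_tree_escape]) auto
  show "tree_escape i \<le> srw_escape_prob G chi i"
    using return_prob_avoid_prob[of "[]"]
    by (intro LIMSEQ_le_const[OF srw_escape_prob_limit]) auto
qed

end

section \<open>Survival of the branching process of good children\<close>

lemma prod_one_minus_ge:
  fixes s :: "'a \<Rightarrow> real"
  assumes "finite A" "\<And>l. l \<in> A \<Longrightarrow> 0 \<le> s l \<and> s l \<le> 1"
  shows "1 - sum s A \<le> (\<Prod>l\<in>A. 1 - s l)"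
  using assms
proof (induction rule: finite_induct)
  case (insert a A)
  have "(1 - s a) * (1 - sum s A) \<le> (1 - s a) * (\<Prod>l\<in>A. 1 - s l)"
    using insert by (intro mult_left_mono) auto
  moreover have "0 \<le> s a * sum s A"
    using insert by (intro mult_nonneg_nonneg sum_nonneg) auto
  ultimately show ?case using insert by (simp add: algebra_simps)
qed simp

text \<open>Two positive terms have a positive product, which makes the union bound strict. In
  \<open>extinction\<close> this excludes two surviving children.\<close>

lemma prod_one_minus_gt:
  fixes s :: "'a \<Rightarrow> real"
  assumes A: "finite A" "\<And>l. l \<in> A \<Longrightarrow> 0 \<le> s l \<and> s l \<le> 1"
    and ab: "a \<in> A" "b \<in> A" "a \<noteq> b" "s a > 0" "s b > 0"
  shows "1 - sum s A < (\<Prod>l\<in>A. 1 - s l)"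
proof -
  have "s b \<le> sum s (A - {a})"
    using A ab by (intro member_le_sum) auto
  then have "0 < s a * sum s (A - {a})" using ab by simp
  moreover have "(1 - s a) * (1 - sum s (A - {a})) \<le> (1 - s a) * (\<Prod>l\<in>A - {a}. 1 - s l)"
    using A ab by (intro mult_left_mono prod_one_minus_ge) auto
  ultimately show ?thesis
    using A ab by (simp add: sum.remove[of A a] prod.remove[of A a] algebra_simps)
qed

text \<open>The error is quadratic, so for small \<open>s\<close> a linear gain can outweigh it;
  \<open>survival_positive\<close> relies on this.\<close>

lemma prod_one_minus_le:
  fixes s :: "'a \<Rightarrow> real"
  assumes "finite A" "\<And>l. l \<in> A \<Longrightarrow> 0 \<le> s l \<and> s l \<le> 1"
  shows "(\<Prod>l\<in>A. 1 - s l) \<le> 1 - sum s A + (sum s A)\<^sup>2"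
  using assms
proof (induction rule: finite_induct)
  case (insert a A)
  let ?S = "sum s A"
  have S: "0 \<le> ?S" using insert by (intro sum_nonneg) auto
  have "(1 - s a) * (\<Prod>l\<in>A. 1 - s l) \<le> (1 - s a) * (1 - ?S + ?S\<^sup>2)"
    using insert by (intro mult_left_mono) auto
  also have "\<dots> \<le> 1 - (s a + ?S) + (s a + ?S)\<^sup>2"
  proof -
    have "0 \<le> s a * ?S" "0 \<le> s a * ?S\<^sup>2" "0 \<le> (s a)\<^sup>2"
      using insert S by auto
    then show ?thesis by (simp add: power2_eq_square algebra_simps)
  qed
  finally show ?case using insert by simp
qed simp

section \<open>Survival probabilities and the first moment matrix\<close>

locale rotor_law = cover +
  fixes \<D> :: "nat \<Rightarrow> nat pmf" and m :: nat
  assumes verts: "verts G = {1..m}"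
    and support: "\<And>j. j \<in> {1..m} \<Longrightarrow> set_pmf (\<D> j) \<subseteq> {0..deg G j}"
begin

lemma sum_pmf_D: "j \<in> verts G \<Longrightarrow> (\<Sum>k=0..deg G j. pmf (\<D> j) k) = 1"
  using support verts by (intro sum_pmf_eq_1) auto

text \<open>The action of the first moment matrix on functions of the type; see
  \<open>mean_op_matrix\<close>.\<close>

definition mean_op :: "(nat \<Rightarrow> real) \<Rightarrow> nat \<Rightarrow> real" where
  "mean_op s j = (\<Sum>k=0..deg G j. pmf (\<D> j) k * (\<Sum>l\<in>{k+1..deg G j}. s (chi j l)))"

text \<open>One minus the offspring generating function at \<open>1 - s\<close>: the probability
  that some good child is kept when a child of type \<open>t\<close> is kept independently with
  probability \<open>s t\<close>.\<close>

definition survival_op :: "(nat \<Rightarrow> real) \<Rightarrow> nat \<Rightarrow> real" where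
  "survival_op s j = 1 - (\<Sum>k=0..deg G j. pmf (\<D> j) k * (\<Prod>l\<in>{k+1..deg G j}. 1 - s (chi j l)))"

definition survival :: "nat \<Rightarrow> nat \<Rightarrow> real" where
  "survival h = (survival_op ^^ h) (\<lambda>_. 1)"

lemma survival_0 [simp]: "survival 0 j = 1"
  and survival_Suc: "survival (Suc h) = survival_op (survival h)"
  by (simp_all add: survival_def)

definition type_prob :: "(nat \<Rightarrow> real) \<Rightarrow> bool" where
  "type_prob s \<longleftrightarrow> (\<forall>j\<in>verts G. 0 \<le> s j \<and> s j \<le> 1)"

lemma type_probD: "type_prob s \<Longrightarrow> j \<in> verts G \<Longrightarrow> l \<in> {1..deg G j} \<Longrightarrow> 0 \<le> s (chi j l) \<and> s (chi j l) \<le> 1"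
  using chi_in_verts by (auto simp: type_prob_def)

lemma survival_op_eq:
  assumes "j \<in> verts G"
  shows "survival_op s j = (\<Sum>k=0..deg G j. pmf (\<D> j) k * (1 - (\<Prod>l\<in>{k+1..deg G j}. 1 - s (chi j l))))"
  using sum_pmf_D[OF assms] by (simp add: survival_op_def right_diff_distrib sum_subtractf)

lemma type_prob_survival_op:
  assumes "type_prob s"
  shows "type_prob (survival_op s)"
  unfolding type_prob_def
proof (intro ballI conjI)
  fix j assume j: "j \<in> verts G"
  have b: "0 \<le> (\<Prod>l\<in>{k+1..deg G j}. 1 - s (chi j l)) \<and> (\<Prod>l\<in>{k+1..deg G j}. 1 - s (chi j l)) \<le> 1" for k
    using type_probD[OF assms j] by (intro conjI prod_nonneg prod_le_1) force+
  show "survival_op s j \<le> 1"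
    unfolding survival_op_def using b by (simp add: sum_nonneg)
  show "0 \<le> survival_op s j"
    unfolding survival_op_eq[OF j] using b by (intro sum_nonneg mult_nonneg_nonneg) auto
qed

lemma survival_op_mono:
  assumes "type_prob s" "type_prob s'" "\<And>j. j \<in> verts G \<Longrightarrow> s j \<le> s' j" and j: "j \<in> verts G"
  shows "survival_op s j \<le> survival_op s' j"
  unfolding survival_op_def
proof (intro diff_left_mono sum_mono mult_left_mono prod_mono)
  fix k l assume "l \<in> {k+1..deg G j}"
  then have l: "l \<in> {1..deg G j}" by auto
  show "0 \<le> 1 - s' (chi j l) \<and> 1 - s' (chi j l) \<le> 1 - s (chi j l)"
    using assms(3)[OF chi_in_verts[OF j l]] type_probD[OF assms(2) j l] by auto
qed simp

lemma type_prob_survival: "type_prob (survival h)"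
proof (induction h)
  case 0
  show ?case by (simp add: type_prob_def)
next
  case (Suc h)
  then show ?case unfolding survival_Suc by (rule type_prob_survival_op)
qed

lemma survival_decseq: "j \<in> verts G \<Longrightarrow> decseq (\<lambda>h. survival h j)"
proof (rule decseq_SucI)
  show "survival (Suc h) j \<le> survival h j" if "j \<in> verts G" for h
    using that
  proof (induction h arbitrary: j)
    case 0
    then show ?case using type_prob_survival[of "Suc 0"] by (simp add: type_prob_def)
  next
    case (Suc h)
    then show ?case
      unfolding survival_Suc[of "Suc h"] survival_Suc[of h]
      by (intro survival_op_mono) (auto simp: type_prob_survival survival_Suc[symmetric])
  qed
qed

definition survival_limit :: "nat \<Rightarrow> real" where
  "survival_limit j = lim (\<lambda>h. survival h j)"

lemma tendsto_survival_limit: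
  assumes "j \<in> verts G"
  shows "(\<lambda>h. survival h j) \<longlonglongrightarrow> survival_limit j"
  using decseq_convergent[OF survival_decseq[OF assms], of 0] type_prob_survival assms
  unfolding survival_limit_def type_prob_def by (metis limI)

lemma type_prob_survival_limit: "type_prob survival_limit"
  unfolding type_prob_def
proof (intro ballI conjI)
  fix j assume j: "j \<in> verts G"
  show "0 \<le> survival_limit j"
    using type_prob_survival j by (intro LIMSEQ_le_const[OF tendsto_survival_limit[OF j]]) (auto simp: type_prob_def)
  show "survival_limit j \<le> 1"
    using type_prob_survival j by (intro LIMSEQ_le_const2[OF tendsto_survival_limit[OF j]]) (auto simp: type_prob_def)
qed

lemma survival_limit_fixpoint:
  assumes j: "j \<in> verts G"
  shows "survival_op survival_limit j = survival_limit j"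
proof (rule LIMSEQ_unique)
  show "(\<lambda>h. survival (Suc h) j) \<longlonglongrightarrow> survival_limit j"
    using tendsto_survival_limit[OF j] by (rule LIMSEQ_Suc)
  show "(\<lambda>h. survival (Suc h) j) \<longlonglongrightarrow> survival_op survival_limit j"
    unfolding survival_Suc survival_op_def
    by (intro tendsto_intros tendsto_survival_limit chi_in_verts[OF j]) auto
qed

lemma mean_op_matrix:
  assumes j: "j \<in> verts G"
  shows "mean_op s j = (\<Sum>k\<in>verts G. mean_offspring G chi \<D> j k * s k)"
proof -
  have "(\<Sum>l\<in>{k+1..deg G j}. s (chi j l)) = (\<Sum>t\<in>verts G. real (good_children G chi j k t) * s t)" for k
  proof -
    have "(\<Sum>t\<in>verts G. \<Sum>l\<in>{l\<in>{k+1..deg G j}. chi j l = t}. s (chi j l)) = (\<Sum>l\<in>{k+1..deg G j}. s (chi j l))"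
      using chi_in_verts[OF j] by (intro sum.group) (auto simp: finite_verts)
    moreover have "(\<Sum>l\<in>{l\<in>{k+1..deg G j}. chi j l = t}. s (chi j l)) = real (good_children G chi j k t) * s t" for t
    proof -
      have "(\<Sum>l\<in>{l\<in>{k+1..deg G j}. chi j l = t}. s (chi j l)) = (\<Sum>l\<in>{l\<in>{k+1..deg G j}. chi j l = t}. s t)"
        by (rule sum.cong) auto
      then show ?thesis by (simp add: good_children_def)
    qed
    ultimately show ?thesis by (simp only:)
  qed
  then have "mean_op s j = (\<Sum>k=0..deg G j. \<Sum>t\<in>verts G. pmf (\<D> j) k * real (good_children G chi j k t) * s t)"
    by (simp add: mean_op_def sum_distrib_left mult.assoc)
  also have "\<dots> = (\<Sum>t\<in>verts G. \<Sum>k=0..deg G j. pmf (\<D> j) k * real (good_children G chi j k t) * s t)"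
    by (rule sum.swap)
  finally show ?thesis
    by (simp add: mean_offspring_def sum_distrib_right)
qed

lemma mean_op_mono:
  assumes "\<And>j. j \<in> verts G \<Longrightarrow> s j \<le> s' j" and j: "j \<in> verts G"
  shows "mean_op s j \<le> mean_op s' j"
  unfolding mean_op_def
  by (intro sum_mono mult_left_mono assms(1) chi_in_verts[OF j]) auto

lemma mean_op_scale: "mean_op (\<lambda>j. c * s j) j = c * mean_op s j"
  by (simp add: mean_op_def sum_distrib_left mult_ac)

lemma mean_op_pow_mono:
  assumes "\<And>j. j \<in> verts G \<Longrightarrow> s j \<le> s' j" and "j \<in> verts G"
  shows "(mean_op ^^ t) s j \<le> (mean_op ^^ t) s' j"
  using assms(2) by (induction t arbitrary: j) (auto intro: assms(1) mean_op_mono)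

lemma mean_op_pow_scale: "(mean_op ^^ t) (\<lambda>j. c * s j) = (\<lambda>j. c * (mean_op ^^ t) s j)"
  by (induction t) (auto simp: mean_op_scale)

lemma survival_op_le_mean_op:
  assumes "type_prob s" and j: "j \<in> verts G"
  shows "survival_op s j \<le> mean_op s j"
  unfolding survival_op_eq[OF j] mean_op_def
proof (intro sum_mono mult_left_mono)
  fix k
  have "1 - (\<Sum>l\<in>{k+1..deg G j}. s (chi j l)) \<le> (\<Prod>l\<in>{k+1..deg G j}. 1 - s (chi j l))"
    using type_probD[OF assms] by (intro prod_one_minus_ge) auto
  then show "1 - (\<Prod>l\<in>{k+1..deg G j}. 1 - s (chi j l)) \<le> (\<Sum>l\<in>{k+1..deg G j}. s (chi j l))"
    by simp
qed simp

abbreviation "moment_matrix \<equiv> first_moment_matrix G chi \<D> m"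

definition type_vec :: "(nat \<Rightarrow> real) \<Rightarrow> complex vec" where
  "type_vec s = vec m (\<lambda>a. complex_of_real (s (Suc a)))"

lemma moment_matrix_carrier: "moment_matrix \<in> carrier_mat m m"
  by (simp add: first_moment_matrix_def)

lemma sum_verts: "(\<Sum>k\<in>verts G. f k) = (\<Sum>a<m. f (Suc a))"
  unfolding verts by (rule sum.reindex_bij_witness[of _ Suc "\<lambda>k. k - 1"]) auto

lemma moment_matrix_type_vec: "moment_matrix *\<^sub>v type_vec s = type_vec (mean_op s)"
proof (rule eq_vecI)
  fix a assume "a < dim_vec (type_vec (mean_op s))"
  then have a: "a < m" by (simp add: type_vec_def)
  then have "Suc a \<in> verts G" by (simp add: verts)
  then show "(moment_matrix *\<^sub>v type_vec s) $ a = type_vec (mean_op s) $ a"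
    using a by (simp add: type_vec_def first_moment_matrix_def scalar_prod_def mean_op_matrix
        sum_verts atLeast0LessThan)
qed (simp add: type_vec_def first_moment_matrix_def)

lemma moment_matrix_pow_type_vec:
  "(moment_matrix ^\<^sub>m n) *\<^sub>v type_vec s = type_vec ((mean_op ^^ n) s)"
proof (induction n arbitrary: s)
  case 0
  have "type_vec s \<in> carrier_vec m" by (simp add: type_vec_def)
  then show ?case using moment_matrix_carrier by simp
next
  case (Suc n)
  have c: "type_vec s \<in> carrier_vec m" by (simp add: type_vec_def)
  have "(moment_matrix ^\<^sub>m Suc n) *\<^sub>v type_vec s = (moment_matrix ^\<^sub>m n) *\<^sub>v (moment_matrix *\<^sub>v type_vec s)"
    using assoc_mult_mat_vec[OF pow_carrier_mat[OF moment_matrix_carrier] moment_matrix_carrier c] by simp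
  then show ?case
    using Suc by (simp add: moment_matrix_type_vec funpow_swap1)
qed

text \<open>At spectral radius 1, Jordan blocks still allow polynomial growth of the matrix powers;
  their size is at most \<open>m\<close>, hence the degree \<open>m - 1\<close>.\<close>

lemma mean_op_pow_polynomial_bound:
  assumes r: "spectral_radius moment_matrix \<le> 1" and s: "type_prob s" and j: "j \<in> verts G"
  shows "\<exists>c1 c2 d. \<forall>n. (mean_op ^^ n) s j \<le> c1 + c2 * real n ^ d"
proof -
  obtain c1 c2 where c: "\<And>n. norm_bound (moment_matrix ^\<^sub>m n) (c1 + c2 * of_nat n ^ (m - 1))"
    using spectral_radius_jnf_norm_bound_le_1_upper_triangular[OF moment_matrix_carrier r] by blast
  obtain a where a: "j = Suc a" "a < m" using j by (cases j) (auto simp: verts)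
  have "(mean_op ^^ n) s j \<le> real m * c1 + (real m * c2) * real n ^ (m - 1)" for n
  proof -
    let ?A = "moment_matrix ^\<^sub>m n"
    have dim: "dim_row ?A = m" "dim_col ?A = m"
      using pow_carrier_mat[OF moment_matrix_carrier, of n] by auto
    have "(mean_op ^^ n) s j \<le> cmod (type_vec ((mean_op ^^ n) s) $ a)"
      using a by (simp add: type_vec_def)
    also have "\<dots> = cmod ((?A *\<^sub>v type_vec s) $ a)"
      by (simp only: moment_matrix_pow_type_vec)
    also have "\<dots> = cmod (\<Sum>b<m. ?A $$ (a, b) * complex_of_real (s (Suc b)))"
      using a dim by (simp add: type_vec_def scalar_prod_def atLeast0LessThan)
    also have "\<dots> \<le> (\<Sum>b<m. cmod (?A $$ (a, b) * complex_of_real (s (Suc b))))"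
      by (rule norm_sum)
    also have "\<dots> \<le> (\<Sum>b<m. c1 + c2 * real n ^ (m - 1))"
    proof (rule sum_mono)
      fix b assume b: "b \<in> {..<m}"
      have "\<bar>s (Suc b)\<bar> \<le> 1" using s b by (auto simp: type_prob_def verts)
      moreover have "cmod (?A $$ (a, b)) \<le> c1 + c2 * real n ^ (m - 1)"
        using c[of n] a b dim by (auto simp: norm_bound_def)
      ultimately have "cmod (?A $$ (a, b)) * \<bar>s (Suc b)\<bar> \<le> (c1 + c2 * real n ^ (m - 1)) * 1"
        by (intro mult_mono) (auto intro: order_trans[OF norm_ge_zero])
      then show "cmod (?A $$ (a, b) * complex_of_real (s (Suc b))) \<le> c1 + c2 * real n ^ (m - 1)"
        by (simp add: norm_mult)
    qed
    finally show ?thesis by (simp add: algebra_simps)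
  qed
  then show ?thesis by blast
qed

lemma exponential_not_polynomial:
  fixes x :: real
  assumes "x > 1" "c > 0"
  shows "\<exists>r. c1 + c2 * real (N * r) ^ d < c * x ^ r"
proof -
  define L where "L = ln x"
  have L: "L > 0" using assms by (simp add: L_def)
  have lim: "filterlim (\<lambda>r. real r * L) at_top sequentially"
    using L by (intro filterlim_at_top_mult_tendsto_pos[OF tendsto_const] filterlim_real_sequentially)
  have "(\<lambda>r. c1 * ((real r * L) ^ 0 / exp (real r * L)) +
      c2 * real N ^ d / L ^ d * ((real r * L) ^ d / exp (real r * L))) \<longlonglongrightarrow>
      c1 * 0 + c2 * real N ^ d / L ^ d * 0"
    by (intro tendsto_add tendsto_mult_left filterlim_compose[OF tendsto_power_div_exp_0 lim])
  moreover have "exp (real r * L) = x ^ r" for r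
    using assms by (simp add: L_def exp_of_nat_mult)
  ultimately have "(\<lambda>r. (c1 + c2 * real (N * r) ^ d) / x ^ r) \<longlonglongrightarrow> 0"
    using L by (simp add: power_mult_distrib add_divide_distrib mult.assoc)
  then have "eventually (\<lambda>r. (c1 + c2 * real (N * r) ^ d) / x ^ r < c) sequentially"
    using assms(2) by (rule order_tendstoD)
  then obtain r where "(c1 + c2 * real (N * r) ^ d) / x ^ r < c"
    by (auto simp: eventually_sequentially)
  then show ?thesis using assms by (intro exI[of _ r]) (simp add: pos_divide_less_eq)
qed

text \<open>If some type has \<open>(mean_op ^^ n) s j = s j\<close> for all \<open>n\<close>, these types are closed under
  surviving offspring, and the maximisers of \<open>s\<close> among them witness singularity; otherwise the
  iterates of \<open>mean_op\<close> grow exponentially.\<close>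

lemma extinction:
  assumes r: "spectral_radius moment_matrix \<le> 1" and ns: "\<not> singular G chi \<D>" and j: "j \<in> verts G"
  shows "survival_limit j = 0"
proof (rule ccontr)
  define s where "s = survival_limit"
  assume "survival_limit j \<noteq> 0"
  then have s_j: "s j > 0"
    using type_prob_survival_limit j unfolding type_prob_def s_def by fastforce
  have s: "type_prob s" unfolding s_def by (rule type_prob_survival_limit)
  have fix_s: "survival_op s k = s k" if "k \<in> verts G" for k
    using survival_limit_fixpoint[OF that] by (simp add: s_def)
  define it where "it n = (mean_op ^^ n) s" for n
  have it_Suc: "it (Suc n) = mean_op (it n)" and it_0: "it 0 = s" for n
    by (simp_all add: it_def)
  \<comment> \<open>By the union bound \<open>s = survival_op s \<le> mean_op s\<close>, so the
    iterates increase.\<close>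
  have it_mono: "it n k \<le> it (Suc n) k" if "k \<in> verts G" for n k
    using that
  proof (induction n arbitrary: k)
    case 0
    then show ?case
      using survival_op_le_mean_op[OF s 0] fix_s[OF 0] by (simp add: it_Suc it_0)
  next
    case (Suc n)
    then show ?case unfolding it_Suc[of "Suc n"] it_Suc[of n]
      by (intro mean_op_mono) (auto simp: it_Suc[symmetric])
  qed
  have it_inc: "it n k \<le> it n' k" if "k \<in> verts G" "n \<le> n'" for n n' k
    using lift_Suc_mono_le[of "\<lambda>n. it n k", OF it_mono[OF that(1)] that(2)] .
  have it_ge: "s k \<le> it n k" if "k \<in> verts G" for n k
    using it_inc[OF that, of 0 n] by (simp add: it_0)
  have s_nonneg: "s k \<ge> 0" if "k \<in> verts G" for k
    using s that by (auto simp: type_prob_def)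
  define C where "C = {k \<in> verts G. s k > 0}"
  define Q where "Q = {k \<in> C. \<forall>n. it n k = s k}"
  have finC: "finite C" using finite_verts by (simp add: C_def)
  show False
  proof (cases "Q = {}")
    case False
    have Q_verts: "k \<in> verts G" if "k \<in> Q" for k using that by (simp add: Q_def C_def)
    have mean_eq: "mean_op (it n) k = s k" if "k \<in> Q" for n k
      using that unfolding it_Suc[symmetric] Q_def by blast
    \<comment> \<open>If the iterates rose at a surviving child that occurs with positive
      probability, they would rise at \<open>k\<close> one step later.\<close>
    have closed: "chi k l \<in> Q"
      if "k \<in> Q" "a \<le> deg G k" "pmf (\<D> k) a > 0" "l \<in> {a+1..deg G k}" "s (chi k l) > 0" for k a l
    proof -
      have "it n (chi k l) = s (chi k l)" for n
      proof (rule ccontr)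
        assume ne: "it n (chi k l) \<noteq> s (chi k l)"
        note ch = chi_in_verts[OF Q_verts[OF that(1)]]
        have le: "s (chi k l') \<le> it n (chi k l')" if "l' \<in> {a'+1..deg G k}" for l' a'
          using it_ge[OF ch, of l'] that by auto
        have "s (chi k l) < it n (chi k l)" using ne le[OF that(4)] by linarith
        then have lt: "(\<Sum>l\<in>{a+1..deg G k}. s (chi k l)) < (\<Sum>l\<in>{a+1..deg G k}. it n (chi k l))"
          using that(4) le by (intro sum_strict_mono_ex1) auto
        have "mean_op s k < mean_op (it n) k"
          unfolding mean_op_def
        proof (rule sum_strict_mono_ex1)
          show "\<forall>a\<in>{0..deg G k}. pmf (\<D> k) a * (\<Sum>l\<in>{a+1..deg G k}. s (chi k l)) \<le>
              pmf (\<D> k) a * (\<Sum>l\<in>{a+1..deg G k}. it n (chi k l))"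
            using le by (intro ballI mult_left_mono sum_mono) auto
          show "\<exists>a\<in>{0..deg G k}. pmf (\<D> k) a * (\<Sum>l\<in>{a+1..deg G k}. s (chi k l)) <
              pmf (\<D> k) a * (\<Sum>l\<in>{a+1..deg G k}. it n (chi k l))"
            using that lt by (intro bexI[of _ a]) auto
        qed simp
        then show False using mean_eq[OF that(1), of n] mean_eq[OF that(1), of 0] by (simp add: it_0)
      qed
      then show ?thesis
        using that chi_in_verts[OF Q_verts[OF that(1)], of l] by (auto simp: Q_def C_def)
    qed
    \<comment> \<open>Two surviving children would make the union bound strict and give
      \<open>s k < mean_op s k\<close>, although \<open>k\<close> lies in \<open>Q\<close>.\<close>
    have unique: "l = l'"
      if k: "k \<in> Q" and a: "a \<le> deg G k" "pmf (\<D> k) a > 0" and l: "l \<in> {a+1..deg G k}" "l' \<in> {a+1..deg G k}"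
        and pos: "s (chi k l) > 0" "s (chi k l') > 0" for k a l l'
    proof (rule ccontr)
      assume ne: "l \<noteq> l'"
      note kv = Q_verts[OF k]
      have "survival_op s k < mean_op s k"
        unfolding survival_op_eq[OF kv] mean_op_def
      proof (rule sum_strict_mono_ex1)
        have "1 - (\<Sum>l\<in>{a+1..deg G k}. s (chi k l)) \<le> (\<Prod>l\<in>{a+1..deg G k}. 1 - s (chi k l))" for a
          using type_probD[OF s kv] by (intro prod_one_minus_ge) auto
        then show "\<forall>a\<in>{0..deg G k}. pmf (\<D> k) a * (1 - (\<Prod>l\<in>{a+1..deg G k}. 1 - s (chi k l))) \<le>
            pmf (\<D> k) a * (\<Sum>l\<in>{a+1..deg G k}. s (chi k l))"
          by (intro ballI mult_left_mono) (auto simp: algebra_simps)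
        have "1 - (\<Sum>l\<in>{a+1..deg G k}. s (chi k l)) < (\<Prod>l\<in>{a+1..deg G k}. 1 - s (chi k l))"
          using type_probD[OF s kv] by (intro prod_one_minus_gt[OF _ _ l ne pos]) auto
        then show "\<exists>a\<in>{0..deg G k}. pmf (\<D> k) a * (1 - (\<Prod>l\<in>{a+1..deg G k}. 1 - s (chi k l))) <
            pmf (\<D> k) a * (\<Sum>l\<in>{a+1..deg G k}. s (chi k l))"
          using a by (intro bexI[of _ a] mult_strict_left_mono) auto
      qed simp
      then show False using mean_eq[OF k, of 0] fix_s[OF kv] by (simp add: it_0)
    qed
    have finQ: "finite Q" using finC by (simp add: Q_def)
    define \<mu> where "\<mu> = Max (s ` Q)"
    have \<mu>_ge: "s k \<le> \<mu>" if "k \<in> Q" for k using finQ that by (simp add: \<mu>_def)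
    define C' where "C' = {k \<in> Q. s k = \<mu>}"
    have "\<mu> \<in> s ` Q" unfolding \<mu>_def using finQ False by (intro Max_in) auto
    then have "C' \<noteq> {}" by (auto simp: C'_def)
    have \<mu>_pos: "\<mu> > 0" using \<open>\<mu> \<in> s ` Q\<close> by (auto simp: Q_def C_def)
    \<comment> \<open>The sum \<open>\<sigma>\<close> of \<open>s\<close> over the good children has
      mean \<open>s k = \<mu>\<close> and, with at most one surviving child in \<open>Q\<close>,
      never exceeds \<open>\<mu>\<close> at a rotor position of positive probability. So it equals
      \<open>\<mu>\<close> at all of these, and the one surviving child is again a
      maximiser.\<close>
    have one: "(\<Sum>t\<in>C'. good_children G chi k a t) = 1" if k: "k \<in> C'" and a: "a \<in> set_pmf (\<D> k)" for k a
    proof -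
      have kQ: "k \<in> Q" "s k = \<mu>" using k by (auto simp: C'_def)
      note kv = Q_verts[OF kQ(1)]
      define \<sigma> where "\<sigma> a = (\<Sum>l\<in>{a+1..deg G k}. s (chi k l))" for a
      have s_ge: "s (chi k l) \<ge> 0" if "l \<in> {b+1..deg G k}" for b l
        using type_probD[OF s kv, of l] that by auto
      have \<sigma>_eq: "\<sigma> b = s (chi k l)"
        if "b \<le> deg G k" "pmf (\<D> k) b > 0" "l \<in> {b+1..deg G k}" "s (chi k l) > 0" for b l
      proof -
        have "s (chi k l') = 0" if "l' \<in> {b+1..deg G k} - {l}" for l'
          using unique[OF kQ(1) \<open>b \<le> deg G k\<close> \<open>pmf (\<D> k) b > 0\<close> \<open>l \<in> {b+1..deg G k}\<close>, of l']
            \<open>s (chi k l) > 0\<close> s_ge[of l' b] that by fastforce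
        then have "(\<Sum>l\<in>{b+1..deg G k} - {l}. s (chi k l)) = 0" by (intro sum.neutral) auto
        then show ?thesis using that by (simp add: \<sigma>_def sum.remove[of _ l])
      qed
      have \<sigma>_le: "\<sigma> b \<le> \<mu>" if "b \<le> deg G k" "pmf (\<D> k) b > 0" for b
      proof (cases "\<exists>l\<in>{b+1..deg G k}. s (chi k l) > 0")
        case True
        then obtain l where l: "l \<in> {b+1..deg G k}" "s (chi k l) > 0" by blast
        then show ?thesis using \<sigma>_eq[OF that l] \<mu>_ge[OF closed[OF kQ(1) that l]] by simp
      next
        case False
        have "s (chi k l) = 0" if "l \<in> {b+1..deg G k}" for l
          using False s_ge[OF that] that by (metis order_le_less)
        then have "\<sigma> b = 0" unfolding \<sigma>_def by (intro sum.neutral) auto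
        then show ?thesis using \<mu>_pos by simp
      qed
      have a': "a \<le> deg G k" "pmf (\<D> k) a > 0"
        using a support[of k] kv by (auto simp: verts pmf_positive)
      have "(\<Sum>b=0..deg G k. pmf (\<D> k) b * (\<mu> - \<sigma> b)) = 0"
        using mean_eq[OF kQ(1), of 0] kQ(2) sum_pmf_D[OF kv]
        by (simp add: it_0 mean_op_def \<sigma>_def right_diff_distrib sum_subtractf flip: sum_distrib_right)
      moreover have "0 \<le> pmf (\<D> k) b * (\<mu> - \<sigma> b)" if "b \<in> {0..deg G k}" for b
      proof (cases "pmf (\<D> k) b > 0")
        case True
        then show ?thesis using \<sigma>_le[of b] that by simp
      next
        case False
        then have "pmf (\<D> k) b = 0" using pmf_nonneg[of "\<D> k" b] by linarith
        then show ?thesis by simp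
      qed
      ultimately have "pmf (\<D> k) a * (\<mu> - \<sigma> a) = 0"
        using a'(1) sum_nonneg_0[of "{0..deg G k}" "\<lambda>b. pmf (\<D> k) b * (\<mu> - \<sigma> b)" a] by simp
      then have \<sigma>_a: "\<sigma> a = \<mu>" using a' by simp
      have "\<exists>l\<in>{a+1..deg G k}. s (chi k l) > 0"
      proof (rule ccontr)
        assume "\<not> ?thesis"
        then have "\<sigma> a \<le> 0" unfolding \<sigma>_def by (intro sum_nonpos) (simp add: not_less)
        then show False using \<sigma>_a \<mu>_pos by simp
      qed
      then obtain l where l: "l \<in> {a+1..deg G k}" "s (chi k l) > 0" by blast
      have lC': "chi k l \<in> C'"
        using closed[OF kQ(1) a' l] \<sigma>_eq[OF a' l] \<sigma>_a by (simp add: C'_def)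
      have C'_pos: "s t > 0" if "t \<in> C'" for t
        using that \<mu>_pos by (simp add: C'_def)
      have "{l \<in> {a+1..deg G k}. chi k l \<in> C'} = {l}"
        using l lC' C'_pos unique[OF kQ(1) a'] by blast
      moreover have "(\<Sum>t\<in>C'. good_children G chi k a t) = card {l \<in> {a+1..deg G k}. chi k l \<in> C'}"
      proof -
        have "(\<Sum>t\<in>C'. \<Sum>l\<in>{l\<in>{l \<in> {a+1..deg G k}. chi k l \<in> C'}. chi k l = t}. 1) =
            (\<Sum>l\<in>{l \<in> {a+1..deg G k}. chi k l \<in> C'}. 1::nat)"
          using finQ by (intro sum.group) (auto simp: C'_def)
        moreover have "{l\<in>{l \<in> {a+1..deg G k}. chi k l \<in> C'}. chi k l = t} = {l \<in> {a+1..deg G k}. chi k l = t}"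
          if "t \<in> C'" for t using that by auto
        ultimately show ?thesis by (simp add: good_children_def)
      qed
      ultimately show ?thesis by simp
    qed
    have "singular G chi \<D>"
      unfolding singular_def offspring_def
      using \<open>C' \<noteq> {}\<close> one Q_verts by (intro exI[of _ C']) (auto simp: AE_measure_pmf_iff C'_def)
    with ns show False by blast
  next
    case True
    have "\<forall>k\<in>C. \<exists>n. it n k > s k"
    proof
      fix k assume k: "k \<in> C"
      then obtain n where "it n k \<noteq> s k" using True by (auto simp: Q_def)
      moreover have "s k \<le> it n k" using it_ge k by (simp add: C_def)
      ultimately show "\<exists>n. it n k > s k" by (intro exI[of _ n]) simp
    qed
    then obtain n where n: "\<And>k. k \<in> C \<Longrightarrow> it (n k) k > s k" by metis
    \<comment> \<open>A common number of iterations after which every type in \<open>C\<close> has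
      strictly risen; \<open>x\<close> is then the least growth factor.\<close>
    define N where "N = Suc (Max (n ` C))"
    have N: "it N k > s k" if "k \<in> C" for k
    proof -
      have "n k \<le> N" using finC that by (simp add: N_def le_SucI)
      then show ?thesis using n[OF that] it_inc[of k "n k" N] that by (simp add: C_def)
    qed
    define x where "x = Min ((\<lambda>k. it N k / s k) ` C)"
    have jC: "j \<in> C" using j s_j by (simp add: C_def)
    have "1 < it N k / s k" if "k \<in> C" for k
      using N[OF that] that by (simp add: C_def)
    then have x: "x > 1" "\<And>k. k \<in> C \<Longrightarrow> x \<le> it N k / s k"
      unfolding x_def by (subst Min_gr_iff) (use finC jC in auto)
    have step: "x * s k \<le> it N k" if k: "k \<in> verts G" for k
    proof (cases "k \<in> C")
      case True
      then show ?thesis using x(2)[OF True] by (simp add: C_def pos_le_divide_eq)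
    next
      case False
      then have "s k = 0" using k s_nonneg[OF k] by (simp add: C_def)
      then show ?thesis using it_ge[OF k, of N] by simp
    qed
    have grow: "x ^ r * s k \<le> it (N * r) k" if "k \<in> verts G" for r k
    proof (induction r)
      case (Suc r)
      have "x ^ Suc r * s k \<le> x * it (N * r) k"
        using Suc x(1) by (simp add: mult.assoc)
      also have "\<dots> = (mean_op ^^ (N * r)) (\<lambda>k. x * s k) k"
        by (simp add: it_def mean_op_pow_scale)
      also have "\<dots> \<le> (mean_op ^^ (N * r)) (it N) k"
        by (rule mean_op_pow_mono[OF step that])
      also have "\<dots> = it (N * Suc r) k"
      proof -
        have "N * Suc r = N * r + N" by simp
        then show ?thesis unfolding it_def by (simp only: funpow_add o_apply)
      qed
      finally show ?case .
    qed (simp add: it_0)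
    obtain c1 c2 d where bound: "\<And>n. it n j \<le> c1 + c2 * real n ^ d"
      using mean_op_pow_polynomial_bound[OF r s j] unfolding it_def by blast
    obtain r where "c1 + c2 * real (N * r) ^ d < s j * x ^ r"
      using exponential_not_polynomial[OF x(1) s_j] by metis
    with bound[of "N * r"] grow[OF j, of r] show False by (simp add: mult.commute)
  qed
qed

text \<open>Take the moduli of the entries of an eigenvector whose eigenvalue has modulus
  \<open>c > 1\<close>. The matrix is nonnegative, so the triangle inequality turns the eigenvalue
  equation into the required inequality. Some types may have \<open>f j = 0\<close>.\<close>

lemma superinvariant_vector:
  assumes r: "spectral_radius moment_matrix > 1"
  obtains f c where "c > 1" "\<And>j. f j \<ge> 0" "\<exists>j\<in>verts G. f j > 0"
    "\<And>j. j \<in> verts G \<Longrightarrow> c * f j \<le> mean_op f j"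
proof -
  have m: "m > 0" using root_type verts by simp
  obtain ev where ev: "ev \<in> spectrum moment_matrix" "cmod ev > 1"
    using spectral_radius_mem_max(1)[OF moment_matrix_carrier m] r by auto
  then obtain v where v: "eigenvector moment_matrix v ev"
    by (auto simp: spectrum_def eigenvalue_def)
  then have v_dim: "dim_vec v = m" and v0: "v \<noteq> 0\<^sub>v m" and eq: "moment_matrix *\<^sub>v v = ev \<cdot>\<^sub>v v"
    using moment_matrix_carrier by (auto simp: eigenvector_def)
  define f where "f j = (if j \<in> verts G then cmod (v $ (j - 1)) else 0)" for j
  have f_Suc: "f (Suc a) = cmod (v $ a)" if "a < m" for a
    using that by (simp add: f_def verts)
  have mean_nonneg: "mean_offspring G chi \<D> j k \<ge> 0" for j k
    by (auto simp: mean_offspring_def intro: sum_nonneg)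
  show thesis
  proof (rule that[of "cmod ev" f])
    show "f j \<ge> 0" for j by (simp add: f_def)
    obtain a where "a < m" "v $ a \<noteq> 0"
      using v0 v_dim by (metis eq_vecI index_zero_vec dim_vec)
    then show "\<exists>j\<in>verts G. f j > 0"
      by (intro bexI[of _ "Suc a"]) (auto simp: f_Suc verts)
    fix j assume j: "j \<in> verts G"
    then obtain a where a: "j = Suc a" "a < m" by (cases j) (auto simp: verts)
    have "cmod ev * f j = cmod ((ev \<cdot>\<^sub>v v) $ a)"
      using a v_dim by (simp add: f_Suc norm_mult)
    also have "\<dots> = cmod (\<Sum>b<m. complex_of_real (mean_offspring G chi \<D> j (Suc b)) * v $ b)"
      unfolding eq[symmetric] using a v_dim
      by (simp add: first_moment_matrix_def scalar_prod_def atLeast0LessThan)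
    also have "\<dots> \<le> (\<Sum>b<m. cmod (complex_of_real (mean_offspring G chi \<D> j (Suc b)) * v $ b))"
      by (rule norm_sum)
    also have "\<dots> = mean_op f j"
      unfolding mean_op_matrix[OF j] sum_verts
      using mean_nonneg by (intro sum.cong) (auto simp: norm_mult f_Suc)
    finally show "cmod ev * f j \<le> mean_op f j" .
  qed (rule ev(2))
qed

text \<open>With out-degrees at most 1 there is at most one good child, so \<open>mean_op\<close>
  cannot raise the maximum of \<open>f\<close>, against \<open>c > 1\<close>.\<close>

lemma branching_type_exists:
  assumes "spectral_radius moment_matrix > 1"
  obtains j where "j \<in> verts G" "deg G j \<ge> 2"
proof -
  obtain f c where f: "c > 1" "\<And>j. f j \<ge> 0" "\<exists>j\<in>verts G. f j > 0"
      "\<And>j. j \<in> verts G \<Longrightarrow> c * f j \<le> mean_op f j"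
    using superinvariant_vector[OF assms] by metis
  have "\<exists>j\<in>verts G. deg G j \<ge> 2"
  proof (rule ccontr)
    assume "\<not> ?thesis"
    then have deg: "deg G j \<le> 1" if "j \<in> verts G" for j using that by fastforce
    define \<mu> where "\<mu> = Max (f ` verts G)"
    have "\<mu> \<in> f ` verts G" unfolding \<mu>_def using f(3) finite_verts by (intro Max_in) auto
    then obtain j where j: "j \<in> verts G" "f j = \<mu>" by blast
    have \<mu>: "f k \<le> \<mu>" if "k \<in> verts G" for k using that finite_verts by (simp add: \<mu>_def)
    then have \<mu>_pos: "\<mu> > 0" using f(3) by (meson less_le_trans)
    have "mean_op f j \<le> (\<Sum>k=0..deg G j. pmf (\<D> j) k * \<mu>)"
      unfolding mean_op_def
    proof (intro sum_mono mult_left_mono)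
      fix k
      have "(\<Sum>l\<in>{k+1..deg G j}. f (chi j l)) \<le> (\<Sum>l\<in>{k+1..deg G j}. \<mu>)"
        using chi_in_verts[OF j(1)] by (intro sum_mono \<mu>) auto
      also have "\<dots> \<le> real 1 * \<mu>"
        unfolding sum_constant using deg[OF j(1)] \<mu>_pos by (intro mult_right_mono of_nat_mono) auto
      finally show "(\<Sum>l\<in>{k+1..deg G j}. f (chi j l)) \<le> \<mu>" by simp
    qed simp
    also have "\<dots> = \<mu>" using sum_pmf_D[OF j(1)] by (simp flip: sum_distrib_right)
    finally have "c * \<mu> \<le> 1 * \<mu>" using f(4)[OF j(1)] j(2) by simp
    then show False using f(1) \<mu>_pos by simp
  qed
  with that show thesis by blast
qed

text \<open>A small multiple \<open>s = e * f\<close> satisfies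
  \<open>s \<le> survival_op s\<close>, because the linear gain \<open>(c - 1) * s\<close> outweighs
  the quadratic error. By monotonicity the iterates started from 1 stay above
  \<open>s\<close>.\<close>

lemma survival_positive:
  assumes "spectral_radius moment_matrix > 1"
  obtains b where "b \<in> verts G" "survival_limit b > 0"
proof -
  obtain f c where f: "c > 1" "\<And>j. f j \<ge> 0" "\<exists>j\<in>verts G. f j > 0"
      "\<And>j. j \<in> verts G \<Longrightarrow> c * f j \<le> mean_op f j"
    using superinvariant_vector[OF assms] by metis
  \<comment> \<open>One bound for every \<open>f j\<close> and every sum of \<open>f\<close> over
    good children; the summand 1 keeps it positive.\<close>
  define B where "B = 1 + (\<Sum>j\<in>verts G. f j + (\<Sum>l=1..deg G j. f (chi j l)))"
  have terms: "0 \<le> f j + (\<Sum>l=1..deg G j. f (chi j l))" for j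
    using f(2) by (simp add: sum_nonneg)
  have "0 \<le> (\<Sum>j\<in>verts G. f j + (\<Sum>l=1..deg G j. f (chi j l)))"
    by (intro sum_nonneg terms)
  then have B: "B \<ge> 1" unfolding B_def by linarith
  have B_j: "f j + (\<Sum>l=1..deg G j. f (chi j l)) \<le> B" if "j \<in> verts G" for j
    using member_le_sum[OF that, of "\<lambda>j. f j + (\<Sum>l=1..deg G j. f (chi j l))"] terms finite_verts
    by (simp add: B_def)
  have fB: "f j \<le> B" if "j \<in> verts G" for j
    using B_j[OF that] sum_nonneg[of "{1..deg G j}" "\<lambda>l. f (chi j l)"] f(2) by fastforce
  have sB: "(\<Sum>l\<in>{k+1..deg G j}. f (chi j l)) \<le> B" if "j \<in> verts G" for j k
  proof -
    have "(\<Sum>l\<in>{k+1..deg G j}. f (chi j l)) \<le> (\<Sum>l=1..deg G j. f (chi j l))"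
      using f(2) by (intro sum_mono2) auto
    then show ?thesis using B_j[OF that] f(2)[of j] by linarith
  qed
  define P where "P = {j \<in> verts G. f j > 0}"
  have P: "finite P" "P \<noteq> {}" using finite_verts f(3) by (auto simp: P_def)
  define \<mu> where "\<mu> = Min (f ` P)"
  have \<mu>: "\<mu> > 0" "\<And>j. j \<in> P \<Longrightarrow> \<mu> \<le> f j"
    using P by (auto simp: \<mu>_def P_def)
  \<comment> \<open>The first term keeps \<open>s\<close> at most 1. The second makes the error, the
    square of \<open>e * B\<close>, at most \<open>e * (c - 1) * \<mu>\<close>, with
    \<open>\<mu>\<close> the least positive value of \<open>f\<close>.\<close>
  define e where "e = min (1 / B) ((c - 1) * \<mu> / B\<^sup>2)"
  have e: "e > 0" "e * B \<le> 1" "e * B\<^sup>2 \<le> (c - 1) * \<mu>"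
  proof -
    show "e > 0" using B f(1) \<mu>(1) by (simp add: e_def)
    have "e \<le> 1 / B" "e \<le> (c - 1) * \<mu> / B\<^sup>2" by (simp_all add: e_def)
    then show "e * B \<le> 1" "e * B\<^sup>2 \<le> (c - 1) * \<mu>"
      using B by (simp_all add: pos_le_divide_eq)
  qed
  define s where "s j = e * f j" for j
  have s: "type_prob s"
    unfolding type_prob_def
  proof (intro ballI conjI)
    fix j assume j: "j \<in> verts G"
    show "0 \<le> s j" using e f(2) by (simp add: s_def)
    have "s j \<le> e * B" unfolding s_def using fB[OF j] e(1) by (intro mult_left_mono) auto
    then show "s j \<le> 1" using e(2) by simp
  qed
  have sub: "s j \<le> survival_op s j" if j: "j \<in> verts G" for j
  proof (cases "j \<in> P")
    case False
    then have "s j = 0" using j f(2)[of j] by (simp add: s_def P_def)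
    then show ?thesis using type_prob_survival_op[OF s] j by (simp add: type_prob_def)
  next
    case True
    have "mean_op s j - (e * B)\<^sup>2 = (\<Sum>k=0..deg G j. pmf (\<D> j) k * ((\<Sum>l\<in>{k+1..deg G j}. s (chi j l)) - (e * B)\<^sup>2))"
      using sum_pmf_D[OF j]
      by (simp add: mean_op_def right_diff_distrib sum_subtractf flip: sum_distrib_right)
    also have "\<dots> \<le> survival_op s j"
      unfolding survival_op_eq[OF j]
    proof (intro sum_mono mult_left_mono)
      fix k
      let ?S = "\<Sum>l\<in>{k+1..deg G j}. s (chi j l)"
      have "(\<Prod>l\<in>{k+1..deg G j}. 1 - s (chi j l)) \<le> 1 - ?S + ?S\<^sup>2"
        using type_probD[OF s j] by (intro prod_one_minus_le) auto
      moreover have "?S\<^sup>2 \<le> (e * B)\<^sup>2"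
      proof (rule power_mono)
        have "?S = e * (\<Sum>l\<in>{k+1..deg G j}. f (chi j l))" by (simp add: s_def sum_distrib_left)
        also have "\<dots> \<le> e * B" using sB[OF j] e(1) by (intro mult_left_mono) auto
        finally show "?S \<le> e * B" .
        show "0 \<le> ?S" using type_probD[OF s j] by (intro sum_nonneg) auto
      qed
      ultimately show "?S - (e * B)\<^sup>2 \<le> 1 - (\<Prod>l\<in>{k+1..deg G j}. 1 - s (chi j l))" by linarith
    qed simp
    finally have 1: "mean_op s j - (e * B)\<^sup>2 \<le> survival_op s j" .
    have "(e * B)\<^sup>2 = e * (e * B\<^sup>2)" by (simp add: power2_eq_square)
    also have "\<dots> \<le> e * ((c - 1) * \<mu>)" using e by (intro mult_left_mono) auto
    also have "\<dots> \<le> e * ((c - 1) * f j)" using e(1) f(1) \<mu>(2)[OF True] by (intro mult_left_mono) auto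
    finally have 2: "(e * B)\<^sup>2 \<le> e * ((c - 1) * f j)" .
    have "e * (c * f j) \<le> e * mean_op f j" using e(1) f(4)[OF j] by (intro mult_left_mono) auto
    then have "e * (c * f j) \<le> mean_op s j" unfolding s_def mean_op_scale .
    with 1 2 show ?thesis by (simp add: s_def algebra_simps)
  qed
  have below: "s j \<le> survival h j" if "j \<in> verts G" for h j
    using that
  proof (induction h arbitrary: j)
    case 0
    then show ?case using s by (simp add: type_prob_def)
  next
    case (Suc h)
    have "s j \<le> survival_op s j" by (rule sub[OF Suc.prems])
    also have "\<dots> \<le> survival_op (survival h) j"
      by (rule survival_op_mono[OF s type_prob_survival Suc.IH Suc.prems])
    finally show ?case by (simp add: survival_Suc)
  qed
  obtain b where b: "b \<in> verts G" "f b > 0" using f(3) by blast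
  have "s b \<le> survival_limit b"
    using below[OF b(1)] by (intro LIMSEQ_le_const[OF tendsto_survival_limit[OF b(1)]]) auto
  moreover have "s b > 0" using b e by (simp add: s_def)
  ultimately show thesis using that[OF b(1)] by linarith
qed

end

section \<open>Random rotors\<close>

locale random_rotors = rotor_law G chi i \<D> m + prob_space \<Omega>
  for G :: "(nat, 'e) pre_digraph" and chi :: "nat \<Rightarrow> nat \<Rightarrow> nat" and i :: nat
    and \<D> :: "nat \<Rightarrow> nat pmf" and m :: nat and \<Omega> :: "'w measure" +
  fixes \<rho> :: "vertex \<Rightarrow> 'w \<Rightarrow> nat"
  assumes indep_rotors: "indep_vars (\<lambda>_. count_space UNIV) \<rho> T"
    and distr_rotor: "\<And>x. x \<in> T \<Longrightarrow> distr \<Omega> (count_space UNIV) (\<rho> x) = measure_pmf (\<D> (tau x))"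
begin

abbreviation rotors_at :: "'w \<Rightarrow> rotors" where "rotors_at \<omega> \<equiv> \<lambda>x. \<rho> x \<omega>"

definition below :: "vertex \<Rightarrow> vertex set" where
  "below x = {y \<in> T. suffix x y}"

abbreviation "rotor_space K \<equiv> PiM K (\<lambda>_::vertex. count_space (UNIV :: nat set))"

lemma measurable_rotor: "x \<in> T \<Longrightarrow> \<rho> x \<in> measurable \<Omega> (count_space UNIV)"
  using indep_rotors by (auto simp: indep_vars_def)

lemma prob_rotor: "x \<in> T \<Longrightarrow> prob {\<omega> \<in> space \<Omega>. \<rho> x \<omega> \<in> A} = measure_pmf.prob (\<D> (tau x)) A"
  using measure_distr[OF measurable_rotor, of x A] distr_rotor[of x]
  by (simp add: vimage_def Int_def conj_commute)

lemma AE_admissible: "AE \<omega> in \<Omega>. admissible (rotors_at \<omega>)"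
proof -
  have "AE \<omega> in \<Omega>. \<rho> x \<omega> \<le> nch x" if x: "x \<in> T" for x
  proof -
    have "set_pmf (\<D> (tau x)) \<subseteq> {0..nch x}"
      using support tau_in_verts[OF x] verts by (simp add: nchildren_def)
    then have "AE k in measure_pmf (\<D> (tau x)). k \<le> nch x"
      by (intro AE_pmfI) auto
    then have "AE k in distr \<Omega> (count_space UNIV) (\<rho> x). k \<le> nch x"
      by (simp only: distr_rotor[OF x])
    then show ?thesis
      using AE_distrD[OF measurable_rotor[OF x]] by blast
  qed
  then have "AE \<omega> in \<Omega>. \<forall>x\<in>T. \<rho> x \<omega> \<le> nch x"
    by (subst AE_ball_countable) auto
  then show ?thesis by (simp add: admissible_def)
qed

lemma below_Cons: "below (l # x) \<subseteq> below x"
  by (auto simp: below_def dest: suffix_ConsD)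

text \<open>Good paths from \<open>x\<close> involve only rotors in its subtree, which is what gives
  independence over disjoint subtrees.\<close>

lemma gpath_restrict:
  assumes "x \<in> T" "below x \<subseteq> K"
  shows "gpath h (restrict f K) x = gpath h f x"
  using assms
proof (induction h arbitrary: x)
  case (Suc h)
  have "x \<in> K" using Suc.prems by (auto simp: below_def)
  then have "restrict f K x = f x" by simp
  moreover have "gpath h (restrict f K) (l # x) = gpath h f (l # x)" if "l \<in> {1..nch x}" for l
    using Suc.prems below_Cons[of l x] that by (intro Suc.IH child_in_T) auto
  ultimately show ?case by (simp only: good_path.simps cong: bex_cong)
qed simp

lemma measurable_gpath:
  assumes "x \<in> T" "below x \<subseteq> K"
  shows "{f \<in> space (rotor_space K). gpath h f x} \<in> sets (rotor_space K)"
  using assms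
proof (induction h arbitrary: x)
  case 0
  show ?case by simp
next
  case (Suc h)
  have x: "x \<in> K" using Suc.prems by (auto simp: below_def)
  have "{f \<in> space (rotor_space K). f x < l} \<in> sets (rotor_space K)" for l
    using measurable_sets[OF measurable_component_singleton[OF x, of "\<lambda>_. count_space UNIV"], of "{..<l}"]
    by (simp add: vimage_def Int_def conj_commute)
  moreover have "{f \<in> space (rotor_space K). gpath h f (l # x)} \<in> sets (rotor_space K)"
    if "l \<in> {1..nch x}" for l
    using Suc.prems below_Cons[of l x] that by (intro Suc.IH child_in_T) auto
  ultimately have "(\<Union>l\<in>{1..nch x}. {f \<in> space (rotor_space K). f x < l} \<inter>
      {f \<in> space (rotor_space K). gpath h f (l # x)}) \<in> sets (rotor_space K)"
    by (intro sets.finite_UN sets.Int) auto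
  also have "(\<Union>l\<in>{1..nch x}. {f \<in> space (rotor_space K). f x < l} \<inter>
      {f \<in> space (rotor_space K). gpath h f (l # x)}) = {f \<in> space (rotor_space K). gpath (Suc h) f x}"
    by auto
  finally show ?case .
qed

lemma live_restrict: "x \<in> T \<Longrightarrow> live (restrict f (below x)) x = live f x"
  by (simp add: live_def gpath_restrict)

lemma measurable_live:
  assumes "x \<in> T"
  shows "{f \<in> space (rotor_space (below x)). live f x} \<in> sets (rotor_space (below x))"
  unfolding live_def using measurable_gpath[OF assms] by (intro sets.sets_Collect_countable_All) auto

lemma measurable_restrict_rotors:
  "K \<subseteq> T \<Longrightarrow> (\<lambda>\<omega>. restrict (rotors_at \<omega>) K) \<in> measurable \<Omega> (rotor_space K)"
  by (intro measurable_restrict measurable_rotor) auto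

lemma below_subset: "below x \<subseteq> T"
  by (auto simp: below_def)

lemma gpath_event:
  assumes x: "x \<in> T"
  shows "{\<omega> \<in> space \<Omega>. gpath h (rotors_at \<omega>) x} \<in> events"
proof -
  note m = measurable_restrict_rotors[OF below_subset[of x]]
  have "{\<omega> \<in> space \<Omega>. gpath h (rotors_at \<omega>) x} = (\<lambda>\<omega>. restrict (rotors_at \<omega>) (below x)) -`
      {f \<in> space (rotor_space (below x)). gpath h f x} \<inter> space \<Omega>"
    using measurable_space[OF m] gpath_restrict[OF x subset_refl] by blast
  also have "\<dots> \<in> events"
    by (rule measurable_sets[OF m measurable_gpath[OF x subset_refl]])
  finally show ?thesis .
qed

lemma live_event: "x \<in> T \<Longrightarrow> {\<omega> \<in> space \<Omega>. live (rotors_at \<omega>) x} \<in> events"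
  unfolding live_def using gpath_event by (intro sets.sets_Collect_countable_All) auto

lemma prob_no_gpath_step:
  assumes x: "x \<in> T" and k: "k \<le> nch x"
  shows "prob {\<omega> \<in> space \<Omega>. \<rho> x \<omega> = k \<and> (\<forall>l\<in>{k+1..nch x}. \<not> gpath h (rotors_at \<omega>) (l # x))} =
    pmf (\<D> (tau x)) k * (\<Prod>l\<in>{k+1..nch x}. 1 - prob {\<omega> \<in> space \<Omega>. gpath h (rotors_at \<omega>) (l # x)})"
proof -
  \<comment> \<open>Index 0 is free, since children are numbered from 1; it stands for the rotor at
    \<open>x\<close> itself, and \<open>l\<close> for the subtree of the child
    \<open>l # x\<close>.\<close>
  define K where "K l = (if l = 0 then {x} else below (l # x))" for l
  define J where "J = insert 0 {k+1..nch x}"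
  define Y where "Y l \<omega> = restrict (rotors_at \<omega>) (K l)" for l \<omega>
  define A where "A l = (if l = 0 then {f \<in> space (rotor_space (K 0)). f x = k}
    else {f \<in> space (rotor_space (K l)). \<not> gpath h f (l # x)})" for l
  have child: "l # x \<in> T" if "l \<in> {k+1..nch x}" for l
    using that x by (simp add: Cons_in_T)
  have K: "K l \<subseteq> T" for l using x by (auto simp: K_def below_def)
  have "disjoint_family_on K J"
    unfolding disjoint_family_on_def
  proof (intro ballI impI)
    fix a b assume ab: "a \<in> J" "b \<in> J" "a \<noteq> b"
    have "x \<notin> below (l # x)" for l
      using suffix_length_le[of "l # x" x] by (auto simp: below_def)
    moreover have "below (a # x) \<inter> below (b # x) = {}"
      using ab(3) suffix_siblings[of a x _ b] by (auto simp: below_def)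
    ultimately show "K a \<inter> K b = {}" using ab(3) by (auto simp: K_def)
  qed
  then have indep: "indep_vars (\<lambda>l. rotor_space (K l)) Y J"
    unfolding Y_def using K by (intro indep_vars_restrict[OF indep_rotors]) auto
  have A: "A l \<in> sets (rotor_space (K l))" if "l \<in> J" for l
  proof (cases "l = 0")
    case True
    then show ?thesis
      using measurable_sets[OF measurable_component_singleton[of x "K 0" "\<lambda>_. count_space UNIV"], of "{k}"]
      by (simp add: A_def K_def vimage_def Int_def conj_commute)
  next
    case False
    then have "l \<in> {k+1..nch x}" using that by (simp add: J_def)
    then have "{f \<in> space (rotor_space (K l)). gpath h f (l # x)} \<in> sets (rotor_space (K l))"
      using child False by (intro measurable_gpath) (auto simp: K_def)
    then show ?thesis using False by (simp add: A_def sets.sets_Collect_neg)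
  qed
  have sp: "Y l \<omega> \<in> space (rotor_space (K l))" if "\<omega> \<in> space \<Omega>" for l \<omega>
    using measurable_space[OF measurable_restrict_rotors[OF K[of l]] that] by (simp add: Y_def)
  have Y0: "Y 0 -` A 0 \<inter> space \<Omega> = {\<omega> \<in> space \<Omega>. \<rho> x \<omega> \<in> {k}}"
    using sp[of _ 0] by (auto simp: A_def Y_def K_def)
  have Yl: "Y l -` A l \<inter> space \<Omega> = space \<Omega> - {\<omega> \<in> space \<Omega>. gpath h (rotors_at \<omega>) (l # x)}"
    if l: "l \<in> {k+1..nch x}" for l
  proof -
    have "gpath h (Y l \<omega>) (l # x) = gpath h (rotors_at \<omega>) (l # x)" for \<omega>
      unfolding Y_def using child[OF l] l by (intro gpath_restrict) (auto simp: K_def)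
    then show ?thesis using sp[of _ l] l by (auto simp: A_def)
  qed
  have "{\<omega> \<in> space \<Omega>. \<rho> x \<omega> = k \<and> (\<forall>l\<in>{k+1..nch x}. \<not> gpath h (rotors_at \<omega>) (l # x))} =
      (\<Inter>l\<in>J. Y l -` A l \<inter> space \<Omega>)"
    unfolding J_def by (simp add: Y0 Yl) auto
  also have "prob \<dots> = (\<Prod>l\<in>J. prob (Y l -` A l \<inter> space \<Omega>))"
    using A by (intro indep_varsD_finite[OF indep]) (auto simp: J_def)
  also have "\<dots> = prob (Y 0 -` A 0 \<inter> space \<Omega>) * (\<Prod>l\<in>{k+1..nch x}. prob (Y l -` A l \<inter> space \<Omega>))"
    unfolding J_def by (subst prod.insert) auto
  also have "prob (Y 0 -` A 0 \<inter> space \<Omega>) = pmf (\<D> (tau x)) k"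
    unfolding Y0 prob_rotor[OF x] by (simp add: measure_pmf_single)
  also have "(\<Prod>l\<in>{k+1..nch x}. prob (Y l -` A l \<inter> space \<Omega>)) =
      (\<Prod>l\<in>{k+1..nch x}. 1 - prob {\<omega> \<in> space \<Omega>. gpath h (rotors_at \<omega>) (l # x)})"
    using child by (intro prod.cong refl) (simp only: Yl prob_compl gpath_event)
  finally show ?thesis .
qed

lemma prob_gpath:
  assumes "x \<in> T"
  shows "prob {\<omega> \<in> space \<Omega>. gpath h (rotors_at \<omega>) x} = survival h (tau x)"
  using assms
proof (induction h arbitrary: x)
  case 0
  then show ?case by (simp add: prob_space)
next
  case (Suc h)
  note x = Suc.prems
  define B where "B k = {\<omega> \<in> space \<Omega>. \<rho> x \<omega> = k \<and> (\<forall>l\<in>{k+1..nch x}. \<not> gpath h (rotors_at \<omega>) (l # x))}" for k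
  have B: "B k \<in> events" for k
  proof -
    have "{\<omega> \<in> space \<Omega>. \<rho> x \<omega> = k} \<in> events"
      using measurable_sets[OF measurable_rotor[OF x], of "{k}"]
      by (simp add: vimage_def Int_def conj_commute)
    moreover have "{\<omega> \<in> space \<Omega>. \<forall>l\<in>{k+1..nch x}. \<not> gpath h (rotors_at \<omega>) (l # x)} \<in> events"
      using child_in_T[OF x] by (intro sets.sets_Collect_finite_All sets.sets_Collect_neg gpath_event) auto
    ultimately have "{\<omega> \<in> space \<Omega>. \<rho> x \<omega> = k} \<inter>
        {\<omega> \<in> space \<Omega>. \<forall>l\<in>{k+1..nch x}. \<not> gpath h (rotors_at \<omega>) (l # x)} \<in> events"
      by (rule sets.Int)
    moreover have "B k = {\<omega> \<in> space \<Omega>. \<rho> x \<omega> = k} \<inter>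
        {\<omega> \<in> space \<Omega>. \<forall>l\<in>{k+1..nch x}. \<not> gpath h (rotors_at \<omega>) (l # x)}"
      by (auto simp: B_def)
    ultimately show ?thesis by simp
  qed
  have "1 - prob {\<omega> \<in> space \<Omega>. gpath (Suc h) (rotors_at \<omega>) x} =
      prob (space \<Omega> - {\<omega> \<in> space \<Omega>. gpath (Suc h) (rotors_at \<omega>) x})"
    using prob_compl[OF gpath_event[OF x, of "Suc h"]] by linarith
  also have "\<dots> = prob (\<Union>k\<in>{0..nch x}. B k)"
  \<comment> \<open>The events agree only almost surely: a rotor value above \<open>nch x\<close>,
    of probability 0, belongs to no \<open>B k\<close> in the union.\<close>
  proof (rule finite_measure_eq_AE)
    show "AE \<omega> in \<Omega>. \<omega> \<in> space \<Omega> - {\<omega> \<in> space \<Omega>. gpath (Suc h) (rotors_at \<omega>) x} \<longleftrightarrow>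
        \<omega> \<in> (\<Union>k\<in>{0..nch x}. B k)"
      using AE_admissible AE_space
    proof eventually_elim
      case (elim \<omega>)
      then have "\<rho> x \<omega> \<le> nch x" using x by (simp add: admissible_def)
      then show ?case using elim(2) by (auto simp: B_def)
    qed
    show "space \<Omega> - {\<omega> \<in> space \<Omega>. gpath (Suc h) (rotors_at \<omega>) x} \<in> events"
      by (intro sets.Diff sets.top gpath_event x)
  qed (use B in auto)
  also have "\<dots> = (\<Sum>k=0..nch x. prob (B k))"
    using B by (intro finite_measure_finite_Union) (auto simp: disjoint_family_on_def B_def)
  also have "\<dots> = (\<Sum>k=0..nch x. pmf (\<D> (tau x)) k * (\<Prod>l\<in>{k+1..nch x}. 1 - survival h (tau (l # x))))"
  proof (rule sum.cong)
    fix k assume k: "k \<in> {0..nch x}"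
    have "(\<Prod>l\<in>{k+1..nch x}. 1 - prob {\<omega> \<in> space \<Omega>. gpath h (rotors_at \<omega>) (l # x)}) =
        (\<Prod>l\<in>{k+1..nch x}. 1 - survival h (tau (l # x)))"
      using child_in_T[OF x] Suc.IH by (intro prod.cong refl) auto
    then show "prob (B k) = pmf (\<D> (tau x)) k * (\<Prod>l\<in>{k+1..nch x}. 1 - survival h (tau (l # x)))"
      unfolding B_def using prob_no_gpath_step[OF x, of k h] k by simp
  qed simp
  moreover have "survival (Suc h) (tau x) =
      1 - (\<Sum>k=0..nch x. pmf (\<D> (tau x)) k * (\<Prod>l\<in>{k+1..nch x}. 1 - survival h (tau (l # x))))"
    by (simp add: survival_Suc survival_op_def nchildren_def)
  ultimately show ?case by linarith
qed

lemma prob_live: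
  assumes x: "x \<in> T"
  shows "prob {\<omega> \<in> space \<Omega>. live (rotors_at \<omega>) x} = survival_limit (tau x)"
proof (rule LIMSEQ_unique)
  have dec: "gpath h r y" if "gpath (Suc h) r y" for h r y
    using that by (induction h arbitrary: y) auto
  have "(\<lambda>h. prob {\<omega> \<in> space \<Omega>. gpath h (rotors_at \<omega>) x}) \<longlonglongrightarrow>
      prob (\<Inter>h. {\<omega> \<in> space \<Omega>. gpath h (rotors_at \<omega>) x})"
    using gpath_event[OF x] dec by (intro finite_Lim_measure_decseq decseq_SucI) blast+
  moreover have "(\<Inter>h. {\<omega> \<in> space \<Omega>. gpath h (rotors_at \<omega>) x}) = {\<omega> \<in> space \<Omega>. live (rotors_at \<omega>) x}"
    by (auto simp: live_def)
  ultimately show "(\<lambda>h. survival h (tau x)) \<longlonglongrightarrow> prob {\<omega> \<in> space \<Omega>. live (rotors_at \<omega>) x}"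
    using prob_gpath[OF x] by simp
qed (rule tendsto_survival_limit[OF tau_in_verts[OF x]])

theorem recurrence:
  assumes "spectral_radius moment_matrix \<le> 1" "\<not> singular G chi \<D>"
  shows "AE \<omega> in \<Omega>. \<forall>n. escape_count G chi i (rotors_at \<omega>) n = 0"
proof -
  have "AE \<omega> in \<Omega>. \<not> live (rotors_at \<omega>) x" if x: "x \<in> T" for x
  proof -
    have "prob {\<omega> \<in> space \<Omega>. live (rotors_at \<omega>) x} = 0"
      using prob_live[OF x] extinction[OF assms tau_in_verts[OF x]] by simp
    then have "AE \<omega> in \<Omega>. \<omega> \<notin> {\<omega> \<in> space \<Omega>. live (rotors_at \<omega>) x}"
      using live_event[OF x] by (simp add: prob_eq_0)
    then show ?thesis using AE_space by eventually_elim auto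
  qed
  then have "AE \<omega> in \<Omega>. \<forall>x\<in>T. \<not> live (rotors_at \<omega>) x"
    by (subst AE_ball_countable) auto
  then show ?thesis
    using AE_admissible by eventually_elim (use no_live_escape_count in blast)
qed

text \<open>The leaves are live independently with probability \<open>survival_limit b\<close>.
  Hoeffding's inequality makes a shortfall of half the mean summably unlikely in \<open>k\<close>,
  and Borel-Cantelli applies.\<close>

lemma many_live_leaves:
  assumes emb: "binary_embedding G chi i b v1 v2 w l1 l2" and q: "survival_limit b > 0"
    and x: "x \<in> T" "tau x = b"
  shows "AE \<omega> in \<Omega>. eventually (\<lambda>k. survival_limit b / 2 * 2 ^ k \<le>
    real (card {z \<in> binary_embedding.leaves v1 v2 w l1 l2 k x. live (rotors_at \<omega>) z})) sequentially"
proof -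
  interpret binary_embedding G chi i b v1 v2 w l1 l2 by (rule emb)
  define q where "q = survival_limit b"
  have q_pos: "q > 0" using q by (simp add: q_def)
  define X :: "vertex \<Rightarrow> 'w \<Rightarrow> real" where "X z \<omega> = of_bool (live (rotors_at \<omega>) z)" for z \<omega>
  define F where "F k = {\<omega> \<in> space \<Omega>. (\<Sum>z\<in>leaves k x. X z \<omega>) \<le> q * 2 ^ k - q / 2 * 2 ^ k}" for k
  have leaf: "z \<in> T" "tau z = b" if "z \<in> leaves k x" for z k
    using leaves_type[OF that x] by auto
  have X_meas: "X z \<in> borel_measurable \<Omega>" if "z \<in> T" for z
    unfolding X_def of_bool_def using live_event[OF that] by (intro measurable_If) auto
  have X_exp: "expectation (X z) = q" if "z \<in> leaves k x" for z k
  proof -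
    have "expectation (X z) = expectation (indicat_real {\<omega> \<in> space \<Omega>. live (rotors_at \<omega>) z})"
      by (intro Bochner_Integration.integral_cong) (auto simp: X_def indicator_def)
    also have "\<dots> = q"
      using live_event prob_live leaf[OF that] by (simp add: q_def)
    finally show ?thesis .
  qed
  have tail: "prob (F k) \<le> exp (- (q\<^sup>2 / 2)) ^ k" for k
  proof -
    have indep: "indep_vars (\<lambda>_. borel) X (leaves k x)"
    proof -
      have "disjoint_family_on below (leaves k x)"
        using leaves_incomparable by (auto simp: disjoint_family_on_def below_def)
      then have "indep_vars (\<lambda>z. rotor_space (below z)) (\<lambda>z \<omega>. restrict (rotors_at \<omega>) (below z)) (leaves k x)"
        using below_subset by (intro indep_vars_restrict[OF indep_rotors]) auto
      then have "indep_vars (\<lambda>_. borel) (\<lambda>z \<omega>. of_bool (live (restrict (rotors_at \<omega>) (below z)) z) :: real) (leaves k x)"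
      proof (rule indep_vars_compose2)
        fix z assume "z \<in> leaves k x"
        then have "{f \<in> space (rotor_space (below z)). live f z} \<in> sets (rotor_space (below z))"
          using leaf by (intro measurable_live)
        then show "(\<lambda>f. of_bool (live f z) :: real) \<in> borel_measurable (rotor_space (below z))"
          unfolding of_bool_def by (intro measurable_If) auto
      qed
      then show ?thesis
        by (rule indep_vars_cong[THEN iffD1, rotated -1]) (auto simp: X_def fun_eq_iff live_restrict leaf)
    qed
    interpret Hoeffding_ineq \<Omega> "leaves k x" X "\<lambda>_. 0" "\<lambda>_. 1" "\<Sum>z\<in>leaves k x. expectation (X z)"
      by unfold_locales (auto simp: indep X_def)
    have mean: "(\<Sum>z\<in>leaves k x. expectation (X z)) = q * 2 ^ k"
      by (simp add: X_exp card_leaves)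
    have "prob (F k) \<le> exp (- 2 * (q / 2 * 2 ^ k)\<^sup>2 / (\<Sum>z\<in>leaves k x. (1 - 0)\<^sup>2))"
      using Hoeffding_ineq_le[of "q / 2 * 2 ^ k"] q_pos unfolding F_def mean by (simp add: card_leaves)
    also have "- 2 * (q / 2 * 2 ^ k)\<^sup>2 / (\<Sum>z\<in>leaves k x. (1 - 0)\<^sup>2) = - (q\<^sup>2 / 2 * 2 ^ k)"
      by (simp add: card_leaves power2_eq_square)
    \<comment> \<open>The tail is doubly exponential in \<open>k\<close>;
      \<open>k \<le> 2 ^ k\<close> weakens it to a geometric sequence, which is enough for
      summability.\<close>
    also have "exp (- (q\<^sup>2 / 2 * 2 ^ k)) \<le> exp (real k * - (q\<^sup>2 / 2))"
    proof -
      have "real k \<le> 2 ^ k" using less_exp[of k] by (metis less_imp_le of_nat_le_iff of_nat_numeral of_nat_power)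
      then have "q\<^sup>2 / 2 * real k \<le> q\<^sup>2 / 2 * 2 ^ k" by (intro mult_left_mono) auto
      then show ?thesis by (simp add: mult.commute)
    qed
    also have "\<dots> = exp (- (q\<^sup>2 / 2)) ^ k" by (rule exp_of_nat_mult)
    finally show ?thesis .
  qed
  have F: "F k \<in> events" for k
    unfolding F_def using leaf by (intro borel_measurable_le borel_measurable_sum X_meas) auto
  have "summable (\<lambda>k. exp (- (q\<^sup>2 / 2)) ^ k)"
    using q_pos by (intro summable_geometric) auto
  then have "summable (\<lambda>k. prob (F k))"
    by (rule summable_comparison_test'[of _ 0]) (simp add: tail)
  then have "AE \<omega> in \<Omega>. eventually (\<lambda>k. \<omega> \<in> space \<Omega> - F k) sequentially"
    using F by (intro borel_cantelli_AE1) (auto simp: emeasure_eq_measure)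
  then show ?thesis
  proof eventually_elim
    case (elim \<omega>)
    then show ?case
    proof eventually_elim
      case (elim k)
      then have "q / 2 * 2 ^ k \<le> (\<Sum>z\<in>leaves k x. X z \<omega>)"
        by (auto simp: F_def)
      also have "\<dots> = real (card {z \<in> leaves k x. live (rotors_at \<omega>) z})"
        by (simp add: X_def Int_def)
      finally show ?case by (simp add: q_def)
    qed
  qed
qed

theorem transience:
  assumes r: "spectral_radius moment_matrix > 1"
  shows "AE \<omega> in \<Omega>. (\<lambda>n. real (escape_count G chi i (rotors_at \<omega>) n) / real n) \<longlonglongrightarrow> srw_escape_prob G chi i"
proof -
  obtain j where j: "j \<in> verts G" "deg G j \<ge> 2" by (rule branching_type_exists[OF r])
  obtain b where b: "b \<in> verts G" "survival_limit b > 0" by (rule survival_positive[OF r])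
  obtain v1 v2 w where emb: "binary_embedding G chi i b v1 v2 w 1 2"
    using binary_embedding_exists[OF b(1) j] by blast
  interpret binary_embedding G chi i b v1 v2 w 1 2 by (rule emb)
  \<comment> \<open>\<open>escape_rate\<close> asks for the bound at every vertex of type
    \<open>b\<close>, so the exceptional null sets are united over these countably many
    vertices.\<close>
  have "AE \<omega> in \<Omega>. \<forall>x\<in>{x \<in> T. tau x = b}. eventually (\<lambda>k. survival_limit b / 2 * 2 ^ k \<le>
      real (card {z \<in> leaves k x. live (rotors_at \<omega>) z})) sequentially"
    by (subst AE_ball_countable) (use many_live_leaves[OF emb b(2)] in auto)
  then show ?thesis
    using AE_admissible
  proof eventually_elim
    case (elim \<omega>)
    define c where "c = survival_limit b / 2 / (2 * (1 + 4 * real stride))"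
    have "c > 0" unfolding c_def using b(2) by (intro divide_pos_pos mult_pos_pos add_pos_nonneg) auto
    moreover have "\<exists>K. \<forall>U D E. flow (rotors_at \<omega>) U D E \<longrightarrow> c * real (U x) - K \<le> real (E x)"
      if "x \<in> T" "tau x = b" for x
      unfolding c_def using that b(2) elim(1)
      by (intro linear_escape_if_eventually_many_live_leaves) auto
    ultimately have "(\<lambda>n. real (escape_count G chi i (rotors_at \<omega>) n) / real n) \<longlonglongrightarrow> tree_escape i"
      using escape_rate[OF elim(2) b(1)] by blast
    then show ?case by (simp only: srw_escape_prob_eq)
  qed
qed

end

theorem theorem3p5:
  fixes G :: "(nat, 'e) pre_digraph" and m i :: nat
    and chi :: "nat \<Rightarrow> nat \<Rightarrow> nat" and \<D> :: "nat \<Rightarrow> nat pmf"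
    and \<Omega> :: "'w measure" and \<rho> :: "nat list \<Rightarrow> 'w \<Rightarrow> nat"
  assumes "fin_digraph G" and "strongly_connected G" and "verts G = {1..m}"
    and "generation_function G chi"
    and "\<And>j. j \<in> {1..m} \<Longrightarrow> set_pmf (\<D> j) \<subseteq> {0..deg G j}"
    and "i \<in> {1..m}"
    and "prob_space \<Omega>"
    and "prob_space.indep_vars \<Omega> (\<lambda>_. count_space UNIV) \<rho> (directed_cover G chi i)"
    and "\<And>x. x \<in> directed_cover G chi i \<Longrightarrow>
           distr \<Omega> (count_space UNIV) (\<rho> x) = measure_pmf (\<D> (vtype chi i x))"
  shows "AE \<omega> in \<Omega>.
      (spectral_radius (first_moment_matrix G chi \<D> m) \<le> 1 \<and> \<not> singular G chi \<D> \<longrightarrow>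
         (\<forall>n. escape_count G chi i (\<lambda>x. \<rho> x \<omega>) n = 0)) \<and>
      (spectral_radius (first_moment_matrix G chi \<D> m) > 1 \<longrightarrow>
         (\<lambda>n. real (escape_count G chi i (\<lambda>x. \<rho> x \<omega>) n) / real n)
           \<longlonglongrightarrow> srw_escape_prob G chi i)"
proof -
  interpret prob_space \<Omega> by fact
  interpret random_rotors G chi i \<D> m \<Omega> \<rho>
    by (intro random_rotors.intro rotor_law.intro cover.intro rotor_law_axioms.intro
        random_rotors_axioms.intro prob_space_axioms) (simp_all only: assms)
  show ?thesis
  proof (rule AE_conjI)
    show "AE \<omega> in \<Omega>. spectral_radius moment_matrix \<le> 1 \<and> \<not> singular G chi \<D> \<longrightarrow>
        (\<forall>n. escape_count G chi i (\<lambda>x. \<rho> x \<omega>) n = 0)"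
      by simp (use recurrence in blast)
    show "AE \<omega> in \<Omega>. 1 < spectral_radius moment_matrix \<longrightarrow>
        (\<lambda>n. real (escape_count G chi i (\<lambda>x. \<rho> x \<omega>) n) / real n) \<longlonglongrightarrow> srw_escape_prob G chi i"
      by simp (use transience in blast)
  qed
qed

end
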